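(* Let $\Omega=(0,1)$, let $0<\mu^+<\infty$, $\mathcal P:=[0,\mu^+]$, $|\mathcal P|=\mu^+$, and let $f\in L_2(\Omega)$. For $s\in(1,2)$ and $\mu\in\mathcal P$ let $u_s(\mu)\in V_s:=\widetilde H^{s/2}(\Omega)$ be the unique solution of the variational form of $-{}_0\mathcal D_x^{s}u+\mu u=f$, i.e. $$-\big({}_0\mathcal D_x^{s/2}u_s(\mu),\ {}_x\mathcal D_1^{s/2}v\big)_{L_2(\Omega)}+\mu\,(u_s(\mu),v)_{L_2(\Omega)}=(f,v)_{L_2(\Omega)}\quad\text{for all }v\in V_s .$$ Let $$d_n(\mathcal P):=\inf_{\substack{V_n\subset V_s\\ \dim V_n=n}}\ \sup_{\mu\in\mathcal P}\ \inf_{v_n\in V_n}\|u_s(\mu)-v_n\|_{V_s}$$ be the Kolmogorov $n$-width. Then there exist a constant $c>0$ (independent of $s$ and $n$) and constants $C_s$ depending on $s$ (independent of $n$), with $C_s\to\infty$ as $s\to1$, such that for all $s\in(1,2)$ and all $n\in\mathbb N$ $$d_n(\mathcal P)\ \le\ C_s\,\exp\Big\{-c\,\frac{\alpha_s\,n}{|\mathcal P|}\Big\},$$ where $\alpha_s:=|\cos(s\tfrac\pi2)|\,\tfrac{\Gamma(s/2+1)^4}{8}$ is the coercivity constant of $-{}_0\mathcal D_x^{s}$.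
   Context: All functions are real valued and $\Omega=(0,1)$. For $\sigma\ge 0$, $\widetilde H^\sigma(\Omega)$ is the closure of $C_0^\infty(\Omega)$ in $H^\sigma(\mathbb R)$ (functions identified with their extensions by zero), with norm $\|\varphi\|_{\widetilde H^\sigma(\Omega)}^2=\|\varphi\|_{H^\sigma(\mathbb R)}^2=\int_{\mathbb R}(1+|\omega|^2)^\sigma|\mathcal F\varphi(\omega)|^2\,d\omega$, where $\mathcal F$ is the unitary Fourier transform. For $\sigma\in(0,1)$ and $\varphi\in C_0^\infty(\Omega)$ the left- and right-sided Riemann–Liouville derivatives are $${}_0\mathcal D_x^{\sigma}\varphi(x)=\frac{d}{dx}\,\frac1{\Gamma(1-\sigma)}\int_0^x(x-t)^{-\sigma}\varphi(t)\,dt,\qquad {}_x\mathcal D_1^{\sigma}\varphi(x)=-\frac{d}{dx}\,\frac1{\Gamma(1-\sigma)}\int_x^1(t-x)^{-\sigma}\varphi(t)\,dt .$$ Both extend to bounded linear operators $\widetilde H^\sigma(\Omega)\to L_2(\Omega)$, denoted by the same symbols. The bilinear form $-({}_0\mathcal D_x^{s/2}u,{}_x\mathcal D_1^{s/2}v)_{L_2(\Omega)}$ is bounded on $\widetilde H^{s/2}(\Omega)$ and coercive with constant $\alpha_s$, so $u_s(\mu)$ is well defined for every $\mu\ge0$. The infimum in $d_n(\mathcal P)$ is over linear subspaces of dimension $n$. *)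

theory Defs
  imports "HOL-Analysis.Analysis"
begin

text \<open>
  Square-integrable functions are represented by functions on the real line; two representatives
  that agree almost everywhere denote the same element, so vector-space notions (linear
  independence, dimension) are taken modulo null sets. Functions on \<open>(0,1)\<close> that are regarded as
  elements of a Sobolev space are extended by zero.
\<close>

definition Omega :: "real set" where
  "Omega = {0<..<1}"

definition L2_Omega :: "(real \<Rightarrow> real) set" where
  "L2_Omega = {g. set_borel_measurable lborel Omega g \<and>
                  set_integrable lborel Omega (\<lambda>x. (g x)\<^sup>2)}"

definition L2_inner :: "(real \<Rightarrow> real) \<Rightarrow> (real \<Rightarrow> real) \<Rightarrow> real" where
  "L2_inner g h = (LINT x:Omega|lborel. g x * h x)"

definition L2_norm :: "(real \<Rightarrow> real) \<Rightarrow> real" where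
  "L2_norm g = sqrt (L2_inner g g)"

definition test_functions :: "(real \<Rightarrow> real) set" where
  "test_functions =
     {\<phi>. (\<forall>k x. ((deriv ^^ k) \<phi>) field_differentiable (at x)) \<and>
          compact (closure {x. \<phi> x \<noteq> 0}) \<and> closure {x. \<phi> x \<noteq> 0} \<subseteq> Omega}"

text \<open>
  The unitary Fourier transform is only applied to square-integrable functions vanishing outside
  \<open>(0,1)\<close>. These are integrable, so that the transform is given by the integral.
\<close>

definition fourier :: "(real \<Rightarrow> real) \<Rightarrow> real \<Rightarrow> complex" where
  "fourier \<phi> \<omega> =
     complex_of_real (1 / sqrt (2 * pi)) *
       (LINT x|lborel. cis (- (\<omega> * x)) * complex_of_real (\<phi> x))"

definition H_density :: "real \<Rightarrow> (real \<Rightarrow> real) \<Rightarrow> real \<Rightarrow> real" where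
  "H_density \<sigma> \<phi> \<omega> = (1 + \<bar>\<omega>\<bar>\<^sup>2) powr \<sigma> * (cmod (fourier \<phi> \<omega>))\<^sup>2"

definition H_norm :: "real \<Rightarrow> (real \<Rightarrow> real) \<Rightarrow> real" where
  "H_norm \<sigma> \<phi> = sqrt (LINT \<omega>|lborel. H_density \<sigma> \<phi> \<omega>)"

text \<open>
  The closure of the test functions in \<open>H\<^sup>\<sigma>(\<real>)\<close>. A limit of test functions vanishes almost
  everywhere outside \<open>(0,1)\<close>; we choose the representative that vanishes there identically.
  The first four conditions say that \<open>u\<close> is such a representative of an element of \<open>H\<^sup>\<sigma>(\<real>)\<close>.
\<close>

definition H_tilde :: "real \<Rightarrow> (real \<Rightarrow> real) set" where
  "H_tilde \<sigma> =
     {u. u \<in> borel_measurable lborel \<and>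
         integrable lborel (\<lambda>x. (u x)\<^sup>2) \<and>
         integrable lborel (H_density \<sigma> u) \<and>
         (\<forall>x. x \<notin> Omega \<longrightarrow> u x = 0) \<and>
         (\<exists>\<phi>. (\<forall>k::nat. \<phi> k \<in> test_functions) \<and>
              (\<lambda>k. H_norm \<sigma> (\<lambda>x. \<phi> k x - u x)) \<longlonglongrightarrow> 0)}"

definition RL_left :: "real \<Rightarrow> (real \<Rightarrow> real) \<Rightarrow> real \<Rightarrow> real" where
  "RL_left \<sigma> \<phi> x =
     deriv (\<lambda>y. 1 / Gamma (1 - \<sigma>) * (LINT t:{0..y}|lborel. (y - t) powr (- \<sigma>) * \<phi> t)) x"

definition RL_right :: "real \<Rightarrow> (real \<Rightarrow> real) \<Rightarrow> real \<Rightarrow> real" where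
  "RL_right \<sigma> \<phi> x =
     - deriv (\<lambda>y. 1 / Gamma (1 - \<sigma>) * (LINT t:{y..1}|lborel. (t - y) powr (- \<sigma>) * \<phi> t)) x"

text \<open>
  The continuous extension to \<open>H_tilde \<sigma>\<close> of an operator \<open>T\<close> that is defined on test functions and
  bounded from the \<open>H_tilde \<sigma>\<close>-norm to the \<open>L\<^sub>2(0,1)\<close>-norm. For such \<open>T\<close> the limit \<open>g\<close> exists and,
  as an element of \<open>L\<^sub>2(0,1)\<close>, depends neither on the approximating sequence nor on the choice.
\<close>

definition L2_extension ::
    "real \<Rightarrow> ((real \<Rightarrow> real) \<Rightarrow> real \<Rightarrow> real) \<Rightarrow> (real \<Rightarrow> real) \<Rightarrow> real \<Rightarrow> real" where
  "L2_extension \<sigma> T u =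
     (SOME g. g \<in> L2_Omega \<and>
        (\<exists>\<phi>. (\<forall>k::nat. \<phi> k \<in> test_functions) \<and>
             (\<lambda>k. H_norm \<sigma> (\<lambda>x. \<phi> k x - u x)) \<longlonglongrightarrow> 0 \<and>
             (\<lambda>k. L2_norm (\<lambda>x. T (\<phi> k) x - g x)) \<longlonglongrightarrow> 0))"

definition D_left :: "real \<Rightarrow> (real \<Rightarrow> real) \<Rightarrow> real \<Rightarrow> real" where
  "D_left \<sigma> = L2_extension \<sigma> (RL_left \<sigma>)"

definition D_right :: "real \<Rightarrow> (real \<Rightarrow> real) \<Rightarrow> real \<Rightarrow> real" where
  "D_right \<sigma> = L2_extension \<sigma> (RL_right \<sigma>)"

definition weak_solution ::
    "real \<Rightarrow> real \<Rightarrow> (real \<Rightarrow> real) \<Rightarrow> (real \<Rightarrow> real) \<Rightarrow> bool" where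
  "weak_solution s \<mu> f u \<longleftrightarrow>
     u \<in> H_tilde (s / 2) \<and>
     (\<forall>v \<in> H_tilde (s / 2).
        - L2_inner (D_left (s / 2) u) (D_right (s / 2) v) + \<mu> * L2_inner u v = L2_inner f v)"

text \<open>
  \<open>W\<close> is the span of \<open>n\<close> elements of \<open>V\<close> that are linearly independent modulo null sets. The
  library's \<open>dim\<close> is not used: it ignores null sets and is 0 on infinite-dimensional spaces.
\<close>

definition subspace_of_dim :: "(real \<Rightarrow> real) set \<Rightarrow> nat \<Rightarrow> (real \<Rightarrow> real) set \<Rightarrow> bool" where
  "subspace_of_dim V n W \<longleftrightarrow>
     (\<exists>b :: nat \<Rightarrow> real \<Rightarrow> real.
        (\<forall>i<n. b i \<in> V) \<and>
        (\<forall>a :: nat \<Rightarrow> real.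
           (AE x in lborel. (\<Sum>i<n. a i * b i x) = 0) \<longrightarrow> (\<forall>i<n. a i = 0)) \<and>
        W = {\<lambda>x. \<Sum>i<n. a i * b i x | a :: nat \<Rightarrow> real. True})"

definition kolmogorov_width ::
    "real \<Rightarrow> real set \<Rightarrow> (real \<Rightarrow> real \<Rightarrow> real) \<Rightarrow> nat \<Rightarrow> ereal" where
  "kolmogorov_width s P w n =
     (INF W \<in> {W. subspace_of_dim (H_tilde (s / 2)) n W}.
        SUP \<mu> \<in> P. INF v \<in> W. ereal (H_norm (s / 2) (\<lambda>x. w \<mu> x - v x)))"

definition alpha :: "real \<Rightarrow> real" where
  "alpha s = \<bar>cos (s * (pi / 2))\<bar> * (Gamma (s / 2 + 1) ^ 4 / 8)"

end

theory Submission
  imports Defs "HOL-Probability.Characteristic_Functions" "HOL-Probability.Sinc_Integral"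
    "HOL-Computational_Algebra.Polynomial"
begin

text \<open>
  With \<open>\<sigma> = s/2\<close> and \<open>\<beta> = s - 1\<close>, the form \<open>-(D_left u, D_right v)\<close> on test functions is a positive
  multiple of the Riesz form with kernel \<open>\<bar>t - r\<bar>\<^sup>-\<^sup>\<beta>\<close> applied to \<open>u'(t) v'(r)\<close> on the half plane \<open>t < r\<close>.
  Writing the kernel as a superposition of Gaussians turns the quadratic form into
  \<open>\<integral> \<bar>\<omega>\<bar>\<^sup>s \<bar>\<F>u\<bar>\<^sup>2\<close> with a constant bounded below by a multiple of \<open>s - 1\<close>, and a Poincare inequality
  then gives coercivity with a constant \<open>\<gamma>\<close> proportional to \<open>s - 1\<close>, which dominates \<open>alpha s\<close> up to
  a fixed factor.

  Coercivity bounds each divided difference of \<open>\<mu> \<mapsto> u s \<mu>\<close> by the previous one divided by \<open>\<gamma>\<close>. On a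
  parameter interval of length at most \<open>\<gamma>/e\<close>, Newton interpolation with \<open>m\<close> nodes therefore has error of
  order \<open>e\<^sup>-\<^sup>m\<close>. About \<open>e \<mu>max/\<gamma>\<close> such intervals cover the parameter set, which leaves a number \<open>m\<close> of
  order \<open>\<gamma> n/\<mu>max\<close> of nodes for each of them when the dimension is \<open>n\<close>.
\<close>

section \<open>Square-integrable functions\<close>

text \<open>Uniformity in \<sigma> shapes the estimates. As \<sigma> tends to 1, the factor 1 /
  Gamma(1 - \<sigma>)^2 in front of the form decays like (1 - \<sigma>)^2, so the kernel form must
  be bounded below by a multiple of (1 - \<sigma>)^-2. One power comes from the Beta integral
  \<open>mixed_const\<close>, the other from the negative Gaussian moment
  \<open>moment_const\<close>. The factor s - 1 comes from \<open>gauss_const\<close>, which is at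
  most 4 / (s - 1). Gaussians replace the Fourier transform of the homogeneous kernel, a
  distribution, by absolutely convergent integrals; their positivity also gives the sign of the
  form. All Fourier identities concern test functions. They reach the solutions through limits in
  the left derivative alone, because the equation is only tested with test functions. The width asks
  for dimension exactly n modulo null sets, while the divided differences may be dependent. Explicit
  bump functions with disjoint supports fill the missing dimensions. The divergence of the constant
  as s tends to 1 is arranged by adding 1 / (s - 1) to the bound.\<close>

lemma L2_mult_integrable:
  fixes f g :: "'a \<Rightarrow> real"
  assumes [measurable]: "f \<in> borel_measurable M" "g \<in> borel_measurable M"
    and "integrable M (\<lambda>x. (f x)\<^sup>2)" "integrable M (\<lambda>x. (g x)\<^sup>2)"
  shows "integrable M (\<lambda>x. f x * g x)"
proof (rule Bochner_Integration.integrable_bound[of M "\<lambda>x. (f x)\<^sup>2 + (g x)\<^sup>2"])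
  show "AE x in M. norm (f x * g x) \<le> norm ((f x)\<^sup>2 + (g x)\<^sup>2)"
  proof (rule AE_I2)
    fix x
    have "0 \<le> (\<bar>f x\<bar> - \<bar>g x\<bar>)\<^sup>2" "0 \<le> (f x)\<^sup>2" "0 \<le> (g x)\<^sup>2" by auto
    then show "norm (f x * g x) \<le> norm ((f x)\<^sup>2 + (g x)\<^sup>2)"
      using mult_nonneg_nonneg[OF abs_ge_zero[of "f x"] abs_ge_zero[of "g x"]]
      unfolding power2_diff real_norm_def abs_mult by (simp only: power2_abs)
  qed
qed (use assms in auto)

lemma L2_lincomb_integrable:
  fixes f g :: "'a \<Rightarrow> real"
  assumes [measurable]: "f \<in> borel_measurable M" "g \<in> borel_measurable M"
    and "integrable M (\<lambda>x. (f x)\<^sup>2)" "integrable M (\<lambda>x. (g x)\<^sup>2)"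
  shows "integrable M (\<lambda>x. (a * f x + b * g x)\<^sup>2)"
proof -
  have "integrable M (\<lambda>x. a\<^sup>2 * (f x)\<^sup>2 + b\<^sup>2 * (g x)\<^sup>2 + (2 * a * b) * (f x * g x))"
    using assms L2_mult_integrable[OF assms] by (intro Bochner_Integration.integrable_add integrable_mult_right) auto
  moreover have "(a * f x + b * g x)\<^sup>2 = a\<^sup>2 * (f x)\<^sup>2 + b\<^sup>2 * (g x)\<^sup>2 + (2 * a * b) * (f x * g x)" for x
    by (simp add: power2_eq_square algebra_simps)
  ultimately show ?thesis by simp
qed

lemma L2_diff_integrable:
  fixes f g :: "'a \<Rightarrow> real"
  assumes "f \<in> borel_measurable M" "g \<in> borel_measurable M"
    and "integrable M (\<lambda>x. (f x)\<^sup>2)" "integrable M (\<lambda>x. (g x)\<^sup>2)"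
  shows "integrable M (\<lambda>x. (f x - g x)\<^sup>2)"
  using L2_lincomb_integrable[OF assms, of 1 "-1"] by simp

lemma L2_Cauchy_Schwarz:
  fixes f g :: "'a \<Rightarrow> real"
  assumes "f \<in> borel_measurable M" "g \<in> borel_measurable M"
    and "integrable M (\<lambda>x. (f x)\<^sup>2)" "integrable M (\<lambda>x. (g x)\<^sup>2)"
  shows "\<bar>LINT x|M. f x * g x\<bar> \<le> sqrt (LINT x|M. (f x)\<^sup>2) * sqrt (LINT x|M. (g x)\<^sup>2)"
proof -
  define A B C where "A = (LINT x|M. (f x)\<^sup>2)" and "B = (LINT x|M. f x * g x)"
    and "C = (LINT x|M. (g x)\<^sup>2)"
  have quad: "0 \<le> A - 2 * t * B + t\<^sup>2 * C" for t
  proof -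
    have "0 \<le> (LINT x|M. (1 * f x + (-t) * g x)\<^sup>2)" by simp
    also have "\<dots> = (LINT x|M. (f x)\<^sup>2 + (- (2 * t)) * (f x * g x) + t\<^sup>2 * (g x)\<^sup>2)"
      by (intro Bochner_Integration.integral_cong) (auto simp: power2_eq_square algebra_simps)
    also have "\<dots> = A - 2 * t * B + t\<^sup>2 * C"
      unfolding A_def B_def C_def using assms L2_mult_integrable[OF assms] by simp
    finally show ?thesis .
  qed
  have "A \<ge> 0" "C \<ge> 0" unfolding A_def C_def by auto
  have "B\<^sup>2 \<le> A * C"
  proof (cases "C = 0")
    case True
    have "B = 0"
    proof (rule ccontr)
      assume "B \<noteq> 0"
      \<comment> \<open>For C = 0 the quadratic is affine in t, and this t is chosen so that its
        value is -1.\<close>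
      have "0 \<le> A - 2 * ((A + 1) / (2 * B)) * B" using quad[of "(A + 1) / (2 * B)"] True by simp
      then show False using \<open>B \<noteq> 0\<close> by simp
    qed
    then show ?thesis using True by simp
  next
    case False
    then have "C > 0" using \<open>C \<ge> 0\<close> by simp
    have "0 \<le> A - 2 * (B / C) * B + (B / C)\<^sup>2 * C" by (rule quad)
    also have "\<dots> = A - B\<^sup>2 / C" using \<open>C > 0\<close> by (simp add: power2_eq_square field_simps)
    finally show ?thesis using \<open>C > 0\<close> by (simp add: field_simps)
  qed
  then have "sqrt (B\<^sup>2) \<le> sqrt (A * C)" by (rule real_sqrt_le_mono)
  then show ?thesis by (simp add: A_def B_def C_def real_sqrt_mult)
qed

lemma L2_triangle:
  fixes f g :: "'a \<Rightarrow> real"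
  assumes "f \<in> borel_measurable M" "g \<in> borel_measurable M"
    and "integrable M (\<lambda>x. (f x)\<^sup>2)" "integrable M (\<lambda>x. (g x)\<^sup>2)"
  shows "sqrt (LINT x|M. (f x + g x)\<^sup>2) \<le> sqrt (LINT x|M. (f x)\<^sup>2) + sqrt (LINT x|M. (g x)\<^sup>2)"
proof -
  let ?A = "LINT x|M. (f x)\<^sup>2" and ?C = "LINT x|M. (g x)\<^sup>2"
  have "(LINT x|M. (f x + g x)\<^sup>2) = (LINT x|M. (f x)\<^sup>2 + 2 * (f x * g x) + (g x)\<^sup>2)"
    by (intro Bochner_Integration.integral_cong) (auto simp: power2_eq_square algebra_simps)
  also have "\<dots> = ?A + 2 * (LINT x|M. f x * g x) + ?C"
    using assms L2_mult_integrable[OF assms] by simp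
  also have "\<dots> \<le> ?A + 2 * (sqrt ?A * sqrt ?C) + ?C"
    using L2_Cauchy_Schwarz[OF assms] by linarith
  also have "\<dots> = (sqrt ?A + sqrt ?C)\<^sup>2"
    by (simp add: power2_sum)
  finally show ?thesis
    by (intro real_le_lsqrt) auto
qed

text \<open>On a finite measure space an L2-Cauchy sequence is L1-Cauchy, so a subsequence converges
  almost everywhere. Its pointwise limit is the candidate, and Fatou's lemma along the subsequence
  turns the Cauchy estimate into L2 convergence of the whole sequence.\<close>

lemma L2_complete:
  fixes g :: "nat \<Rightarrow> 'a \<Rightarrow> real"
  assumes "finite_measure M"
    and meas [measurable]: "\<And>k. g k \<in> borel_measurable M"
    and int: "\<And>k. integrable M (\<lambda>x. (g k x)\<^sup>2)"
    and Cauchy: "\<And>e. e > 0 \<Longrightarrow> \<exists>N. \<forall>i\<ge>N. \<forall>j\<ge>N. (LINT x|M. (g i x - g j x)\<^sup>2) < e"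
  obtains G where "G \<in> borel_measurable M" "integrable M (\<lambda>x. (G x)\<^sup>2)"
    "(\<lambda>k. LINT x|M. (g k x - G x)\<^sup>2) \<longlonglongrightarrow> 0"
proof -
  interpret finite_measure M by fact
  have diff_int: "integrable M (\<lambda>x. (g i x - g j x)\<^sup>2)" for i j
    by (intro L2_diff_integrable meas int)
  have L1: "integrable M (g k)" for k
    using L2_mult_integrable[OF meas _ int, of "\<lambda>_. 1"] by simp
  have L1_le: "(LINT x|M. norm (g i x - g j x)) \<le> sqrt (LINT x|M. (g i x - g j x)\<^sup>2) * sqrt (measure M (space M))"
    for i j
    using L2_Cauchy_Schwarz[of "\<lambda>x. \<bar>g i x - g j x\<bar>" M "\<lambda>_. 1"] diff_int by simp
  have L1_Cauchy: "\<exists>N. \<forall>i\<ge>N. \<forall>j\<ge>N. (LINT x|M. norm (g i x - g j x)) < e" if "e > 0" for e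
  proof -
    \<comment> \<open>The summand 1 keeps the divisor positive when the space has measure
      zero.\<close>
    let ?m = "sqrt (measure M (space M)) + 1"
    have m: "?m > 0" by (simp add: add_nonneg_pos)
    have "(e / ?m)\<^sup>2 > 0" using that m by (intro zero_less_power divide_pos_pos)
    from Cauchy[OF this] obtain N
      where N: "\<And>i j. i \<ge> N \<Longrightarrow> j \<ge> N \<Longrightarrow> (LINT x|M. (g i x - g j x)\<^sup>2) < (e / ?m)\<^sup>2"
      by blast
    have "(LINT x|M. norm (g i x - g j x)) < e" if "i \<ge> N" "j \<ge> N" for i j
    proof -
      have "sqrt (LINT x|M. (g i x - g j x)\<^sup>2) < e / ?m"
        using N[OF that] \<open>e > 0\<close> m by (intro real_less_lsqrt) auto
      then have "sqrt (LINT x|M. (g i x - g j x)\<^sup>2) * ?m < e" using m by (simp add: pos_less_divide_eq)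
      moreover have "sqrt (LINT x|M. (g i x - g j x)\<^sup>2) * sqrt (measure M (space M)) \<le> sqrt (LINT x|M. (g i x - g j x)\<^sup>2) * ?m"
        by (intro mult_left_mono) auto
      ultimately show ?thesis using L1_le[of i j] by linarith
    qed
    then show ?thesis by blast
  qed
  obtain r where r: "strict_mono r" "AE x in M. Cauchy (\<lambda>i. g (r i) x)"
    using cauchy_L1_AE_cauchy_subseq[OF L1 L1_Cauchy] by blast
  define G where "G x = lim (\<lambda>i. g (r i) x)" for x
  have G[measurable]: "G \<in> borel_measurable M"
    unfolding G_def by measurable
  have conv: "AE x in M. (\<lambda>i. g (r i) x) \<longlonglongrightarrow> G x"
    using r(2) by eventually_elim (simp add: G_def Cauchy_convergent_iff convergent_LIMSEQ_iff)
  \<comment> \<open>Fatou is applied in \<open>ennreal\<close>, before anything is known about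
    integrability of the square of g k - G; integrability is then read off from this bound.\<close>
  have bound: "(\<integral>\<^sup>+x. ennreal ((g k x - G x)\<^sup>2) \<partial>M) \<le> ennreal e"
    if "e > 0" and N: "\<And>j. j \<ge> N \<Longrightarrow> (LINT x|M. (g k x - g j x)\<^sup>2) < e" for e k N
  proof -
    have "(\<integral>\<^sup>+x. ennreal ((g k x - G x)\<^sup>2) \<partial>M) = (\<integral>\<^sup>+x. liminf (\<lambda>i. ennreal ((g k x - g (r i) x)\<^sup>2)) \<partial>M)"
    proof (rule nn_integral_cong_AE, use conv in eventually_elim)
      fix x assume "(\<lambda>i. g (r i) x) \<longlonglongrightarrow> G x"
      then have "(\<lambda>i. ennreal ((g k x - g (r i) x)\<^sup>2)) \<longlonglongrightarrow> ennreal ((g k x - G x)\<^sup>2)"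
        by (intro tendsto_ennrealI tendsto_intros)
      then show "ennreal ((g k x - G x)\<^sup>2) = liminf (\<lambda>i. ennreal ((g k x - g (r i) x)\<^sup>2))"
        by (rule lim_imp_Liminf[OF trivial_limit_sequentially, symmetric])
    qed
    also have "\<dots> \<le> liminf (\<lambda>i. \<integral>\<^sup>+x. ennreal ((g k x - g (r i) x)\<^sup>2) \<partial>M)"
      by (intro nn_integral_liminf) measurable
    also have "\<dots> \<le> ennreal e"
    proof (rule Liminf_le[OF trivial_limit_sequentially], rule eventually_sequentiallyI[of N])
      fix i assume "i \<ge> N"
      then have "r i \<ge> N" using seq_suble[OF r(1), of i] by linarith
      then show "(\<integral>\<^sup>+x. ennreal ((g k x - g (r i) x)\<^sup>2) \<partial>M) \<le> ennreal e"
        using N[of "r i"] diff_int by (subst nn_integral_eq_integral) (auto intro: ennreal_leI)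
    qed
    finally show ?thesis .
  qed
  have diffG: "integrable M (\<lambda>x. (g k x - G x)\<^sup>2)" if "e > 0"
    "\<And>j. j \<ge> N \<Longrightarrow> (LINT x|M. (g k x - g j x)\<^sup>2) < e" for e k N
    using bound[OF that] by (intro integrableI_bounded) (auto simp: top_unique less_top[symmetric])
  have ev: "\<exists>N. \<forall>k\<ge>N. integrable M (\<lambda>x. (g k x - G x)\<^sup>2) \<and> (LINT x|M. (g k x - G x)\<^sup>2) \<le> e" if "e > 0" for e
  proof -
    obtain N where N: "\<And>i j. i \<ge> N \<Longrightarrow> j \<ge> N \<Longrightarrow> (LINT x|M. (g i x - g j x)\<^sup>2) < e"
      using Cauchy[OF \<open>e > 0\<close>] by blast
    have "integrable M (\<lambda>x. (g k x - G x)\<^sup>2) \<and> (LINT x|M. (g k x - G x)\<^sup>2) \<le> e" if "k \<ge> N" for k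
    proof
      show I: "integrable M (\<lambda>x. (g k x - G x)\<^sup>2)" using N that \<open>e > 0\<close> by (intro diffG[of e N k]) auto
      have "ennreal (LINT x|M. (g k x - G x)\<^sup>2) \<le> ennreal e"
        using bound[of e N k] N that \<open>e > 0\<close> by (subst nn_integral_eq_integral[symmetric]) (auto intro: I)
      then show "(LINT x|M. (g k x - G x)\<^sup>2) \<le> e" using \<open>e > 0\<close> by (simp add: ennreal_le_iff)
    qed
    then show ?thesis by blast
  qed
  obtain k0 where k0: "integrable M (\<lambda>x. (g k0 x - G x)\<^sup>2)" using ev[of 1] by auto
  have "integrable M (\<lambda>x. (g k0 x - (g k0 x - G x))\<^sup>2)"
    by (intro L2_diff_integrable int k0) measurable
  then have "integrable M (\<lambda>x. (G x)\<^sup>2)" by simp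
  moreover have "(\<lambda>k. LINT x|M. (g k x - G x)\<^sup>2) \<longlonglongrightarrow> 0"
  proof (rule LIMSEQ_I)
    fix e :: real assume "e > 0"
    then obtain N where N: "\<And>k. k \<ge> N \<Longrightarrow> (LINT x|M. (g k x - G x)\<^sup>2) \<le> e / 2"
      using ev[of "e/2"] by auto
    have "norm ((LINT x|M. (g k x - G x)\<^sup>2) - 0) < e" if "k \<ge> N" for k
      using N[OF that] \<open>e > 0\<close> by simp
    then show "\<exists>no. \<forall>k\<ge>no. norm ((LINT x|M. (g k x - G x)\<^sup>2) - 0) < e" by blast
  qed
  ultimately show ?thesis using that G by blast
qed

section \<open>The space L2(0,1) over the restricted Lebesgue measure\<close>

abbreviation OmegaM :: "real measure" where
  "OmegaM \<equiv> restrict_space lborel Omega"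

lemma Omega_sets [measurable, simp]: "Omega \<in> sets lborel" "Omega \<in> sets borel"
  by (auto simp: Omega_def)

lemma finite_measure_OmegaM: "finite_measure OmegaM"
  by (rule finite_measureI) (simp add: Omega_def emeasure_restrict_space)

lemma L2_inner_eq: "L2_inner g h = (LINT x|OmegaM. g x * h x)"
  by (simp add: L2_inner_def set_lebesgue_integral_def integral_restrict_space)

lemma L2_norm_eq: "L2_norm g = sqrt (LINT x|OmegaM. (g x)\<^sup>2)"
  by (simp add: L2_norm_def L2_inner_eq power2_eq_square)

lemma L2_Omega_iff:
  "g \<in> L2_Omega \<longleftrightarrow> g \<in> borel_measurable OmegaM \<and> integrable OmegaM (\<lambda>x. (g x)\<^sup>2)"
  by (simp add: L2_Omega_def set_borel_measurable_def set_integrable_def integrable_restrict_space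
      borel_measurable_restrict_space_iff)

lemma L2_inner_bound:
  assumes "f \<in> L2_Omega" "g \<in> L2_Omega"
  shows "\<bar>L2_inner f g\<bar> \<le> L2_norm f * L2_norm g"
  using assms unfolding L2_inner_eq L2_norm_eq L2_Omega_iff by (intro L2_Cauchy_Schwarz) auto

lemma L2_lincomb:
  assumes "f \<in> L2_Omega" "g \<in> L2_Omega"
  shows "(\<lambda>x. a * f x + b * g x) \<in> L2_Omega"
  using assms unfolding L2_Omega_iff by (auto intro!: L2_lincomb_integrable)

lemma L2_diff:
  assumes "f \<in> L2_Omega" "g \<in> L2_Omega"
  shows "(\<lambda>x. f x - g x) \<in> L2_Omega"
  using assms unfolding L2_Omega_iff by (auto intro!: L2_diff_integrable)

lemma L2_norm_triangle:
  assumes "f \<in> L2_Omega" "g \<in> L2_Omega"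
  shows "L2_norm (\<lambda>x. f x + g x) \<le> L2_norm f + L2_norm g"
  using assms unfolding L2_norm_eq L2_Omega_iff by (intro L2_triangle) auto

lemma L2_inner_lincomb:
  assumes "f \<in> L2_Omega" "g \<in> L2_Omega" "h \<in> L2_Omega"
  shows "L2_inner (\<lambda>x. a * f x + b * g x) h = a * L2_inner f h + b * L2_inner g h"
proof -
  have "integrable OmegaM (\<lambda>x. f x * h x)" "integrable OmegaM (\<lambda>x. g x * h x)"
    using assms L2_mult_integrable[of f OmegaM h] L2_mult_integrable[of g OmegaM h]
    unfolding L2_Omega_iff by blast+
  then have "(LINT x|OmegaM. a * (f x * h x) + b * (g x * h x)) = a * L2_inner f h + b * L2_inner g h"
    by (simp add: L2_inner_eq)
  then show ?thesis by (simp add: L2_inner_eq algebra_simps)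
qed

lemma L2_inner_commute: "L2_inner f g = L2_inner g f"
  by (simp add: L2_inner_def mult.commute)

lemma L2_norm_nonneg: "L2_norm f \<ge> 0"
  by (simp add: L2_norm_eq)

lemma L2_Omega_complete:
  assumes g: "\<And>k. g k \<in> L2_Omega"
    and Cauchy: "\<And>e. e > 0 \<Longrightarrow> \<exists>N. \<forall>i\<ge>N. \<forall>j\<ge>N. L2_norm (\<lambda>x. g i x - g j x) < e"
  obtains G where "G \<in> L2_Omega" "(\<lambda>k::nat. L2_norm (\<lambda>x. g k x - G x)) \<longlonglongrightarrow> 0"
proof -
  have "\<exists>N. \<forall>i\<ge>N. \<forall>j\<ge>N. (LINT x|OmegaM. (g i x - g j x)\<^sup>2) < e" if "e > 0" for e
  proof -
    obtain N where "\<forall>i\<ge>N. \<forall>j\<ge>N. L2_norm (\<lambda>x. g i x - g j x) < sqrt e"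
      using Cauchy[of "sqrt e"] \<open>e > 0\<close> by auto
    then show ?thesis unfolding L2_norm_eq by auto
  qed
  then obtain G where G: "G \<in> borel_measurable OmegaM" "integrable OmegaM (\<lambda>x. (G x)\<^sup>2)"
    "(\<lambda>k. LINT x|OmegaM. (g k x - G x)\<^sup>2) \<longlonglongrightarrow> 0"
    using L2_complete[OF finite_measure_OmegaM, of g] g unfolding L2_Omega_iff by blast
  have "(\<lambda>k. sqrt (LINT x|OmegaM. (g k x - G x)\<^sup>2)) \<longlonglongrightarrow> sqrt 0"
    by (intro tendsto_real_sqrt G)
  then show ?thesis using that[of G] G by (simp add: L2_norm_eq L2_Omega_iff)
qed

section \<open>Test functions and their Fourier transform\<close>

lemma test_deriv_field_diff:
  assumes "\<phi> \<in> test_functions"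
  shows "((deriv ^^ k) \<phi> has_real_derivative (deriv ^^ Suc k) \<phi> x) (at x)"
proof -
  have "(deriv ^^ k) \<phi> field_differentiable (at x)"
    using assms unfolding test_functions_def by blast
  then show ?thesis by (simp add: DERIV_deriv_iff_field_differentiable)
qed

lemma test_has_deriv:
  assumes "\<phi> \<in> test_functions"
  shows "(\<phi> has_real_derivative deriv \<phi> x) (at x)"
  using test_deriv_field_diff[OF assms, of 0 x] by simp

lemma test_continuous:
  assumes "\<phi> \<in> test_functions"
  shows "continuous_on A \<phi>"
  by (rule DERIV_continuous_on) (rule has_field_derivative_at_within[OF test_has_deriv[OF assms]])

lemma test_measurable:
  "\<phi> \<in> test_functions \<Longrightarrow> \<phi> \<in> borel_measurable borel"
  by (intro borel_measurable_continuous_onI test_continuous)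

lemma test_supported:
  assumes "\<phi> \<in> test_functions"
  obtains a b where "0 < a" "a < b" "b < 1" "\<And>x. x \<notin> {a..b} \<Longrightarrow> \<phi> x = 0"
proof (cases "closure {x. \<phi> x \<noteq> 0} = {}")
  case True
  then have "\<phi> x = 0" for x by auto
  then show ?thesis using that[of "1/4" "1/2"] by auto
next
  case False
  define S where "S = closure {x. \<phi> x \<noteq> 0}"
  have S: "compact S" "S \<subseteq> Omega" "S \<noteq> {}"
    using assms False unfolding test_functions_def S_def by auto
  obtain l where l: "l \<in> S" "\<And>x. x \<in> S \<Longrightarrow> l \<le> x" using compact_attains_inf[OF S(1,3)] by blast
  obtain u where u: "u \<in> S" "\<And>x. x \<in> S \<Longrightarrow> x \<le> u" using compact_attains_sup[OF S(1,3)] by blast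
  have lu: "0 < l" "u < 1" "l \<le> u" using l u S(2) by (auto simp: Omega_def)
  \<comment> \<open>The right end is moved from u to (u + 1) / 2 so that a < b holds even if l = u,
    while staying below 1.\<close>
  have "\<phi> x = 0" if "x \<notin> {l..(u + 1) / 2}" for x
  proof (rule ccontr)
    assume "\<phi> x \<noteq> 0"
    then have "x \<in> S" unfolding S_def by (intro subsetD[OF closure_subset]) simp
    then show False using l(2)[of x] u(2)[of x] lu that by auto
  qed
  then show ?thesis using lu by (intro that[of l "(u + 1) / 2"]) auto
qed

lemma test_zero:
  assumes "\<phi> \<in> test_functions" "x \<notin> Omega"
  shows "\<phi> x = 0"
proof -
  obtain a b where "0 < a" "b < 1" "\<And>x. x \<notin> {a..b} \<Longrightarrow> \<phi> x = 0"
    using test_supported[OF assms(1)] by metis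
  moreover have "x \<notin> {a..b}" using assms(2) calculation(1,2) by (auto simp: Omega_def)
  ultimately show ?thesis by blast
qed

lemma test_bounded:
  assumes "\<phi> \<in> test_functions"
  obtains M where "M > 0" "\<And>x. \<bar>\<phi> x\<bar> \<le> M"
proof -
  have "compact (\<phi> ` {0..1})"
    by (rule compact_continuous_image[OF test_continuous[OF assms] compact_Icc])
  then have "bounded (\<phi> ` {0..1})" by (rule compact_imp_bounded)
  then obtain M where M': "\<forall>y\<in>\<phi> ` {0..1}. norm y \<le> M"
    unfolding bounded_iff ..
  have M: "norm (\<phi> x) \<le> M" if "x \<in> {0..1}" for x
    by (rule M'[rule_format, OF imageI[OF that]])
  have "\<bar>\<phi> x\<bar> \<le> max M 1" for x
    using M[of x] test_zero[OF assms, of x] by (cases "x \<in> {0..1}") (auto simp: Omega_def)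
  then show ?thesis using that[of "max M 1"] by auto
qed

lemma test_deriv:
  assumes "\<phi> \<in> test_functions"
  shows "deriv \<phi> \<in> test_functions"
proof -
  let ?S = "{x. \<phi> x \<noteq> 0}" and ?T = "{x. deriv \<phi> x \<noteq> 0}"
  have "?T \<subseteq> closure ?S"
  proof
    fix x assume x: "x \<in> ?T"
    show "x \<in> closure ?S"
    proof (rule ccontr)
      assume "x \<notin> closure ?S"
      then have "x \<in> - closure ?S" "open (- closure ?S)" by auto
      then have "\<forall>\<^sub>F y in nhds x. y \<in> - closure ?S" unfolding eventually_nhds by blast
      then have "\<forall>\<^sub>F y in nhds x. \<phi> y = 0"
        by (rule eventually_mono) (use closure_subset[of ?S] in auto)
      then have "deriv \<phi> x = deriv (\<lambda>_. 0) x" by (intro deriv_cong_ev) auto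
      then show False using x by simp
    qed
  qed
  then have T: "closure ?T \<subseteq> closure ?S" by (simp add: closure_minimal)
  then have "compact (closure ?T)"
    using compact_Int_closed[of "closure ?S" "closure ?T", OF _ closed_closure] assms
    unfolding test_functions_def Int_absorb1[OF T] by blast
  moreover have "(deriv ^^ k) (deriv \<phi>) field_differentiable (at x)" for k x
  proof -
    have "(deriv ^^ Suc k) \<phi> field_differentiable (at x)"
      using assms unfolding test_functions_def by blast
    then show ?thesis by (simp only: funpow_Suc_right comp_apply)
  qed
  ultimately show ?thesis
    using T assms unfolding test_functions_def by blast
qed

lemma test_lincomb:
  assumes "\<phi> \<in> test_functions" "\<psi> \<in> test_functions"
  shows "(\<lambda>x. a * \<phi> x + b * \<psi> x) \<in> test_functions"
proof -
  let ?f = "\<lambda>x. a * \<phi> x + b * \<psi> x"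
  have iter: "(deriv ^^ k) ?f = (\<lambda>x. a * (deriv ^^ k) \<phi> x + b * (deriv ^^ k) \<psi> x)" for k
  proof (induction k)
    case (Suc k)
    have "(deriv ^^ Suc k) ?f x = a * (deriv ^^ Suc k) \<phi> x + b * (deriv ^^ Suc k) \<psi> x" for x
      unfolding funpow.simps comp_def Suc.IH
      by (rule DERIV_imp_deriv)
        (use test_deriv_field_diff[OF assms(1), of k x] test_deriv_field_diff[OF assms(2), of k x] in
          \<open>auto intro!: derivative_eq_intros\<close>)
    then show ?case by blast
  qed simp
  have diff: "(deriv ^^ k) ?f field_differentiable (at x)" for k x
    unfolding iter
    using test_deriv_field_diff[OF assms(1), of k x] test_deriv_field_diff[OF assms(2), of k x]
    by (intro derivative_intros) (auto simp: field_differentiable_def)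
  have sub: "closure {x. ?f x \<noteq> 0} \<subseteq> closure {x. \<phi> x \<noteq> 0} \<union> closure {x. \<psi> x \<noteq> 0}"
    unfolding closure_Un[symmetric] by (intro closure_mono) auto
  have "compact (closure {x. \<phi> x \<noteq> 0} \<union> closure {x. \<psi> x \<noteq> 0})"
    using assms unfolding test_functions_def by auto
  then have "compact ((closure {x. \<phi> x \<noteq> 0} \<union> closure {x. \<psi> x \<noteq> 0}) \<inter> closure {x. ?f x \<noteq> 0})"
    by (rule compact_Int_closed) (rule closed_closure)
  then have "compact (closure {x. ?f x \<noteq> 0})"
    unfolding Int_absorb1[OF sub] .
  then show ?thesis using sub diff assms unfolding test_functions_def by blast
qed

lemma test_diff: "\<phi> \<in> test_functions \<Longrightarrow> \<psi> \<in> test_functions \<Longrightarrow> (\<lambda>x. \<phi> x - \<psi> x) \<in> test_functions"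
  using test_lincomb[of \<phi> \<psi> 1 "-1"] by simp

lemma integrable_bounded_Omega:
  fixes h :: "real \<Rightarrow> real"
  assumes [measurable]: "h \<in> borel_measurable borel" and "\<And>x. \<bar>h x\<bar> \<le> M" "\<And>x. x \<notin> Omega \<Longrightarrow> h x = 0"
  shows "integrable lborel h"
proof (rule Bochner_Integration.integrable_bound[of _ "\<lambda>x. indicator {0..1} x * M"])
  show "AE x in lborel. norm (h x) \<le> norm (indicator {0..1} x * M)"
  proof (rule AE_I2)
    fix x
    show "norm (h x) \<le> norm (indicator {0..1} x * M)"
      using assms(2)[of x] assms(3)[of x] by (cases "x \<in> Omega") (auto simp: Omega_def)
  qed
qed auto

lemma test_integrable: "\<phi> \<in> test_functions \<Longrightarrow> integrable lborel \<phi>"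
    using test_bounded[of \<phi>] integrable_bounded_Omega[OF test_measurable[of \<phi>]] test_zero[of \<phi>] by metis

lemma test_integrable_square:
  assumes "\<phi> \<in> test_functions"
  shows "integrable lborel (\<lambda>x. (\<phi> x)\<^sup>2)"
proof -
  obtain M where M: "\<And>x. \<bar>\<phi> x\<bar> \<le> M" using test_bounded[OF assms] by blast
  have "\<bar>(\<phi> x)\<^sup>2\<bar> \<le> M\<^sup>2" for x using power_mono[OF M[of x], of 2] by simp
  then show ?thesis using test_zero[OF assms]
    by (intro integrable_bounded_Omega[of _ "M\<^sup>2"] borel_measurable_power test_measurable[OF assms]) auto
qed

text \<open>The function is its own product with the indicator of the bounded interval, hence a
  product of two square-integrable functions. This is why the integral in \<open>fourier\<close>
  makes sense for every element of the Sobolev spaces used here.\<close>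

lemma integrable_of_square_integrable:
  assumes [measurable]: "w \<in> borel_measurable borel" and "integrable lborel (\<lambda>x. (w x)\<^sup>2)"
    "\<And>x. x \<notin> Omega \<Longrightarrow> w x = 0"
  shows "integrable lborel (w :: real \<Rightarrow> real)"
proof -
  have "integrable lborel (\<lambda>x. w x * indicator Omega x)"
  proof (intro L2_mult_integrable assms)
    have "(\<lambda>x. (indicator Omega x :: real)\<^sup>2) = indicator Omega" by (auto simp: indicator_def)
    then show "integrable lborel (\<lambda>x. (indicator Omega x :: real)\<^sup>2)"
      by (simp add: Omega_def integrable_real_indicator)
  qed (use assms in auto)
  moreover have "w x * indicator Omega x = w x" for x using assms(3) by (auto simp: indicator_def)
  ultimately show ?thesis by simp
qed

section \<open>The Fourier transform of integrable functions\<close>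

lemma fourier_measurable [measurable]:
  assumes [measurable]: "w \<in> borel_measurable borel"
  shows "fourier w \<in> borel_measurable borel"
  unfolding fourier_def cis_conv_exp by measurable

lemma cis_integrable:
  assumes "integrable lborel (w :: real \<Rightarrow> real)"
  shows "integrable lborel (\<lambda>x. cis (- (\<omega> * x)) * complex_of_real (w x))"
proof (rule Bochner_Integration.integrable_bound[OF assms])
  note [measurable] = borel_measurable_integrable[OF assms]
  show "(\<lambda>x. cis (- (\<omega> * x)) * complex_of_real (w x)) \<in> borel_measurable lborel"
    unfolding cis_conv_exp by measurable
qed (auto simp: norm_mult)

lemma fourier_lincomb:
  assumes "integrable lborel v" "integrable lborel w"
  shows "fourier (\<lambda>x. a * v x + b * w x) \<omega> = of_real a * fourier v \<omega> + of_real b * fourier w \<omega>"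
proof -
  have *: "(\<lambda>x. cis (- (\<omega> * x)) * complex_of_real (a * v x + b * w x)) =
     (\<lambda>x. of_real a * (cis (- (\<omega> * x)) * complex_of_real (v x)) + of_real b * (cis (- (\<omega> * x)) * complex_of_real (w x)))"
    by (auto simp: algebra_simps)
  have "(LINT x|lborel. cis (- (\<omega> * x)) * complex_of_real (a * v x + b * w x)) =
     of_real a * (LINT x|lborel. cis (- (\<omega> * x)) * complex_of_real (v x)) +
     of_real b * (LINT x|lborel. cis (- (\<omega> * x)) * complex_of_real (w x))"
    unfolding * using cis_integrable[OF assms(1), of \<omega>] cis_integrable[OF assms(2), of \<omega>]
    by (subst Bochner_Integration.integral_add) auto
  then show ?thesis unfolding fourier_def by (simp add: algebra_simps)
qed

lemma fourier_cong_AE: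
  assumes "v \<in> borel_measurable borel" "w \<in> borel_measurable borel" "AE x in lborel. v x = w x"
  shows "fourier v = fourier w"
proof
  fix \<omega>
  note [measurable] = assms(1,2)
  have "(LINT x|lborel. cis (- (\<omega> * x)) * complex_of_real (v x)) = (LINT x|lborel. cis (- (\<omega> * x)) * complex_of_real (w x))"
  proof (rule integral_cong_AE)
    show "(\<lambda>x. cis (- (\<omega> * x)) * complex_of_real (v x)) \<in> borel_measurable lborel"
      unfolding cis_conv_exp by measurable
    show "(\<lambda>x. cis (- (\<omega> * x)) * complex_of_real (w x)) \<in> borel_measurable lborel"
      unfolding cis_conv_exp by measurable
  qed (use assms(3) in auto)
  then show "fourier v \<omega> = fourier w \<omega>" by (simp add: fourier_def)
qed

lemma fourier_bound: "cmod (fourier w \<omega>) \<le> (LINT x|lborel. \<bar>w x\<bar>) / sqrt (2 * pi)"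
proof -
  have "cmod (LINT x|lborel. cis (- (\<omega> * x)) * complex_of_real (w x)) \<le> (LINT x|lborel. \<bar>w x\<bar>)"
    using integral_norm_bound[of lborel "\<lambda>x. cis (- (\<omega> * x)) * complex_of_real (w x)"] by (simp add: norm_mult)
  then show ?thesis unfolding fourier_def norm_mult by (simp add: divide_right_mono norm_divide)
qed

text \<open>Integration by parts: the fundamental theorem on [0,1] is applied to the product of the
  character with \<phi>, whose boundary values vanish.\<close>

lemma fourier_deriv:
  assumes "\<phi> \<in> test_functions"
  shows "fourier (deriv \<phi>) \<omega> = \<i> * of_real \<omega> * fourier \<phi> \<omega>"
proof -
  let ?F = "\<lambda>x. cis (- (\<omega> * x)) * complex_of_real (\<phi> x)"
  let ?f = "\<lambda>x. cis (- (\<omega> * x)) * complex_of_real (deriv \<phi> x) - \<i> * of_real \<omega> * (cis (- (\<omega> * x)) * complex_of_real (\<phi> x))"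
  note d = test_deriv[OF assms]
  have F: "(?F has_vector_derivative ?f x) (at x)" for x
  proof -
    have 1: "((\<lambda>x. cis (- (\<omega> * x))) has_vector_derivative (- \<i> * of_real \<omega> * cis (- (\<omega> * x)))) (at x)"
    proof -
      have "((\<lambda>z. exp (- (\<i> * of_real \<omega> * z))) has_field_derivative (- \<i> * of_real \<omega> * exp (- (\<i> * of_real \<omega> * of_real x)))) (at (of_real x))"
        by (auto intro!: derivative_eq_intros)
      from has_vector_derivative_real_field[OF this] show ?thesis
        by (simp add: cis_conv_exp mult_ac)
    qed
    have 2: "((\<lambda>x. complex_of_real (\<phi> x)) has_vector_derivative complex_of_real (deriv \<phi> x)) (at x)"
      using test_has_deriv[OF assms, of x]
      by (intro has_vector_derivative_of_real) (auto simp: has_real_derivative_iff_has_vector_derivative)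
    show ?thesis
      using has_vector_derivative_mult[OF 1 2] by (simp add: algebra_simps)
  qed
  have "(LINT x|lborel. indicator {0..1} x *\<^sub>R ?f x) = ?F 1 - ?F 0"
  proof (rule integral_FTC_atLeastAtMost)
    show "continuous_on {0..1} ?f"
      by (intro continuous_intros test_continuous[OF assms] test_continuous[OF d])
  qed (use has_vector_derivative_at_within[OF F] in auto)
  moreover have "indicator {0..1} x *\<^sub>R ?f x = ?f x" for x
    using test_zero[OF assms, of x] test_zero[OF d, of x] by (auto simp: indicator_def Omega_def)
  ultimately have "(LINT x|lborel. ?f x) = 0"
    using test_zero[OF assms] by (simp add: Omega_def)
  then have "(LINT x|lborel. cis (- (\<omega> * x)) * complex_of_real (deriv \<phi> x)) =
     \<i> * of_real \<omega> * (LINT x|lborel. cis (- (\<omega> * x)) * complex_of_real (\<phi> x))"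
    using cis_integrable[OF test_integrable[OF d], of \<omega>] cis_integrable[OF test_integrable[OF assms], of \<omega>]
    by simp
  then show ?thesis unfolding fourier_def by simp
qed

text \<open>Two derivatives are moved onto \<phi>. Quadratic decay suffices both for integrability
  of the transform and, after squaring, against the weight of order \<sigma> \<le> 1.\<close>

lemma fourier_decay:
  assumes "\<phi> \<in> test_functions"
  obtains C where "C > 0" "\<And>\<omega>. cmod (fourier \<phi> \<omega>) \<le> C / (1 + \<omega>\<^sup>2)"
proof -
  note d = test_deriv[OF assms] test_deriv[OF test_deriv[OF assms]]
  define A where "A = (LINT x|lborel. \<bar>\<phi> x\<bar>) / sqrt (2 * pi)"
  define B where "B = (LINT x|lborel. \<bar>deriv (deriv \<phi>) x\<bar>) / sqrt (2 * pi)"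
  have "A \<ge> 0" "B \<ge> 0" unfolding A_def B_def by auto
  \<comment> \<open>The summand 1 only makes the constant strictly positive; \<phi> may be
    zero.\<close>
  have "cmod (fourier \<phi> \<omega>) \<le> (A + B + 1) / (1 + \<omega>\<^sup>2)" for \<omega>
  proof -
    have "cmod (fourier \<phi> \<omega>) \<le> A" unfolding A_def by (rule fourier_bound)
    moreover have "\<omega>\<^sup>2 * cmod (fourier \<phi> \<omega>) \<le> B"
      using fourier_bound[of "deriv (deriv \<phi>)" \<omega>] unfolding B_def fourier_deriv[OF d(1)] fourier_deriv[OF assms]
      by (simp add: norm_mult power2_eq_square mult.assoc)
    ultimately have "(1 + \<omega>\<^sup>2) * cmod (fourier \<phi> \<omega>) \<le> A + B + 1" by (simp add: algebra_simps)
    moreover have "1 + \<omega>\<^sup>2 > 0" by (simp add: add_pos_nonneg)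
    ultimately show ?thesis by (simp add: pos_le_divide_eq mult.commute)
  qed
  moreover have "A + B + 1 > 0" using \<open>A \<ge> 0\<close> \<open>B \<ge> 0\<close> by linarith
  ultimately show ?thesis by (rule that[rotated])
qed

section \<open>Fourier inversion\<close>

lemma borel_measurable_cis [measurable (raw)]:
  "f \<in> borel_measurable M \<Longrightarrow> (\<lambda>x. cis (f x)) \<in> borel_measurable M"
  unfolding cis_conv_exp by measurable

text \<open>A product majorant makes Tonelli trivial. The oscillating integrands below are of this
  kind: bounded characters times a function of each variable.\<close>

lemma integrable_dominated_pair:
  fixes F :: "'a::euclidean_space \<Rightarrow> 'b::euclidean_space \<Rightarrow> 'c::{banach, second_countable_topology}"
  assumes [measurable]: "case_prod F \<in> borel_measurable (lborel \<Otimes>\<^sub>M lborel)"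
    and f: "integrable lborel f" and g: "integrable lborel g"
    and bound: "\<And>x y. norm (F x y) \<le> f x * g y"
  shows "integrable (lborel \<Otimes>\<^sub>M lborel) (case_prod F)"
proof -
  note [measurable] = borel_measurable_integrable[OF f] borel_measurable_integrable[OF g]
  have "integrable (lborel \<Otimes>\<^sub>M lborel) (\<lambda>z. f (fst z) * g (snd z))"
  proof (rule lborel_pair.Fubini_integrable)
    have "integrable lborel (\<lambda>x. \<bar>f x\<bar> * (LINT y|lborel. \<bar>g y\<bar>))"
      using f by (intro integrable_mult_left) simp
    then show "integrable lborel (\<lambda>x. LINT y|lborel. norm (f (fst (x, y)) * g (snd (x, y))))"
      by (simp add: abs_mult)
  qed (use g in simp_all)
  then show ?thesis
  proof (rule Bochner_Integration.integrable_bound)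
    show "AE z in lborel \<Otimes>\<^sub>M lborel. norm (case_prod F z) \<le> norm (f (fst z) * g (snd z))"
    proof (rule AE_I2)
      fix z :: "'a \<times> 'b"
      have "norm (F (fst z) (snd z)) \<le> \<bar>f (fst z) * g (snd z)\<bar>"
        by (rule order_trans[OF bound abs_ge_self])
      then show "norm (case_prod F z) \<le> norm (f (fst z) * g (snd z))"
        by (simp add: case_prod_beta)
    qed
  qed measurable
qed

lemma Fubini_dominated:
  fixes F :: "'a::euclidean_space \<Rightarrow> 'b::euclidean_space \<Rightarrow> 'c::{banach, second_countable_topology}"
  assumes "case_prod F \<in> borel_measurable (lborel \<Otimes>\<^sub>M lborel)"
    and "integrable lborel f" "integrable lborel g"
    and "\<And>x y. norm (F x y) \<le> f x * g y"
  shows "(LINT x|lborel. LINT y|lborel. F x y) = (LINT y|lborel. LINT x|lborel. F x y)"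
  by (rule lborel_pair.Fubini_integral[symmetric]) (rule integrable_dominated_pair[OF assms])

lemma std_normal_bound: "std_normal_density x \<le> 1"
proof -
  have "1 \<le> sqrt (2 * pi)" using pi_gt3 by (intro real_le_rsqrt) simp
  then have "1 / sqrt (2 * pi) \<le> 1" by simp
  moreover have "exp (- x\<^sup>2 / 2) \<le> 1" by simp
  ultimately show ?thesis unfolding std_normal_density_def by (intro mult_le_one) auto
qed

lemma integrable_std_normal: "integrable lborel std_normal_density"
  using integrable_std_normal_moment[of 0] by simp

lemma integral_std_normal: "(LINT x|lborel. std_normal_density x) = 1"
  using integral_std_normal_moment_even[of 0] by simp

lemma std_normal_cis:
  "(LINT y|lborel. std_normal_density y *\<^sub>R cis (a * y)) = of_real (exp (- a\<^sup>2 / 2))"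
proof -
  have "char std_normal_distribution a = (LINT y|lborel. std_normal_density y *\<^sub>R cis (a * y))"
    unfolding char_def by (subst integral_density) (auto simp: cis_conv_exp)
  then show ?thesis by (simp add: char_std_normal_distribution)
qed

lemma std_normal_cos:
  "(LINT y|lborel. std_normal_density y * cos (a * y)) = exp (- a\<^sup>2 / 2)"
proof -
  have int: "integrable lborel (\<lambda>y. std_normal_density y *\<^sub>R cis (a * y))"
    by (rule Bochner_Integration.integrable_bound[OF integrable_std_normal]) (auto simp: normal_density_nonneg)
  have "Re (LINT y|lborel. std_normal_density y *\<^sub>R cis (a * y)) = (LINT y|lborel. Re (std_normal_density y *\<^sub>R cis (a * y)))"
    by (rule integral_Re[OF int, symmetric])
  then show ?thesis unfolding std_normal_cis by simp
qed

lemma integrable_inverse_square: "integrable lborel (\<lambda>x::real. inverse (1 + x\<^sup>2))"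
  using integrable_inverse_1_plus_square by (simp add: set_integrable_def)

lemma fourier_test_integrable:
  assumes "\<phi> \<in> test_functions"
  shows "integrable lborel (fourier \<phi>)"
proof -
  obtain C where C: "C > 0" "\<And>\<omega>. cmod (fourier \<phi> \<omega>) \<le> C / (1 + \<omega>\<^sup>2)"
    using fourier_decay[OF assms] by metis
  have "integrable lborel (\<lambda>\<omega>::real. C * inverse (1 + \<omega>\<^sup>2))"
    by (intro integrable_mult_right integrable_inverse_square)
  then show ?thesis
  proof (rule Bochner_Integration.integrable_bound)
    show "fourier \<phi> \<in> borel_measurable lborel"
      using fourier_measurable[OF test_measurable[OF assms]] by simp
    show "AE \<omega> in lborel. norm (fourier \<phi> \<omega>) \<le> norm (C * inverse (1 + \<omega>\<^sup>2))"
    proof (rule AE_I2)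
      fix \<omega>
      have "C / (1 + \<omega>\<^sup>2) \<le> \<bar>C * inverse (1 + \<omega>\<^sup>2)\<bar>" by (simp add: divide_inverse)
      then show "norm (fourier \<phi> \<omega>) \<le> norm (C * inverse (1 + \<omega>\<^sup>2))" using C(2)[of \<omega>] by simp
    qed
  qed
qed

text \<open>By Fubini the frequency integral falls on the Gaussian damping factor, whose transform
  is again a Gaussian. What remains is \<phi> averaged against a Gaussian of width e.\<close>

lemma Gaussian_mollification:
  assumes \<phi>: "\<phi> \<in> test_functions" and e: "e > 0"
  shows "(LINT \<omega>|lborel. std_normal_density (e * \<omega>) *\<^sub>R (cis (\<omega> * x) * fourier \<phi> \<omega>)) =
    of_real (LINT y|lborel. std_normal_density y * \<phi> (x + e * y))"
proof -
  note [measurable] = test_measurable[OF \<phi>]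
  define F where "F \<omega> t = std_normal_density (e * \<omega>) *\<^sub>R (cis (\<omega> * (x - t)) * of_real (\<phi> t))" for \<omega> t
  have int_n: "integrable lborel (\<lambda>\<omega>. std_normal_density (e * \<omega>))"
    using lborel_integrable_real_affine[OF integrable_std_normal, of e 0] e by simp
  have swap: "(LINT \<omega>|lborel. LINT t|lborel. F \<omega> t) = (LINT t|lborel. LINT \<omega>|lborel. F \<omega> t)"
  proof (rule Fubini_dominated[where f="\<lambda>\<omega>. std_normal_density (e * \<omega>)" and g="\<lambda>t. \<bar>\<phi> t\<bar>"])
    show "case_prod F \<in> borel_measurable (lborel \<Otimes>\<^sub>M lborel)"
      unfolding F_def by measurable
    show "integrable lborel (\<lambda>t. \<bar>\<phi> t\<bar>)" using test_integrable[OF \<phi>] by simp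
    show "norm (F \<omega> t) \<le> std_normal_density (e * \<omega>) * \<bar>\<phi> t\<bar>" for \<omega> t
      unfolding F_def by (simp add: norm_mult normal_density_nonneg)
  qed (rule int_n)
  have inner1: "(LINT t|lborel. F \<omega> t) = of_real (sqrt (2 * pi)) * (std_normal_density (e * \<omega>) *\<^sub>R (cis (\<omega> * x) * fourier \<phi> \<omega>))" for \<omega>
  proof -
    have "(LINT t|lborel. F \<omega> t) = (LINT t|lborel. (std_normal_density (e * \<omega>) *\<^sub>R cis (\<omega> * x)) * (cis (- (\<omega> * t)) * of_real (\<phi> t)))"
      by (intro Bochner_Integration.integral_cong refl) (simp add: F_def right_diff_distrib cis_mult[symmetric] mult.assoc[symmetric] cis_mult)
    also have "\<dots> = (std_normal_density (e * \<omega>) *\<^sub>R cis (\<omega> * x)) * (LINT t|lborel. cis (- (\<omega> * t)) * of_real (\<phi> t))"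
      by (rule integral_mult_right_zero)
    finally show ?thesis by (simp add: fourier_def scaleR_conv_of_real)
  qed
  have outer: "(LINT t|lborel. LINT \<omega>|lborel. F \<omega> t) = of_real (sqrt (2 * pi)) * of_real (LINT y|lborel. std_normal_density y * \<phi> (x + e * y))"
  proof -
    have inner: "(LINT \<omega>|lborel. F \<omega> t) = of_real (sqrt (2 * pi) * (std_normal_density ((t - x) / e) * \<phi> t / e))" for t
    proof -
      have "(LINT \<omega>|lborel. F \<omega> t) = (LINT \<omega>|lborel. std_normal_density (e * \<omega>) *\<^sub>R cis (\<omega> * (x - t))) * of_real (\<phi> t)"
        unfolding F_def scaleR_conv_of_real mult.assoc[symmetric] by (rule integral_mult_left_zero)
      also have "(LINT \<omega>|lborel. std_normal_density (e * \<omega>) *\<^sub>R cis (\<omega> * (x - t))) =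
         \<bar>1 / e\<bar> *\<^sub>R (LINT y|lborel. std_normal_density (e * (0 + (1 / e) * y)) *\<^sub>R cis ((0 + (1 / e) * y) * (x - t)))"
        using e by (intro lborel_integral_real_affine) simp
      also have "\<dots> = (1 / e) *\<^sub>R (LINT y|lborel. std_normal_density y *\<^sub>R cis (((x - t) / e) * y))"
        using e by (simp add: mult_ac)
      also have "\<dots> = of_real (1 / e * exp (- ((x - t) / e)\<^sup>2 / 2))"
        unfolding std_normal_cis by (simp add: scaleR_conv_of_real)
      also have "1 / e * exp (- ((x - t) / e)\<^sup>2 / 2) = sqrt (2 * pi) * std_normal_density ((t - x) / e) / e"
        unfolding std_normal_density_def by (simp add: power_divide power2_commute)
      finally show ?thesis by simp
    qed
    have "(LINT t|lborel. LINT \<omega>|lborel. F \<omega> t) = of_real (LINT t|lborel. sqrt (2 * pi) * (std_normal_density ((t - x) / e) * \<phi> t / e))"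
      unfolding inner by (rule integral_complex_of_real)
    also have "(LINT t|lborel. sqrt (2 * pi) * (std_normal_density ((t - x) / e) * \<phi> t / e)) =
       sqrt (2 * pi) * (LINT t|lborel. std_normal_density ((t - x) / e) * \<phi> t / e)"
      by (rule integral_mult_right_zero)
    also have "(LINT t|lborel. std_normal_density ((t - x) / e) * \<phi> t / e) =
       \<bar>e\<bar> *\<^sub>R (LINT y|lborel. std_normal_density ((x + e * y - x) / e) * \<phi> (x + e * y) / e)"
      using e by (intro lborel_integral_real_affine) simp
    also have "\<dots> = (LINT y|lborel. std_normal_density y * \<phi> (x + e * y))"
      using e by simp
    finally show ?thesis by simp
  qed
  have "of_real (sqrt (2 * pi)) * (LINT \<omega>|lborel. std_normal_density (e * \<omega>) *\<^sub>R (cis (\<omega> * x) * fourier \<phi> \<omega>)) =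
    of_real (sqrt (2 * pi)) * complex_of_real (LINT y|lborel. std_normal_density y * \<phi> (x + e * y))"
    using swap unfolding inner1 outer integral_mult_right_zero .
  then show ?thesis by simp
qed

text \<open>Let the width in \<open>Gaussian_mollification\<close> tend to 0. The frequency side is
  dominated by the integrable transform, the space side by the bound of \<phi>. The normalising
  factor is \<open>std_normal_density 0\<close>.\<close>

lemma fourier_inversion:
  assumes \<phi>: "\<phi> \<in> test_functions"
  shows "of_real (1 / sqrt (2 * pi)) * (LINT \<omega>|lborel. cis (\<omega> * x) * fourier \<phi> \<omega>) = of_real (\<phi> x)"
proof -
  note [measurable] = test_measurable[OF \<phi>] fourier_measurable[OF test_measurable[OF \<phi>]]
  define e where "e k = 1 / real (Suc k)" for k
  have e: "e k > 0" "e \<longlonglongrightarrow> 0" for k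
    unfolding e_def using LIMSEQ_inverse_real_of_nat by (auto simp: inverse_eq_divide)
  obtain M where M: "\<And>x. \<bar>\<phi> x\<bar> \<le> M" using test_bounded[OF \<phi>] by metis
  have cont_n: "isCont std_normal_density y" for y
    unfolding std_normal_density_def by (intro continuous_intros) simp
  have cont_\<phi>: "isCont \<phi> y" for y
    using test_has_deriv[OF \<phi>] by (rule DERIV_isCont)
  have 1: "(\<lambda>k. LINT \<omega>|lborel. std_normal_density (e k * \<omega>) *\<^sub>R (cis (\<omega> * x) * fourier \<phi> \<omega>))
     \<longlonglongrightarrow> (LINT \<omega>|lborel. std_normal_density 0 *\<^sub>R (cis (\<omega> * x) * fourier \<phi> \<omega>))"
  proof (rule integral_dominated_convergence[where w="\<lambda>\<omega>. cmod (fourier \<phi> \<omega>)"])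
    show "integrable lborel (\<lambda>\<omega>. cmod (fourier \<phi> \<omega>))"
      using fourier_test_integrable[OF \<phi>] by (rule integrable_norm)
    show "AE \<omega> in lborel. (\<lambda>k. std_normal_density (e k * \<omega>) *\<^sub>R (cis (\<omega> * x) * fourier \<phi> \<omega>)) \<longlonglongrightarrow> std_normal_density 0 *\<^sub>R (cis (\<omega> * x) * fourier \<phi> \<omega>)"
    proof (rule AE_I2)
      fix \<omega>
      have "(\<lambda>k. e k * \<omega>) \<longlonglongrightarrow> 0" using tendsto_mult_left_zero[OF e(2), of \<omega>] by simp
      from isCont_tendsto_compose[OF cont_n this]
      show "(\<lambda>k. std_normal_density (e k * \<omega>) *\<^sub>R (cis (\<omega> * x) * fourier \<phi> \<omega>)) \<longlonglongrightarrow> std_normal_density 0 *\<^sub>R (cis (\<omega> * x) * fourier \<phi> \<omega>)"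
        by (intro tendsto_scaleR tendsto_const)
    qed
    show "AE \<omega> in lborel. norm (std_normal_density (e k * \<omega>) *\<^sub>R (cis (\<omega> * x) * fourier \<phi> \<omega>)) \<le> cmod (fourier \<phi> \<omega>)" for k
    proof (rule AE_I2)
      fix \<omega>
      have "std_normal_density (e k * \<omega>) * cmod (fourier \<phi> \<omega>) \<le> 1 * cmod (fourier \<phi> \<omega>)"
        by (intro mult_right_mono std_normal_bound norm_ge_zero)
      then show "norm (std_normal_density (e k * \<omega>) *\<^sub>R (cis (\<omega> * x) * fourier \<phi> \<omega>)) \<le> cmod (fourier \<phi> \<omega>)"
        by (simp add: norm_mult normal_density_nonneg)
    qed
  qed measurable
  have 2: "(\<lambda>k. LINT y|lborel. std_normal_density y * \<phi> (x + e k * y)) \<longlonglongrightarrow> (LINT y|lborel. std_normal_density y * \<phi> x)"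
  proof (rule integral_dominated_convergence[where w="\<lambda>y. std_normal_density y * M"])
    show "integrable lborel (\<lambda>y. std_normal_density y * M)"
      by (intro integrable_mult_left integrable_std_normal)
    show "AE y in lborel. (\<lambda>k. std_normal_density y * \<phi> (x + e k * y)) \<longlonglongrightarrow> std_normal_density y * \<phi> x"
    proof (rule AE_I2)
      fix y
      have "(\<lambda>k. x + e k * y) \<longlonglongrightarrow> x"
        using tendsto_add[OF tendsto_const[of x] tendsto_mult_left_zero[OF e(2), of y]] by simp
      from isCont_tendsto_compose[OF cont_\<phi> this]
      show "(\<lambda>k. std_normal_density y * \<phi> (x + e k * y)) \<longlonglongrightarrow> std_normal_density y * \<phi> x"
        by (intro tendsto_mult tendsto_const)
    qed
    show "AE y in lborel. norm (std_normal_density y * \<phi> (x + e k * y)) \<le> std_normal_density y * M" for k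
    proof (rule AE_I2)
      fix y
      show "norm (std_normal_density y * \<phi> (x + e k * y)) \<le> std_normal_density y * M"
        unfolding real_norm_def abs_mult abs_of_nonneg[OF normal_density_nonneg]
        by (intro mult_left_mono M normal_density_nonneg)
    qed
  qed measurable
  have "(LINT \<omega>|lborel. std_normal_density 0 *\<^sub>R (cis (\<omega> * x) * fourier \<phi> \<omega>)) = of_real (LINT y|lborel. std_normal_density y * \<phi> x)"
  proof (rule LIMSEQ_unique[OF 1])
    show "(\<lambda>k. LINT \<omega>|lborel. std_normal_density (e k * \<omega>) *\<^sub>R (cis (\<omega> * x) * fourier \<phi> \<omega>))
      \<longlonglongrightarrow> of_real (LINT y|lborel. std_normal_density y * \<phi> x)"
      unfolding Gaussian_mollification[OF \<phi> e(1)] by (intro tendsto_of_real 2)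
  qed
  moreover have "std_normal_density 0 = 1 / sqrt (2 * pi)" by (simp add: std_normal_density_def)
  ultimately show ?thesis by (simp add: integral_std_normal scaleR_conv_of_real)
qed

text \<open>Inversion is inserted for \<phi> only, after which Fubini produces the transform of w.
  This asymmetry is deliberate: w is later an arbitrary element of the closure, for which inversion
  has not been established.\<close>

lemma Parseval_test:
  assumes \<phi>: "\<phi> \<in> test_functions" and w: "integrable lborel w"
  shows "of_real (LINT x|lborel. w x * \<phi> x) = (LINT \<omega>|lborel. fourier \<phi> \<omega> * cnj (fourier w \<omega>))"
proof -
  note [measurable] = borel_measurable_integrable[OF w] fourier_measurable[OF test_measurable[OF \<phi>]]
  define F where "F x \<omega> = of_real (w x) * (cis (\<omega> * x) * fourier \<phi> \<omega>)" for x \<omega>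
  have "(LINT x|lborel. LINT \<omega>|lborel. F x \<omega>) = (LINT \<omega>|lborel. LINT x|lborel. F x \<omega>)"
  proof (rule Fubini_dominated[where f="\<lambda>x. \<bar>w x\<bar>" and g="\<lambda>\<omega>. cmod (fourier \<phi> \<omega>)"])
    show "case_prod F \<in> borel_measurable (lborel \<Otimes>\<^sub>M lborel)"
      unfolding F_def by measurable
    show "integrable lborel (\<lambda>x. \<bar>w x\<bar>)" using w by simp
    show "integrable lborel (\<lambda>\<omega>. cmod (fourier \<phi> \<omega>))"
      using fourier_test_integrable[OF \<phi>] by (rule integrable_norm)
    show "norm (F x \<omega>) \<le> \<bar>w x\<bar> * cmod (fourier \<phi> \<omega>)" for \<omega> x
      unfolding F_def by (simp add: norm_mult)
  qed
  moreover have "(LINT \<omega>|lborel. F x \<omega>) = of_real (sqrt (2 * pi)) * of_real (w x * \<phi> x)" for x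
  proof -
    have "(LINT \<omega>|lborel. F x \<omega>) = of_real (w x) * (LINT \<omega>|lborel. cis (\<omega> * x) * fourier \<phi> \<omega>)"
      unfolding F_def by (rule integral_mult_right_zero)
    moreover have "(LINT \<omega>|lborel. cis (\<omega> * x) * fourier \<phi> \<omega>) = of_real (sqrt (2 * pi)) * of_real (\<phi> x)"
      unfolding fourier_inversion[OF \<phi>, of x, symmetric] by (simp flip: of_real_mult mult.assoc)
    ultimately show ?thesis by simp
  qed
  moreover have "(LINT x|lborel. F x \<omega>) = of_real (sqrt (2 * pi)) * (fourier \<phi> \<omega> * cnj (fourier w \<omega>))" for \<omega>
  proof -
    have "(LINT x|lborel. F x \<omega>) = (LINT x|lborel. fourier \<phi> \<omega> * cnj (cis (- (\<omega> * x)) * of_real (w x)))"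
      by (intro Bochner_Integration.integral_cong refl) (simp add: F_def cis_cnj)
    also have "\<dots> = fourier \<phi> \<omega> * cnj (LINT x|lborel. cis (- (\<omega> * x)) * of_real (w x))"
      unfolding integral_mult_right_zero Bochner_Integration.integral_cnj by (rule refl)
    finally show ?thesis by (simp add: fourier_def)
  qed
  ultimately have "(LINT x|lborel. complex_of_real (sqrt (2 * pi)) * of_real (w x * \<phi> x)) =
     (LINT \<omega>|lborel. of_real (sqrt (2 * pi)) * (fourier \<phi> \<omega> * cnj (fourier w \<omega>)))" by simp
  then have "complex_of_real (sqrt (2 * pi)) * (LINT x|lborel. of_real (w x * \<phi> x)) =
     of_real (sqrt (2 * pi)) * (LINT \<omega>|lborel. fourier \<phi> \<omega> * cnj (fourier w \<omega>))"
    unfolding integral_mult_right_zero .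
  then have "(LINT x|lborel. complex_of_real (w x * \<phi> x)) = (LINT \<omega>|lborel. fourier \<phi> \<omega> * cnj (fourier w \<omega>))"
    by simp
  then show ?thesis unfolding integral_complex_of_real .
qed

section \<open>Fractional Sobolev spaces\<close>

text \<open>The conditions of \<open>H_tilde\<close> apart from approximability. Norm inequalities
  are proved on this larger space, so that differences between an element and its approximations are
  covered without further argument.\<close>

definition H_Omega :: "real \<Rightarrow> (real \<Rightarrow> real) set" where
  "H_Omega \<sigma> =
     {w. w \<in> borel_measurable lborel \<and> integrable lborel (\<lambda>x. (w x)\<^sup>2) \<and>
         integrable lborel (H_density \<sigma> w) \<and> (\<forall>x. x \<notin> Omega \<longrightarrow> w x = 0)}"

text \<open>A nonnegative square root of \<open>H_density\<close>. It exhibits the Sobolev norm as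
  an L2 norm on the frequency line, to which Minkowski and Cauchy-Schwarz apply.\<close>

definition H_root :: "real \<Rightarrow> (real \<Rightarrow> real) \<Rightarrow> real \<Rightarrow> real" where
  "H_root \<sigma> w \<omega> = (1 + \<bar>\<omega>\<bar>\<^sup>2) powr (\<sigma> / 2) * cmod (fourier w \<omega>)"

lemma H_root_square: "(H_root \<sigma> w \<omega>)\<^sup>2 = H_density \<sigma> w \<omega>"
  by (simp add: H_root_def H_density_def power_mult_distrib power2_eq_square powr_add[symmetric])

lemma H_root_nonneg: "H_root \<sigma> w \<omega> \<ge> 0"
  by (simp add: H_root_def)

lemma H_density_nonneg: "H_density \<sigma> w \<omega> \<ge> 0"
  by (simp add: H_density_def)

lemma H_norm_eq: "H_norm \<sigma> w = sqrt (LINT \<omega>|lborel. (H_root \<sigma> w \<omega>)\<^sup>2)"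
  by (simp add: H_norm_def H_root_square)

lemma H_norm_nonneg: "H_norm \<sigma> w \<ge> 0"
  unfolding H_norm_eq by (intro real_sqrt_ge_zero integral_nonneg_AE AE_I2 zero_le_power2)

lemma H_norm_square: "(H_norm \<sigma> w)\<^sup>2 = (LINT \<omega>|lborel. H_density \<sigma> w \<omega>)"
  unfolding H_norm_def by (intro real_sqrt_pow2 integral_nonneg_AE AE_I2 H_density_nonneg)

lemma H_root_measurable:
  assumes [measurable]: "w \<in> borel_measurable borel"
  shows "H_root \<sigma> w \<in> borel_measurable lborel"
  unfolding H_root_def by measurable

lemma H_OmegaD:
  assumes "w \<in> H_Omega \<sigma>"
  shows "w \<in> borel_measurable borel" "integrable lborel (\<lambda>x. (w x)\<^sup>2)"
    "integrable lborel (\<lambda>\<omega>. (H_root \<sigma> w \<omega>)\<^sup>2)" "x \<notin> Omega \<Longrightarrow> w x = 0"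
    "integrable lborel w" "H_root \<sigma> w \<in> borel_measurable lborel"
proof -
  show w: "w \<in> borel_measurable borel" "integrable lborel (\<lambda>x. (w x)\<^sup>2)" "x \<notin> Omega \<Longrightarrow> w x = 0" for x
    using assms unfolding H_Omega_def by auto
  have "(\<lambda>\<omega>. (H_root \<sigma> w \<omega>)\<^sup>2) = H_density \<sigma> w" by (simp add: fun_eq_iff H_root_square)
  then show "integrable lborel (\<lambda>\<omega>. (H_root \<sigma> w \<omega>)\<^sup>2)"
    using assms unfolding H_Omega_def by simp
  show "integrable lborel w"
    by (rule integrable_of_square_integrable[OF w])
  show "H_root \<sigma> w \<in> borel_measurable lborel" by (rule H_root_measurable[OF w(1)])
qed

lemma H_root_lincomb_le:
  assumes "v \<in> H_Omega \<sigma>" "w \<in> H_Omega \<sigma>"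
  shows "H_root \<sigma> (\<lambda>x. a * v x + b * w x) \<omega> \<le> \<bar>a\<bar> * H_root \<sigma> v \<omega> + \<bar>b\<bar> * H_root \<sigma> w \<omega>"
proof -
  have "cmod (fourier (\<lambda>x. a * v x + b * w x) \<omega>) \<le> \<bar>a\<bar> * cmod (fourier v \<omega>) + \<bar>b\<bar> * cmod (fourier w \<omega>)"
    unfolding fourier_lincomb[OF H_OmegaD(5)[OF assms(1)] H_OmegaD(5)[OF assms(2)]]
    by (rule order_trans[OF norm_triangle_ineq]) (simp add: norm_mult)
  from mult_left_mono[OF this, of "(1 + \<bar>\<omega>\<bar>\<^sup>2) powr (\<sigma> / 2)"]
  show ?thesis unfolding H_root_def by (simp add: algebra_simps)
qed

text \<open>The triangle inequality for the transforms at each frequency survives multiplication by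
  the weight, so \<open>H_root\<close> of the combination is dominated pointwise. Domination gives
  membership, Minkowski gives the norm bound.\<close>

lemma
  assumes "v \<in> H_Omega \<sigma>" "w \<in> H_Omega \<sigma>"
  shows H_Omega_lincomb: "(\<lambda>x. a * v x + b * w x) \<in> H_Omega \<sigma>" (is "?u \<in> _")
    and H_norm_lincomb: "H_norm \<sigma> (\<lambda>x. a * v x + b * w x) \<le> \<bar>a\<bar> * H_norm \<sigma> v + \<bar>b\<bar> * H_norm \<sigma> w"
proof -
  note v = H_OmegaD[OF assms(1)] and w = H_OmegaD[OF assms(2)]
  note [measurable] = v(1,6) w(1,6)
  have u: "?u \<in> borel_measurable borel" by measurable
  let ?R = "\<lambda>\<omega>. \<bar>a\<bar> * H_root \<sigma> v \<omega> + \<bar>b\<bar> * H_root \<sigma> w \<omega>"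
  have le: "(H_root \<sigma> ?u \<omega>)\<^sup>2 \<le> (?R \<omega>)\<^sup>2" for \<omega>
    by (intro power_mono H_root_lincomb_le assms H_root_nonneg)
  have R: "integrable lborel (\<lambda>\<omega>. (?R \<omega>)\<^sup>2)"
    by (rule L2_lincomb_integrable) (use v w in simp_all)
  have int: "integrable lborel (\<lambda>\<omega>. (H_root \<sigma> ?u \<omega>)\<^sup>2)"
  proof (rule Bochner_Integration.integrable_bound[OF R])
    show "(\<lambda>\<omega>. (H_root \<sigma> ?u \<omega>)\<^sup>2) \<in> borel_measurable lborel"
      using H_root_measurable[OF u] by (rule borel_measurable_power)
  qed (use le in simp)
  have "integrable lborel (\<lambda>x. (?u x)\<^sup>2)"
    by (rule L2_lincomb_integrable) (use v w in simp_all)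
  moreover have "H_density \<sigma> ?u = (\<lambda>\<omega>. (H_root \<sigma> ?u \<omega>)\<^sup>2)" by (simp add: fun_eq_iff H_root_square)
  ultimately show "?u \<in> H_Omega \<sigma>" unfolding H_Omega_def using u int v(4) w(4) by simp
  have "H_norm \<sigma> ?u \<le> sqrt (LINT \<omega>|lborel. (?R \<omega>)\<^sup>2)"
    unfolding H_norm_eq by (intro real_sqrt_le_mono integral_mono int R le)
  also have "\<dots> \<le> sqrt (LINT \<omega>|lborel. (\<bar>a\<bar> * H_root \<sigma> v \<omega>)\<^sup>2) + sqrt (LINT \<omega>|lborel. (\<bar>b\<bar> * H_root \<sigma> w \<omega>)\<^sup>2)"
    by (rule L2_triangle) (use v w in \<open>simp_all add: power_mult_distrib\<close>)
  also have "\<dots> = \<bar>a\<bar> * H_norm \<sigma> v + \<bar>b\<bar> * H_norm \<sigma> w"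
    unfolding H_norm_eq by (simp add: power_mult_distrib real_sqrt_mult)
  finally show "H_norm \<sigma> ?u \<le> \<bar>a\<bar> * H_norm \<sigma> v + \<bar>b\<bar> * H_norm \<sigma> w" .
qed

lemma H_Omega_diff: "v \<in> H_Omega \<sigma> \<Longrightarrow> w \<in> H_Omega \<sigma> \<Longrightarrow> (\<lambda>x. v x - w x) \<in> H_Omega \<sigma>"
  using H_Omega_lincomb[of v \<sigma> w 1 "-1"] by simp

lemma H_norm_cmult:
  assumes "w \<in> H_Omega \<sigma>"
  shows "H_norm \<sigma> (\<lambda>x. c * w x) = \<bar>c\<bar> * H_norm \<sigma> w"
proof -
  have "fourier (\<lambda>x. c * w x) \<omega> = of_real c * fourier w \<omega>" for \<omega>
    using fourier_lincomb[OF H_OmegaD(5)[OF assms] H_OmegaD(5)[OF assms], of c 0] by simp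
  then have "H_root \<sigma> (\<lambda>x. c * w x) \<omega> = \<bar>c\<bar> * H_root \<sigma> w \<omega>" for \<omega>
    unfolding H_root_def by (simp add: norm_mult)
  then show ?thesis unfolding H_norm_eq by (simp add: power_mult_distrib real_sqrt_mult)
qed

lemma H_norm_diff_commute:
  assumes "v \<in> H_Omega \<sigma>" "w \<in> H_Omega \<sigma>"
  shows "H_norm \<sigma> (\<lambda>x. v x - w x) = H_norm \<sigma> (\<lambda>x. w x - v x)"
  using H_norm_cmult[OF H_Omega_diff[OF assms], of "-1"] by simp

lemma H_norm_diff_triangle:
  assumes "u \<in> H_Omega \<sigma>" "v \<in> H_Omega \<sigma>" "w \<in> H_Omega \<sigma>"
  shows "H_norm \<sigma> (\<lambda>x. u x - w x) \<le> H_norm \<sigma> (\<lambda>x. u x - v x) + H_norm \<sigma> (\<lambda>x. v x - w x)"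
  using H_norm_lincomb[OF H_Omega_diff[OF assms(1,2)] H_Omega_diff[OF assms(2,3)], of 1 1] by simp

lemma H_norm_le_add:
  assumes "u \<in> H_Omega \<sigma>" "v \<in> H_Omega \<sigma>"
  shows "H_norm \<sigma> u \<le> H_norm \<sigma> v + H_norm \<sigma> (\<lambda>x. u x - v x)"
  using H_norm_lincomb[OF assms(2) H_Omega_diff[OF assms], of 1 1] by simp

lemma test_H_Omega:
  assumes \<phi>: "\<phi> \<in> test_functions" and \<sigma>: "\<sigma> \<le> 1"
  shows "\<phi> \<in> H_Omega \<sigma>"
proof -
  note [measurable] = fourier_measurable[OF test_measurable[OF \<phi>]]
  obtain C where C: "C > 0" "\<And>\<omega>. cmod (fourier \<phi> \<omega>) \<le> C / (1 + \<omega>\<^sup>2)"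
    using fourier_decay[OF \<phi>] by metis
  have le: "H_density \<sigma> \<phi> \<omega> \<le> C\<^sup>2 * inverse (1 + \<omega>\<^sup>2)" for \<omega>
  proof -
    have eq: "q * (C / q)\<^sup>2 = C\<^sup>2 * inverse q" if "q > 0" for q
      using that by (simp add: power2_eq_square field_simps)
    have p: "1 + \<omega>\<^sup>2 > 0" by (simp add: add_pos_nonneg)
    have "(1 + \<omega>\<^sup>2) powr \<sigma> \<le> (1 + \<omega>\<^sup>2) powr 1" using \<sigma> by (intro powr_mono) auto
    then have "(1 + \<omega>\<^sup>2) powr \<sigma> * (cmod (fourier \<phi> \<omega>))\<^sup>2 \<le> (1 + \<omega>\<^sup>2) * (C / (1 + \<omega>\<^sup>2))\<^sup>2"
      using p by (intro mult_mono power_mono C) auto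
    also have "\<dots> = C\<^sup>2 * inverse (1 + \<omega>\<^sup>2)" using eq[OF p] .
    finally show ?thesis by (simp add: H_density_def)
  qed
  have "integrable lborel (\<lambda>\<omega>::real. C\<^sup>2 * inverse (1 + \<omega>\<^sup>2))"
    by (intro integrable_mult_right integrable_inverse_square)
  then have "integrable lborel (H_density \<sigma> \<phi>)"
  proof (rule Bochner_Integration.integrable_bound)
    show "H_density \<sigma> \<phi> \<in> borel_measurable lborel" unfolding H_density_def by measurable
    show "AE \<omega> in lborel. norm (H_density \<sigma> \<phi> \<omega>) \<le> norm (C\<^sup>2 * inverse (1 + \<omega>\<^sup>2))"
      unfolding real_norm_def
      by (intro AE_I2) (rule order_trans[OF _ abs_ge_self], unfold abs_of_nonneg[OF H_density_nonneg], rule le)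
  qed
  then show ?thesis unfolding H_Omega_def
    using test_measurable[OF \<phi>] test_integrable_square[OF \<phi>] test_zero[OF \<phi>] by simp
qed

lemma H_tilde_H_Omega: "u \<in> H_tilde \<sigma> \<Longrightarrow> u \<in> H_Omega \<sigma>"
  unfolding H_tilde_def H_Omega_def by blast

lemma H_tilde_approx:
  assumes "u \<in> H_tilde \<sigma>"
  obtains \<phi> where "\<And>k::nat. \<phi> k \<in> test_functions" "(\<lambda>k. H_norm \<sigma> (\<lambda>x. \<phi> k x - u x)) \<longlonglongrightarrow> 0"
  using assms unfolding H_tilde_def by blast

lemma H_tildeI:
  assumes "u \<in> H_Omega \<sigma>" "\<And>k::nat. \<phi> k \<in> test_functions" "(\<lambda>k. H_norm \<sigma> (\<lambda>x. \<phi> k x - u x)) \<longlonglongrightarrow> 0"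
  shows "u \<in> H_tilde \<sigma>"
  using assms unfolding H_tilde_def H_Omega_def by blast

lemma H_norm_zero: "H_norm \<sigma> (\<lambda>x. 0) = 0"
  by (simp add: H_norm_def H_density_def fourier_def)

lemma test_H_tilde:
  assumes "\<phi> \<in> test_functions" "\<sigma> \<le> 1"
  shows "\<phi> \<in> H_tilde \<sigma>"
  by (rule H_tildeI[OF test_H_Omega[OF assms], of "\<lambda>_. \<phi>"]) (simp_all add: assms H_norm_zero)

text \<open>Stated for prescribed sequences, because linearity of the extended derivative is proved
  along the combined sequence itself.\<close>

lemma approx_lincomb:
  assumes \<sigma>: "\<sigma> \<le> 1" and v: "v \<in> H_Omega \<sigma>" and w: "w \<in> H_Omega \<sigma>"
    and \<phi>: "\<And>k::nat. \<phi> k \<in> test_functions" "(\<lambda>k. H_norm \<sigma> (\<lambda>x. \<phi> k x - v x)) \<longlonglongrightarrow> 0"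
    and \<psi>: "\<And>k::nat. \<psi> k \<in> test_functions" "(\<lambda>k. H_norm \<sigma> (\<lambda>x. \<psi> k x - w x)) \<longlonglongrightarrow> 0"
  shows "(\<lambda>k. H_norm \<sigma> (\<lambda>x. (a * \<phi> k x + b * \<psi> k x) - (a * v x + b * w x))) \<longlonglongrightarrow> 0"
proof -
  have *: "(\<lambda>x. (a * \<phi> k x + b * \<psi> k x) - (a * v x + b * w x)) = (\<lambda>x. a * (\<phi> k x - v x) + b * (\<psi> k x - w x))" for k
    by (simp add: algebra_simps)
  have ub: "\<forall>\<^sub>F k in sequentially. H_norm \<sigma> (\<lambda>x. (a * \<phi> k x + b * \<psi> k x) - (a * v x + b * w x))
    \<le> \<bar>a\<bar> * H_norm \<sigma> (\<lambda>x. \<phi> k x - v x) + \<bar>b\<bar> * H_norm \<sigma> (\<lambda>x. \<psi> k x - w x)"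
    unfolding *
    by (intro always_eventually allI H_norm_lincomb H_Omega_diff v w test_H_Omega[OF \<phi>(1) \<sigma>] test_H_Omega[OF \<psi>(1) \<sigma>])
  have lim: "(\<lambda>k. \<bar>a\<bar> * H_norm \<sigma> (\<lambda>x. \<phi> k x - v x) + \<bar>b\<bar> * H_norm \<sigma> (\<lambda>x. \<psi> k x - w x)) \<longlonglongrightarrow> 0"
    using tendsto_add[OF tendsto_mult_right_zero[OF \<phi>(2), of "\<bar>a\<bar>"] tendsto_mult_right_zero[OF \<psi>(2), of "\<bar>b\<bar>"]] by simp
  show ?thesis
    by (rule tendsto_sandwich[OF always_eventually ub tendsto_const lim]) (simp add: H_norm_nonneg)
qed

lemma H_tilde_lincomb:
  assumes \<sigma>: "\<sigma> \<le> 1" and v: "v \<in> H_tilde \<sigma>" and w: "w \<in> H_tilde \<sigma>"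
  shows "(\<lambda>x. a * v x + b * w x) \<in> H_tilde \<sigma>"
proof -
  obtain \<phi> where \<phi>: "\<And>k::nat. \<phi> k \<in> test_functions" "(\<lambda>k. H_norm \<sigma> (\<lambda>x. \<phi> k x - v x)) \<longlonglongrightarrow> 0"
    using H_tilde_approx[OF v] by metis
  obtain \<psi> where \<psi>: "\<And>k::nat. \<psi> k \<in> test_functions" "(\<lambda>k. H_norm \<sigma> (\<lambda>x. \<psi> k x - w x)) \<longlonglongrightarrow> 0"
    using H_tilde_approx[OF w] by metis
  note vw = H_tilde_H_Omega[OF v] H_tilde_H_Omega[OF w]
  show ?thesis
    by (rule H_tildeI[OF H_Omega_lincomb[OF vw] test_lincomb[OF \<phi>(1) \<psi>(1)] approx_lincomb[OF \<sigma> vw \<phi> \<psi>]])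
qed

lemma L2_inner_eq_lborel:
  assumes "\<And>x. x \<notin> Omega \<Longrightarrow> w x = 0"
  shows "L2_inner w v = (LINT x|lborel. w x * v x)"
proof -
  have "indicator Omega x *\<^sub>R (w x * v x) = w x * v x" for x
    using assms[of x] by (cases "x \<in> Omega") auto
  then show ?thesis by (simp only: L2_inner_def set_lebesgue_integral_def)
qed

lemma H_Omega_L2_Omega:
  assumes "w \<in> H_Omega \<sigma>"
  shows "w \<in> L2_Omega"
proof -
  note w = H_OmegaD[OF assms]
  have "integrable OmegaM (\<lambda>x. (w x)\<^sup>2)"
    using integrable_mult_indicator[OF Omega_sets(1) w(2)] by (simp add: integrable_restrict_space)
  moreover have "w \<in> borel_measurable OmegaM"
    using w(1) by (intro measurable_restrict_space1) simp
  ultimately show ?thesis unfolding L2_Omega_iff by blast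
qed

text \<open>Parseval together with the fact that the Sobolev weight is at least 1. This lets a
  right-hand side given by a Sobolev function act as a bounded functional with constant 1.\<close>

lemma L2_inner_H_bound:
  assumes w: "w \<in> H_Omega \<sigma>" and \<phi>: "\<phi> \<in> test_functions" and \<sigma>: "0 \<le> \<sigma>" "\<sigma> \<le> 1"
  shows "\<bar>L2_inner w \<phi>\<bar> \<le> H_norm \<sigma> w * H_norm \<sigma> \<phi>"
proof -
  note W = H_OmegaD[OF w] and P = H_OmegaD[OF test_H_Omega[OF \<phi> \<sigma>(2)]]
  have le: "cmod (fourier v \<omega>) \<le> H_root \<sigma> v \<omega>" for v \<omega>
  proof -
    have "1 \<le> (1 + \<bar>\<omega>\<bar>\<^sup>2) powr (\<sigma> / 2)" using \<sigma> by (intro ge_one_powr_ge_zero) auto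
    from mult_right_mono[OF this, of "cmod (fourier v \<omega>)"] show ?thesis by (simp add: H_root_def)
  qed
  have int: "integrable lborel (\<lambda>\<omega>. H_root \<sigma> w \<omega> * H_root \<sigma> \<phi> \<omega>)"
    by (rule L2_mult_integrable[OF W(6) P(6) W(3) P(3)])
  have "\<bar>L2_inner w \<phi>\<bar> = cmod (of_real (LINT x|lborel. w x * \<phi> x))"
    by (subst L2_inner_eq_lborel) (use W(4) in auto)
  also have "\<dots> = cmod (LINT \<omega>|lborel. fourier \<phi> \<omega> * cnj (fourier w \<omega>))"
    unfolding Parseval_test[OF \<phi> W(5)] ..
  also have "\<dots> \<le> (LINT \<omega>|lborel. cmod (fourier \<phi> \<omega> * cnj (fourier w \<omega>)))"
    by (rule integral_norm_bound)
  also have "\<dots> \<le> (LINT \<omega>|lborel. H_root \<sigma> w \<omega> * H_root \<sigma> \<phi> \<omega>)"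
  proof (rule integral_mono'[OF int])
    fix \<omega>
    show "cmod (fourier \<phi> \<omega> * cnj (fourier w \<omega>)) \<le> H_root \<sigma> w \<omega> * H_root \<sigma> \<phi> \<omega>"
      unfolding norm_mult complex_mod_cnj mult.commute[of "cmod (fourier \<phi> \<omega>)"]
      by (intro mult_mono le H_root_nonneg norm_ge_zero)
  qed (simp add: H_root_nonneg)
  also have "\<dots> \<le> H_norm \<sigma> w * H_norm \<sigma> \<phi>"
    unfolding H_norm_eq using L2_Cauchy_Schwarz[OF W(6) P(6) W(3) P(3)] by linarith
  finally show ?thesis .
qed

section \<open>The homogeneous energy and a Poincare inequality\<close>

definition energy_density :: "real \<Rightarrow> (real \<Rightarrow> real) \<Rightarrow> real \<Rightarrow> real" where
  "energy_density \<sigma> \<phi> \<omega> = \<bar>\<omega>\<bar> powr (2 * \<sigma>) * (cmod (fourier \<phi> \<omega>))\<^sup>2"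

lemma energy_density_le: 
  assumes "0 \<le> \<sigma>"
  shows "energy_density \<sigma> \<phi> \<omega> \<le> H_density \<sigma> \<phi> \<omega>"
proof -
  have "\<bar>\<omega>\<bar> powr (2 * \<sigma>) \<le> (1 + \<bar>\<omega>\<bar>\<^sup>2) powr \<sigma>"
  proof (cases "\<omega> = 0")
    case False
    then have "\<bar>\<omega>\<bar> powr (2 * \<sigma>) = (\<bar>\<omega>\<bar>\<^sup>2) powr \<sigma>"
      by (simp add: powr_powr[symmetric] powr_numeral)
    also have "\<dots> \<le> (1 + \<bar>\<omega>\<bar>\<^sup>2) powr \<sigma>" using assms by (intro powr_mono2) auto
    finally show ?thesis .
  qed simp
  then show ?thesis unfolding energy_density_def H_density_def by (intro mult_right_mono) auto
qed

lemma energy_integrable: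
  assumes \<phi>: "\<phi> \<in> test_functions" and \<sigma>: "0 \<le> \<sigma>" "\<sigma> \<le> 1"
  shows "integrable lborel (energy_density \<sigma> \<phi>)"
proof (rule Bochner_Integration.integrable_bound)
  note [measurable] = fourier_measurable[OF test_measurable[OF \<phi>]]
  show "integrable lborel (H_density \<sigma> \<phi>)"
    using test_H_Omega[OF \<phi> \<sigma>(2)] by (simp add: H_Omega_def)
  show "energy_density \<sigma> \<phi> \<in> borel_measurable lborel" unfolding energy_density_def by measurable
  show "AE \<omega> in lborel. norm (energy_density \<sigma> \<phi> \<omega>) \<le> norm (H_density \<sigma> \<phi> \<omega>)"
  proof (rule AE_I2)
    fix \<omega>
    have "energy_density \<sigma> \<phi> \<omega> \<ge> 0" by (simp add: energy_density_def)
    then show "norm (energy_density \<sigma> \<phi> \<omega>) \<le> norm (H_density \<sigma> \<phi> \<omega>)"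
      using energy_density_le[OF \<sigma>(1), of \<phi> \<omega>] by simp
  qed
qed

lemma test_L1_L2:
  assumes \<phi>: "\<phi> \<in> test_functions"
  shows "(LINT x|lborel. \<bar>\<phi> x\<bar>)\<^sup>2 \<le> (LINT x|lborel. (\<phi> x)\<^sup>2)"
proof -
  note [measurable] = test_measurable[OF \<phi>]
  have sq: "(indicator Omega x :: real)\<^sup>2 = indicator Omega x" for x :: real by (simp add: indicator_def)
  have ab: "\<bar>\<phi> x\<bar> * indicator Omega x = \<bar>\<phi> x\<bar>" for x
    using test_zero[OF \<phi>, of x] by (cases "x \<in> Omega") auto
  have int: "integrable lborel (indicator Omega :: real \<Rightarrow> real)"
    by (simp add: Omega_def)
  have "\<bar>LINT x|lborel. \<bar>\<phi> x\<bar> * indicator Omega x\<bar> \<le>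
     sqrt (LINT x|lborel. \<bar>\<phi> x\<bar>\<^sup>2) * sqrt (LINT x|lborel. (indicator Omega x)\<^sup>2)"
    by (rule L2_Cauchy_Schwarz) (use test_integrable_square[OF \<phi>] int in \<open>simp_all add: sq\<close>)
  also have "(LINT x|lborel. (indicator Omega x)\<^sup>2) = (1::real)"
    unfolding sq by (simp add: Omega_def)
  finally have "(LINT x|lborel. \<bar>\<phi> x\<bar>) \<le> sqrt (LINT x|lborel. (\<phi> x)\<^sup>2)"
    unfolding ab by simp
  then have "(LINT x|lborel. \<bar>\<phi> x\<bar>)\<^sup>2 \<le> (sqrt (LINT x|lborel. (\<phi> x)\<^sup>2))\<^sup>2"
    by (intro power_mono integral_nonneg_AE AE_I2) auto
  then show ?thesis by simp
qed

lemma Plancherel_test: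
  assumes \<phi>: "\<phi> \<in> test_functions"
  shows "(LINT x|lborel. (\<phi> x)\<^sup>2) = (LINT \<omega>|lborel. (cmod (fourier \<phi> \<omega>))\<^sup>2)"
proof -
  have "complex_of_real (LINT x|lborel. (\<phi> x)\<^sup>2) = (LINT \<omega>|lborel. complex_of_real ((cmod (fourier \<phi> \<omega>))\<^sup>2))"
    using Parseval_test[OF \<phi> test_integrable[OF \<phi>]]
    by (simp only: complex_norm_square power2_eq_square[of "\<phi> _"])
  then show ?thesis unfolding integral_complex_of_real of_real_eq_iff .
qed

text \<open>
  Since \<open>\<phi>\<close> is supported in a unit interval, \<open>\<bar>\<F>\<phi>\<bar>\<^sup>2\<close> is at most \<open>1/(2\<pi>)\<close> times the squared
  \<open>L\<^sub>2\<close> norm, so frequencies below \<open>1\<close> carry at most the fraction \<open>1/\<pi>\<close> of that norm.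
\<close>

lemma H_norm_le_energy:
  assumes \<phi>: "\<phi> \<in> test_functions" and \<sigma>: "0 \<le> \<sigma>" "\<sigma> \<le> 1"
  shows "(H_norm \<sigma> \<phi>)\<^sup>2 \<le> 6 * (LINT \<omega>|lborel. energy_density \<sigma> \<phi> \<omega>)"
proof -
  let ?F = "\<lambda>\<omega>. (cmod (fourier \<phi> \<omega>))\<^sup>2"
  define N E where "N = (LINT \<omega>|lborel. ?F \<omega>)" and "E = (LINT \<omega>|lborel. energy_density \<sigma> \<phi> \<omega>)"
  have iF: "integrable lborel ?F"
    using test_H_Omega[OF \<phi>, of 0] unfolding H_Omega_def H_density_def by (simp add: add_pos_nonneg less_imp_neq[symmetric])
  have iE: "integrable lborel (energy_density \<sigma> \<phi>)" by (rule energy_integrable[OF \<phi> \<sigma>])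
  have low: "?F \<omega> \<le> N / (2 * pi)" for \<omega>
  proof -
    have "?F \<omega> \<le> ((LINT x|lborel. \<bar>\<phi> x\<bar>) / sqrt (2 * pi))\<^sup>2"
      by (intro power_mono fourier_bound norm_ge_zero)
    also have "\<dots> = (LINT x|lborel. \<bar>\<phi> x\<bar>)\<^sup>2 / (2 * pi)" by (simp add: power_divide)
    also have "\<dots> \<le> N / (2 * pi)"
      using test_L1_L2[OF \<phi>] unfolding N_def Plancherel_test[OF \<phi>] by (intro divide_right_mono) auto
    finally show ?thesis .
  qed
  have pt: "?F \<omega> \<le> indicator {-1..1} \<omega> * (N / (2 * pi)) + energy_density \<sigma> \<phi> \<omega>" for \<omega>
  proof (cases "\<omega> \<in> {-1..1}")
    case True
    then show ?thesis using low[of \<omega>] by (simp add: energy_density_def add_increasing2)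
  next
    case False
    then have "1 \<le> \<bar>\<omega>\<bar> powr (2 * \<sigma>)" using \<sigma> by (intro ge_one_powr_ge_zero) auto
    from mult_right_mono[OF this, of "?F \<omega>"] False show ?thesis by (simp add: energy_density_def)
  qed
  have iI: "integrable lborel (\<lambda>\<omega>::real. indicator {-1..1} \<omega> * (N / (2 * pi)))"
    by (intro integrable_mult_left) simp
  have "N \<le> (LINT \<omega>|lborel. indicator {-1..1} \<omega> * (N / (2 * pi)) + energy_density \<sigma> \<phi> \<omega>)"
    unfolding N_def[symmetric] using iF iE iI unfolding N_def by (intro integral_mono Bochner_Integration.integrable_add) (use pt in \<open>simp_all add: N_def\<close>)
  also have "\<dots> = 2 * (N / (2 * pi)) + E"
    using iE iI by (subst Bochner_Integration.integral_add) (simp_all add: E_def)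
  finally have "N \<le> N / pi + E" by simp
  moreover have "N \<ge> 0" unfolding N_def by simp
  then have "N / pi \<le> N / 3" using pi_gt3 by (intro divide_left_mono) auto
  \<comment> \<open>Absorbing N / 3 leaves N \<le> 3/2 E. Rounding up to 2 E turns the later bound 2
    N + 2 E into the constant 6 of the statement.\<close>
  ultimately have NE: "N \<le> 2 * E" using \<open>N \<ge> 0\<close> by linarith
  have dens: "H_density \<sigma> \<phi> \<omega> \<le> 2 * ?F \<omega> + 2 * energy_density \<sigma> \<phi> \<omega>" for \<omega>
  proof -
    have "(1 + \<bar>\<omega>\<bar>\<^sup>2) powr \<sigma> \<le> 2 * (1 + \<bar>\<omega>\<bar> powr (2 * \<sigma>))"
    proof (cases "\<bar>\<omega>\<bar> \<le> 1")
      case True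
      then have "\<bar>\<omega>\<bar>\<^sup>2 \<le> 1" by (simp add: abs_square_le_1)
      then have "(1 + \<bar>\<omega>\<bar>\<^sup>2) powr \<sigma> \<le> 2 powr \<sigma>" using \<sigma> by (intro powr_mono2) auto
      also have "\<dots> \<le> 2 powr 1" using \<sigma> by (intro powr_mono) auto
      also have "\<dots> \<le> 2 * (1 + \<bar>\<omega>\<bar> powr (2 * \<sigma>))" by simp
      finally show ?thesis .
    next
      case False
      then have "1 \<le> \<bar>\<omega>\<bar>\<^sup>2" by (intro one_le_power) simp
      then have "(1 + \<bar>\<omega>\<bar>\<^sup>2) powr \<sigma> \<le> (2 * \<bar>\<omega>\<bar>\<^sup>2) powr \<sigma>" using \<sigma> by (intro powr_mono2) auto
      also have "\<dots> = 2 powr \<sigma> * (\<bar>\<omega>\<bar>\<^sup>2) powr \<sigma>" by (simp add: powr_mult)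
      also have "(\<bar>\<omega>\<bar>\<^sup>2) powr \<sigma> = \<bar>\<omega>\<bar> powr (2 * \<sigma>)"
        using False by (simp add: powr_powr[symmetric] powr_numeral)
      also have "2 powr \<sigma> * \<bar>\<omega>\<bar> powr (2 * \<sigma>) \<le> 2 powr 1 * \<bar>\<omega>\<bar> powr (2 * \<sigma>)"
        using \<sigma> by (intro mult_right_mono powr_mono) auto
      finally show ?thesis by simp
    qed
    from mult_right_mono[OF this, of "?F \<omega>"] show ?thesis
      unfolding H_density_def energy_density_def by (simp add: algebra_simps)
  qed
  have "(H_norm \<sigma> \<phi>)\<^sup>2 \<le> (LINT \<omega>|lborel. 2 * ?F \<omega> + 2 * energy_density \<sigma> \<phi> \<omega>)"
    unfolding H_norm_square using iF iE test_H_Omega[OF \<phi> \<sigma>(2)] dens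
    by (intro integral_mono Bochner_Integration.integrable_add integrable_mult_right) (simp_all add: H_Omega_def)
  also have "\<dots> = 2 * N + 2 * E" using iF iE by (simp add: N_def E_def)
  finally show ?thesis using NE by (simp add: E_def)
qed

section \<open>Riesz kernels\<close>

text \<open>The one-sided power kernel without its Gamma factor. Being zero on the negative half
  line, it allows integrals over {0..x} and {x..1} to be written over the whole line.\<close>

definition rker :: "real \<Rightarrow> real \<Rightarrow> real" where
  "rker \<sigma> r = (if 0 < r then r powr (- \<sigma>) else 0)"

lemma rker_nonneg: "0 \<le> rker \<sigma> r"
  by (simp add: rker_def)

lemma rker_measurable [measurable]: "rker \<sigma> \<in> borel_measurable borel"
  unfolding rker_def[abs_def] by measurable

lemma rker_scale: "0 < d \<Longrightarrow> rker \<sigma> (d * z) = d powr (- \<sigma>) * rker \<sigma> z"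
  by (simp add: rker_def powr_mult zero_less_mult_iff)

lemma rker_scale_mult:
  assumes "0 < d"
  shows "ennreal (rker \<sigma> (d * a) * rker \<sigma> (d * b)) = ennreal (d powr (- 2 * \<sigma>)) * ennreal (rker \<sigma> a * rker \<sigma> b)"
proof -
  have "rker \<sigma> (d * a) * rker \<sigma> (d * b) = (d powr (- \<sigma>) * d powr (- \<sigma>)) * (rker \<sigma> a * rker \<sigma> b)"
    unfolding rker_scale[OF assms] by (simp only: mult_ac)
  also have "d powr (- \<sigma>) * d powr (- \<sigma>) = d powr (- 2 * \<sigma>)"
    unfolding powr_add[symmetric] by simp
  finally show ?thesis by (simp only:) (rule ennreal_mult, simp_all add: rker_nonneg)
qed

lemma rker_le_1: "0 \<le> \<sigma> \<Longrightarrow> 1 \<le> r \<Longrightarrow> rker \<sigma> r \<le> 1"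
  using powr_mono2'[of "- \<sigma>" 1 r] by (simp add: rker_def)

lemma rker_ge_1: "0 \<le> \<sigma> \<Longrightarrow> 0 < r \<Longrightarrow> r \<le> 1 \<Longrightarrow> 1 \<le> rker \<sigma> r"
  using powr_mono2'[of "- \<sigma>" r 1] by (simp add: rker_def)

lemma rker_antimono: "0 \<le> \<sigma> \<Longrightarrow> 0 < r \<Longrightarrow> r \<le> r' \<Longrightarrow> rker \<sigma> r' \<le> rker \<sigma> r"
  using powr_mono2'[of "- \<sigma>" r r'] by (simp add: rker_def)

lemma nn_integral_rker_unit:
  assumes "\<sigma> < 1"
  shows "(\<integral>\<^sup>+z. ennreal (rker \<sigma> z) * indicator {..1} z \<partial>lborel) = ennreal (1 / (1 - \<sigma>))"
proof -
  have "((\<lambda>z. z powr (- \<sigma>)) has_integral (1 powr (- \<sigma> + 1) / (- \<sigma> + 1))) {0..1}"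
    using assms by (intro has_integral_powr_from_0) auto
  then have "(\<integral>\<^sup>+z. ennreal (z powr (- \<sigma>)) * indicator {0..1} z \<partial>lborel) = ennreal (1 / (1 - \<sigma>))"
    using nn_integral_has_integral_lebesgue'[of "{0..1}" "\<lambda>z. z powr (- \<sigma>)"] by simp
  moreover have "(\<integral>\<^sup>+z. ennreal (rker \<sigma> z) * indicator {..1} z \<partial>lborel) =
      (\<integral>\<^sup>+z. ennreal (z powr (- \<sigma>)) * indicator {0..1} z \<partial>lborel)"
    by (intro nn_integral_cong) (auto simp: rker_def indicator_def)
  ultimately show ?thesis by simp
qed

lemma nn_integral_rker_tail:
  assumes "1 < \<sigma>"
  shows "(\<integral>\<^sup>+z. ennreal (rker \<sigma> z) * indicator {1..} z \<partial>lborel) = ennreal (1 / (\<sigma> - 1))"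
proof -
  have "((\<lambda>z. z powr (- \<sigma>)) has_integral - (1 powr (- \<sigma> + 1)) / (- \<sigma> + 1)) {1..}"
    using assms by (intro has_integral_powr_to_inf) auto
  moreover have "- (1 powr (- \<sigma> + 1)) / (- \<sigma> + 1) = 1 / (\<sigma> - 1)"
    using assms by (simp add: divide_simps)
  ultimately have "((\<lambda>z. z powr (- \<sigma>)) has_integral 1 / (\<sigma> - 1)) {1..}"
    by (simp only:)
  then have "(\<integral>\<^sup>+z. ennreal (z powr (- \<sigma>)) * indicator {1..} z \<partial>lborel) = ennreal (1 / (\<sigma> - 1))"
    by (intro nn_integral_has_integral_lebesgue') auto
  moreover have "(\<integral>\<^sup>+z. ennreal (rker \<sigma> z) * indicator {1..} z \<partial>lborel) =
      (\<integral>\<^sup>+z. ennreal (z powr (- \<sigma>)) * indicator {1..} z \<partial>lborel)"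
    by (intro nn_integral_cong) (auto simp: rker_def indicator_def)
  ultimately show ?thesis by simp
qed

section \<open>Beta integrals and correlations of one-sided kernels\<close>

definition same_const :: "real \<Rightarrow> real" where
  "same_const \<sigma> = enn2real (\<integral>\<^sup>+z. ennreal (rker \<sigma> (z + 1) * rker \<sigma> z) \<partial>lborel)"

text \<open>The Beta value B(1 - \<sigma>, 1 - \<sigma>), which arises when a left-sided kernel
  meets a right-sided one.\<close>

definition mixed_const :: "real \<Rightarrow> real" where
  "mixed_const \<sigma> = enn2real (\<integral>\<^sup>+z. ennreal (rker \<sigma> z * rker \<sigma> (1 - z)) \<partial>lborel)"

text \<open>The integral is the Beta value B(1 - \<sigma>, 2 \<sigma> - 1). Near 0 the shifted
  factor is at most 1 and \<sigma> < 1 gives convergence; beyond 1 both factors are bounded by the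
  unshifted one and 2 \<sigma> > 1 gives convergence.\<close>

lemma same_const:
  assumes "1/2 < \<sigma>" "\<sigma> < 1"
  shows "(\<integral>\<^sup>+z. ennreal (rker \<sigma> (z + 1) * rker \<sigma> z) \<partial>lborel) = ennreal (same_const \<sigma>)"
proof -
  have "(\<integral>\<^sup>+z. ennreal (rker \<sigma> (z + 1) * rker \<sigma> z) \<partial>lborel) \<le>
     (\<integral>\<^sup>+z. ennreal (rker \<sigma> z) * indicator {..1} z + ennreal (rker (2 * \<sigma>) z) * indicator {1..} z \<partial>lborel)"
  proof (intro nn_integral_mono)
    fix z :: real
    consider "z \<le> 0" | "0 < z" "z \<le> 1" | "1 < z" by linarith
    then show "ennreal (rker \<sigma> (z + 1) * rker \<sigma> z) \<le> ennreal (rker \<sigma> z) * indicator {..1} z + ennreal (rker (2 * \<sigma>) z) * indicator {1..} z"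
    proof cases
      case 1
      then show ?thesis by (simp add: rker_def)
    next
      case 2
      have "rker \<sigma> (z + 1) * rker \<sigma> z \<le> 1 * rker \<sigma> z"
        using 2 assms by (intro mult_right_mono rker_le_1 rker_nonneg) auto
      then have "ennreal (rker \<sigma> (z + 1) * rker \<sigma> z) \<le> ennreal (rker \<sigma> z)" by (simp add: ennreal_leI)
      then show ?thesis using 2 by (simp add: add_increasing2)
    next
      case 3
      have "rker \<sigma> (z + 1) * rker \<sigma> z \<le> rker \<sigma> z * rker \<sigma> z"
        using 3 assms by (intro mult_right_mono rker_antimono rker_nonneg) auto
      also have "\<dots> = rker (2 * \<sigma>) z" using 3 by (simp add: rker_def powr_add[symmetric])
      finally show ?thesis using 3 by (simp add: ennreal_leI)
    qed
  qed
  also have "\<dots> = ennreal (1 / (1 - \<sigma>)) + ennreal (1 / (2 * \<sigma> - 1))"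
    using nn_integral_rker_unit[of \<sigma>] nn_integral_rker_tail[of "2 * \<sigma>"] assms
    by (subst nn_integral_add) auto
  finally have "(\<integral>\<^sup>+z. ennreal (rker \<sigma> (z + 1) * rker \<sigma> z) \<partial>lborel) < \<infinity>"
    by (rule le_less_trans) (simp add: ennreal_add_eq_top less_top)
  then show ?thesis unfolding same_const_def by simp
qed

text \<open>On either half of (0,1) one factor is singular and the other is at most 2^\<sigma> \<le>
  2. For the lower bound one factor is replaced by 1, its minimum on (0,1). The resulting 1 / (1 -
  \<sigma>) is the first of the two powers that compensate the Gamma factors.\<close>

lemma mixed_const:
  assumes "0 \<le> \<sigma>" "\<sigma> < 1"
  shows "(\<integral>\<^sup>+z. ennreal (rker \<sigma> z * rker \<sigma> (1 - z)) \<partial>lborel) = ennreal (mixed_const \<sigma>)"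
    and "1 / (1 - \<sigma>) \<le> mixed_const \<sigma>"
proof -
  let ?I = "\<integral>\<^sup>+z. ennreal (rker \<sigma> z) * indicator {..1} z \<partial>lborel"
  have "(\<integral>\<^sup>+z. ennreal (rker \<sigma> (1 - z)) * indicator {..1} (1 - z) \<partial>lborel) = ?I"
    using nn_integral_real_affine[of "\<lambda>z. ennreal (rker \<sigma> z) * indicator {..1} z" "-1" 1] by simp
  note refl_int = this
  have half: "rker \<sigma> z \<le> 2" if "1/2 \<le> z" for z
  proof -
    have "rker \<sigma> z \<le> rker \<sigma> (1/2)" using that assms by (intro rker_antimono) auto
    also have "\<dots> = 2 powr \<sigma>" by (simp add: rker_def powr_minus powr_divide)
    also have "\<dots> \<le> 2 powr 1" using assms by (intro powr_mono) auto
    finally show ?thesis by simp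
  qed
  have "(\<integral>\<^sup>+z. ennreal (rker \<sigma> z * rker \<sigma> (1 - z)) \<partial>lborel) \<le>
     (\<integral>\<^sup>+z. 2 * (ennreal (rker \<sigma> z) * indicator {..1} z) + 2 * (ennreal (rker \<sigma> (1 - z)) * indicator {..1} (1 - z)) \<partial>lborel)"
  proof (intro nn_integral_mono)
    fix z :: real
    consider "z \<le> 0 \<or> 1 \<le> z" | "0 < z" "z \<le> 1/2" | "1/2 < z" "z < 1" by linarith
    then show "ennreal (rker \<sigma> z * rker \<sigma> (1 - z)) \<le> 2 * (ennreal (rker \<sigma> z) * indicator {..1} z) + 2 * (ennreal (rker \<sigma> (1 - z)) * indicator {..1} (1 - z))"
    proof cases
      case 1
      then show ?thesis by (auto simp: rker_def)
    next
      case 2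
      have "rker \<sigma> z * rker \<sigma> (1 - z) \<le> rker \<sigma> z * 2"
        using 2 by (intro mult_left_mono half rker_nonneg) auto
      then have "ennreal (rker \<sigma> z * rker \<sigma> (1 - z)) \<le> 2 * ennreal (rker \<sigma> z)"
        by (metis ennreal_leI ennreal_mult'' ennreal_numeral mult.commute zero_le_numeral)
      then show ?thesis using 2 by (simp add: add_increasing2)
    next
      case 3
      have "rker \<sigma> z * rker \<sigma> (1 - z) \<le> 2 * rker \<sigma> (1 - z)"
        using 3 by (intro mult_right_mono half rker_nonneg) auto
      then have "ennreal (rker \<sigma> z * rker \<sigma> (1 - z)) \<le> 2 * ennreal (rker \<sigma> (1 - z))"
        by (metis ennreal_leI ennreal_mult' ennreal_numeral zero_le_numeral)
      then show ?thesis using 3 by (simp add: add_increasing)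
    qed
  qed
  also have "\<dots> = 2 * ?I + 2 * ?I"
    unfolding refl_int[symmetric] by (subst nn_integral_add) (auto simp: nn_integral_cmult refl_int)
  also have "\<dots> < \<infinity>"
    unfolding nn_integral_rker_unit[OF assms(2)]
    by (simp add: ennreal_add_eq_top ennreal_mult_eq_top_iff less_top[symmetric])
  finally have fin: "(\<integral>\<^sup>+z. ennreal (rker \<sigma> z * rker \<sigma> (1 - z)) \<partial>lborel) < \<infinity>" .
  then show eq: "(\<integral>\<^sup>+z. ennreal (rker \<sigma> z * rker \<sigma> (1 - z)) \<partial>lborel) = ennreal (mixed_const \<sigma>)"
    unfolding mixed_const_def by simp
  have "?I \<le> (\<integral>\<^sup>+z. ennreal (rker \<sigma> z * rker \<sigma> (1 - z)) \<partial>lborel)"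
  \<comment> \<open>The point 1 has to be removed: the left side is 1 there, while the reflected
    kernel is evaluated at 0 and vanishes.\<close>
  proof (intro nn_integral_mono_AE, rule AE_mp[OF AE_lborel_singleton[of 1]], rule AE_I2, rule impI)
    fix z :: real assume "z \<noteq> 1"
    show "ennreal (rker \<sigma> z) * indicator {..1} z \<le> ennreal (rker \<sigma> z * rker \<sigma> (1 - z))"
    proof (cases "0 < z \<and> z < 1")
      case True
      then have "rker \<sigma> z * 1 \<le> rker \<sigma> z * rker \<sigma> (1 - z)"
        using assms by (intro mult_left_mono rker_ge_1 rker_nonneg) auto
      then show ?thesis using True by (simp add: ennreal_leI)
    next
      case False
      then show ?thesis using \<open>z \<noteq> 1\<close> by (auto simp: rker_def indicator_def)
    qed
  qed
  then have "ennreal (1 / (1 - \<sigma>)) \<le> ennreal (mixed_const \<sigma>)"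
    unfolding eq nn_integral_rker_unit[OF assms(2)] .
  then show "1 / (1 - \<sigma>) \<le> mixed_const \<sigma>"
    using assms by (subst (asm) ennreal_le_iff) (auto simp: mixed_const_def)
qed

text \<open>Homogeneity: moving the larger singularity to the origin and rescaling by the distance d
  gives the factor d * d^(-2 \<sigma>) times a fixed integral. Symmetry in t and r reduces
  everything to t < r.\<close>

lemma rker_correlation_left:
  assumes "1/2 < \<sigma>" "\<sigma> < 1" "t \<noteq> r"
  shows "(\<integral>\<^sup>+x. ennreal (rker \<sigma> (x - t) * rker \<sigma> (x - r)) \<partial>lborel) = ennreal (same_const \<sigma> * \<bar>t - r\<bar> powr (1 - 2 * \<sigma>))"
proof -
  have *: "(\<integral>\<^sup>+x. ennreal (rker \<sigma> (x - t) * rker \<sigma> (x - r)) \<partial>lborel) = ennreal (same_const \<sigma> * \<bar>t - r\<bar> powr (1 - 2 * \<sigma>))"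
    if "t < r" for t r
  proof -
    define d where "d = r - t"
    have d: "0 < d" using that by (simp add: d_def)
    have "(\<integral>\<^sup>+x. ennreal (rker \<sigma> (x - t) * rker \<sigma> (x - r)) \<partial>lborel) =
       ennreal \<bar>d\<bar> * (\<integral>\<^sup>+z. ennreal (rker \<sigma> (r + d * z - t) * rker \<sigma> (r + d * z - r)) \<partial>lborel)"
      using d by (intro nn_integral_real_affine) auto
    also have "(\<lambda>z. ennreal (rker \<sigma> (r + d * z - t) * rker \<sigma> (r + d * z - r))) =
       (\<lambda>z. ennreal (d powr (- 2 * \<sigma>)) * ennreal (rker \<sigma> (z + 1) * rker \<sigma> z))"
    proof
      fix z
      have "r + d * z - t = d * (z + 1)" "r + d * z - r = d * z" by (simp_all add: d_def algebra_simps)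
      then show "ennreal (rker \<sigma> (r + d * z - t) * rker \<sigma> (r + d * z - r)) = ennreal (d powr (- 2 * \<sigma>)) * ennreal (rker \<sigma> (z + 1) * rker \<sigma> z)"
        by (simp only: rker_scale_mult[OF d])
    qed
    also have "ennreal \<bar>d\<bar> * (\<integral>\<^sup>+z. ennreal (d powr (- 2 * \<sigma>)) * ennreal (rker \<sigma> (z + 1) * rker \<sigma> z) \<partial>lborel) =
       ennreal d * (ennreal (d powr (- 2 * \<sigma>)) * ennreal (same_const \<sigma>))"
      using d same_const[OF assms(1,2)] by (simp add: nn_integral_cmult)
    also have "\<dots> = ennreal (d * (d powr (- 2 * \<sigma>) * same_const \<sigma>))"
      using d by (simp add: ennreal_mult'' ennreal_mult' same_const_def)
    also have "d * (d powr (- 2 * \<sigma>) * same_const \<sigma>) = same_const \<sigma> * (d powr 1 * d powr (- 2 * \<sigma>))"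
      using d by simp
    also have "d powr 1 * d powr (- 2 * \<sigma>) = \<bar>t - r\<bar> powr (1 - 2 * \<sigma>)"
      unfolding powr_add[symmetric] using that by (simp add: d_def)
    finally show ?thesis .
  qed
  show ?thesis
  proof (cases "t < r")
    case True
    then show ?thesis by (rule *)
  next
    case False
    then show ?thesis using *[of r t] assms(3) by (simp add: mult.commute abs_minus_commute)
  qed
qed

lemma rker_correlation_right:
  assumes "1/2 < \<sigma>" "\<sigma> < 1" "t \<noteq> r"
  shows "(\<integral>\<^sup>+x. ennreal (rker \<sigma> (t - x) * rker \<sigma> (r - x)) \<partial>lborel) = ennreal (same_const \<sigma> * \<bar>t - r\<bar> powr (1 - 2 * \<sigma>))"
proof -
  have "(\<integral>\<^sup>+x. ennreal (rker \<sigma> (t - x) * rker \<sigma> (r - x)) \<partial>lborel) =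
    (\<integral>\<^sup>+x. ennreal (rker \<sigma> (x - (- t)) * rker \<sigma> (x - (- r))) \<partial>lborel)"
    using nn_integral_real_affine[of "\<lambda>x. ennreal (rker \<sigma> (t - x) * rker \<sigma> (r - x))" "-1" 0] by (simp add: add.commute)
  also have "\<dots> = ennreal (same_const \<sigma> * \<bar>(- t) - (- r)\<bar> powr (1 - 2 * \<sigma>))"
    using assms by (intro rker_correlation_left) auto
  also have "\<bar>(- t) - (- r)\<bar> = \<bar>t - r\<bar>" by simp
  finally show ?thesis .
qed

text \<open>The two kernels overlap only for t < x < r. Hence the correlation lives on a half plane,
  unlike the one-sided correlations, and by homogeneity it has the same power of the distance
  there.\<close>

lemma rker_correlation_mixed:
  assumes "0 \<le> \<sigma>" "\<sigma> < 1" "t \<noteq> r"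
  shows "(\<integral>\<^sup>+x. ennreal (rker \<sigma> (x - t) * rker \<sigma> (r - x)) \<partial>lborel) =
    ennreal (mixed_const \<sigma> * (if t < r then \<bar>t - r\<bar> powr (1 - 2 * \<sigma>) else 0))"
proof (cases "t < r")
  case False
  then have "rker \<sigma> (x - t) * rker \<sigma> (r - x) = 0" for x by (simp add: rker_def)
  then have "(\<integral>\<^sup>+x. ennreal (rker \<sigma> (x - t) * rker \<sigma> (r - x)) \<partial>lborel) = 0"
    by (simp only: ennreal_0 nn_integral_const) simp
  then show ?thesis using False by simp
next
  case True
  define d where "d = r - t"
  have d: "0 < d" using True by (simp add: d_def)
  have "(\<integral>\<^sup>+x. ennreal (rker \<sigma> (x - t) * rker \<sigma> (r - x)) \<partial>lborel) =
     ennreal \<bar>d\<bar> * (\<integral>\<^sup>+z. ennreal (rker \<sigma> (t + d * z - t) * rker \<sigma> (r - (t + d * z))) \<partial>lborel)"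
    using d by (intro nn_integral_real_affine) auto
  also have "(\<lambda>z. ennreal (rker \<sigma> (t + d * z - t) * rker \<sigma> (r - (t + d * z)))) =
     (\<lambda>z. ennreal (d powr (- 2 * \<sigma>)) * ennreal (rker \<sigma> z * rker \<sigma> (1 - z)))"
  proof
    fix z
    have "t + d * z - t = d * z" "r - (t + d * z) = d * (1 - z)" by (simp_all add: d_def algebra_simps)
    then show "ennreal (rker \<sigma> (t + d * z - t) * rker \<sigma> (r - (t + d * z))) = ennreal (d powr (- 2 * \<sigma>)) * ennreal (rker \<sigma> z * rker \<sigma> (1 - z))"
      by (simp only: rker_scale_mult[OF d])
  qed
  also have "ennreal \<bar>d\<bar> * (\<integral>\<^sup>+z. ennreal (d powr (- 2 * \<sigma>)) * ennreal (rker \<sigma> z * rker \<sigma> (1 - z)) \<partial>lborel) =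
     ennreal d * (ennreal (d powr (- 2 * \<sigma>)) * ennreal (mixed_const \<sigma>))"
    using d mixed_const(1)[OF assms(1,2)] by (simp add: nn_integral_cmult)
  also have "\<dots> = ennreal (d * (d powr (- 2 * \<sigma>) * mixed_const \<sigma>))"
    using d by (simp add: ennreal_mult'' ennreal_mult' mixed_const_def)
  also have "d * (d powr (- 2 * \<sigma>) * mixed_const \<sigma>) = mixed_const \<sigma> * (d powr 1 * d powr (- 2 * \<sigma>))"
    using d by simp
  also have "d powr 1 * d powr (- 2 * \<sigma>) = \<bar>t - r\<bar> powr (1 - 2 * \<sigma>)"
    unfolding powr_add[symmetric] using True by (simp add: d_def)
  finally show ?thesis using True by simp
qed

section \<open>Double integrals over the plane\<close>

lemma borel_measurable_fst_snd_real [measurable (raw)]: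
  fixes f :: "'a \<Rightarrow> real \<times> real"
  assumes "f \<in> borel_measurable M"
  shows "(\<lambda>x. fst (f x)) \<in> borel_measurable M" "(\<lambda>x. snd (f x)) \<in> borel_measurable M"
  using assms borel_measurable_continuous_onI[OF continuous_on_fst[OF continuous_on_id]]
    borel_measurable_continuous_onI[OF continuous_on_snd[OF continuous_on_id]]
  by (auto intro: measurable_compose)

text \<open>The correlation formulas are stated off the diagonal; this discards the diagonal in all
  double integrals.\<close>

lemma AE_lborel_fst_neq_snd: "AE z in (lborel :: (real \<times> real) measure). fst z \<noteq> snd z"
proof -
  have "AE z in lborel \<Otimes>\<^sub>M (lborel :: real measure). fst z \<noteq> (snd z :: real)"
  proof (rule lborel_pair.AE_pair_measure)
    show "AE x in lborel. AE y in lborel. fst (x, y) \<noteq> (snd (x, y) :: real)"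
    proof (rule AE_I2)
      fix x :: real
      show "AE y in lborel. fst (x, y) \<noteq> (snd (x, y) :: real)"
        using AE_lborel_singleton[of x] by eventually_elim simp
    qed
  qed measurable
  then show ?thesis unfolding lborel_prod .
qed

text \<open>Double integrals are taken over a single variable of pair type, so that the whole pair
  can be one of the two variables in a further application of Fubini.\<close>

lemma LINT_pair_mult:
  fixes f g :: "real \<Rightarrow> complex"
  assumes f: "integrable lborel f" and g: "integrable lborel g"
  shows "(LINT z|lborel. f (fst z) * g (snd z)) = (LINT t|lborel. f t) * (LINT r|lborel. g r)"
    and "integrable lborel (\<lambda>z. f (fst z) * g (snd z))"
proof -
  note [measurable] = borel_measurable_integrable[OF f] borel_measurable_integrable[OF g]
  have "integrable (lborel \<Otimes>\<^sub>M lborel) (case_prod (\<lambda>t r. f t * g r))"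
    by (rule integrable_dominated_pair[OF _ integrable_norm[OF f] integrable_norm[OF g]])
      (measurable, simp add: norm_mult)
  then have int: "integrable (lborel \<Otimes>\<^sub>M lborel) (\<lambda>z. f (fst z) * g (snd z))"
    by (simp add: case_prod_beta')
  then show "integrable lborel (\<lambda>z. f (fst z) * g (snd z))" unfolding lborel_prod .
  have "(LINT t|lborel. LINT r|lborel. f (fst (t, r)) * g (snd (t, r))) = (LINT z|(lborel \<Otimes>\<^sub>M lborel). f (fst z) * g (snd z))"
    by (rule lborel_pair.integral_fst'[OF int])
  moreover have "(LINT t|lborel. LINT r|lborel. f (fst (t, r)) * g (snd (t, r))) = (LINT t|lborel. f t) * (LINT r|lborel. g r)"
    unfolding fst_conv snd_conv integral_mult_right_zero integral_mult_left_zero ..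
  ultimately show "(LINT z|lborel. f (fst z) * g (snd z)) = (LINT t|lborel. f t) * (LINT r|lborel. g r)"
    unfolding lborel_prod by simp
qed

lemma LINT_pair_mult_real:
  fixes f g :: "real \<Rightarrow> real"
  assumes f: "integrable lborel f" and g: "integrable lborel g"
  shows "(LINT z|lborel. f (fst z) * g (snd z)) = (LINT t|lborel. f t) * (LINT r|lborel. g r)"
    and "integrable lborel (\<lambda>z. f (fst z) * g (snd z))"
proof -
  note * = LINT_pair_mult[OF integrable_of_real[OF f] integrable_of_real[OF g], unfolded of_real_mult[symmetric] integral_complex_of_real]
  show "(LINT z|lborel. f (fst z) * g (snd z)) = (LINT t|lborel. f t) * (LINT r|lborel. g r)"
    using *(1) unfolding of_real_eq_iff .
  show "integrable lborel (\<lambda>z. f (fst z) * g (snd z))"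
    using integrable_Re[OF *(2)] by simp
qed

text \<open>The kernel calculus uses boundedness and support only. It is applied to derivatives of
  test functions for the energy identities, and to test functions themselves for convolutions and
  symmetry of the transform.\<close>

locale bounded_on_Omega =
  fixes h :: "real \<Rightarrow> real" and M :: real
  assumes h_measurable [measurable]: "h \<in> borel_measurable borel"
    and h_bound: "\<bar>h x\<bar> \<le> M"
    and h_zero: "x \<notin> Omega \<Longrightarrow> h x = 0"
begin

lemma M_nonneg: "0 \<le> M"
  using h_bound[of 0] by linarith

lemma h_integrable: "integrable lborel h"
  by (rule integrable_bounded_Omega[OF h_measurable h_bound h_zero])

lemma rker_shift_integral:
  assumes "\<beta> < 1"
  shows "(\<integral>\<^sup>+r. ennreal (rker \<beta> (r - t)) * indicator {..1} (r - t) \<partial>lborel) = ennreal (1 / (1 - \<beta>))"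
    and "(\<integral>\<^sup>+r. ennreal (rker \<beta> (t - r)) * indicator {..1} (t - r) \<partial>lborel) = ennreal (1 / (1 - \<beta>))"
  using nn_integral_rker_unit[OF assms]
    nn_integral_real_affine[of "\<lambda>z. ennreal (rker \<beta> z) * indicator {..1} z" 1 "-t"]
    nn_integral_real_affine[of "\<lambda>z. ennreal (rker \<beta> z) * indicator {..1} z" "-1" t]
  by (simp_all add: add.commute)

text \<open>Points of the support are at distance at most 1, so only the part of the kernel on (0,1]
  is seen. For fixed t its integral over r is bounded by 1 / (1 - \<beta>) on either side of
  t.\<close>

lemma Riesz_finite:
  assumes "\<beta> < 1"
  shows "(\<integral>\<^sup>+z. ennreal (\<bar>h (fst z)\<bar> * \<bar>h (snd z)\<bar> * \<bar>fst z - snd z\<bar> powr (- \<beta>)) \<partial>lborel) < \<infinity>"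
proof -
  let ?K = "\<lambda>z :: real. ennreal (rker \<beta> z) * indicator {..1} z"
  have le: "ennreal (\<bar>h t\<bar> * \<bar>h r\<bar> * \<bar>t - r\<bar> powr (- \<beta>)) \<le> ennreal (M * M) * indicator Omega t * (?K (r - t) + ?K (t - r))" for t r
  proof (cases "t \<in> Omega \<and> r \<in> Omega \<and> t \<noteq> r")
    case True
    have "\<bar>t - r\<bar> powr (- \<beta>) = (if t < r then rker \<beta> (r - t) else rker \<beta> (t - r))"
      using True by (simp add: rker_def)
    moreover have "r - t \<le> 1" "t - r \<le> 1" using True by (auto simp: Omega_def)
    moreover have "rker \<beta> (r - t) = 0" if "\<not> t < r" using that by (simp add: rker_def)
    moreover have "rker \<beta> (t - r) = 0" if "t < r" using that by (simp add: rker_def)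
    ultimately have eq: "?K (r - t) + ?K (t - r) = ennreal (\<bar>t - r\<bar> powr (- \<beta>))" by (cases "t < r") auto
    have "\<bar>h t\<bar> * \<bar>h r\<bar> * \<bar>t - r\<bar> powr (- \<beta>) \<le> M * M * \<bar>t - r\<bar> powr (- \<beta>)"
      by (intro mult_right_mono mult_mono h_bound) (auto simp: M_nonneg)
    then have "ennreal (\<bar>h t\<bar> * \<bar>h r\<bar> * \<bar>t - r\<bar> powr (- \<beta>)) \<le> ennreal (M * M) * ennreal (\<bar>t - r\<bar> powr (- \<beta>))"
      by (subst ennreal_mult[symmetric]) (auto simp: M_nonneg intro!: ennreal_leI)
    then show ?thesis unfolding eq using True by simp
  next
    case False
    then have "\<bar>h t\<bar> * \<bar>h r\<bar> * \<bar>t - r\<bar> powr (- \<beta>) = 0" using h_zero[of t] h_zero[of r] by auto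
    then show ?thesis by (simp only: ennreal_0 zero_le)
  qed
  have "(\<integral>\<^sup>+z. ennreal (\<bar>h (fst z)\<bar> * \<bar>h (snd z)\<bar> * \<bar>fst z - snd z\<bar> powr (- \<beta>)) \<partial>lborel) =
     (\<integral>\<^sup>+t. \<integral>\<^sup>+r. ennreal (\<bar>h t\<bar> * \<bar>h r\<bar> * \<bar>t - r\<bar> powr (- \<beta>)) \<partial>lborel \<partial>lborel)"
  proof -
    have "(\<lambda>z. ennreal (\<bar>h (fst z)\<bar> * \<bar>h (snd z)\<bar> * \<bar>fst z - snd z\<bar> powr (- \<beta>))) \<in> borel_measurable (lborel \<Otimes>\<^sub>M lborel)"
      by measurable
    from lborel.nn_integral_fst[OF this, symmetric] show ?thesis unfolding lborel_prod fst_conv snd_conv .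
  qed
  also have "\<dots> \<le> (\<integral>\<^sup>+t. \<integral>\<^sup>+r. ennreal (M * M) * indicator Omega t * (?K (r - t) + ?K (t - r)) \<partial>lborel \<partial>lborel)"
    by (intro nn_integral_mono le)
  also have "\<dots> = (\<integral>\<^sup>+t. ennreal (M * M) * indicator Omega t * (ennreal (1 / (1 - \<beta>)) + ennreal (1 / (1 - \<beta>))) \<partial>lborel)"
    using rker_shift_integral[OF assms] by (simp add: nn_integral_cmult nn_integral_add)
  also have "\<dots> = ennreal (M * M) * (ennreal (1 / (1 - \<beta>)) + ennreal (1 / (1 - \<beta>)))"
    by (simp add: mult.assoc nn_integral_cmult nn_integral_multc) (simp add: Omega_def)
  also have "\<dots> < \<infinity>"
    by (simp add: ennreal_add_eq_top ennreal_mult_eq_top_iff less_top[symmetric])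
  finally show ?thesis .
qed

text \<open>The common pattern behind all quadratic identities: a nonnegative kernel depending on a
  pair is averaged over a parameter x, and the average is known off the diagonal. Since it is
  controlled by a Riesz kernel, \<open>Riesz_finite\<close> gives absolute integrability. The
  parameter is the space variable for the one-sided kernels and the inverse width for the
  Gaussians.\<close>

lemma kernel_Fubini:
  fixes \<Phi> :: "real \<Rightarrow> real \<times> real \<Rightarrow> real" and G :: "real \<times> real \<Rightarrow> real"
  assumes \<beta>: "\<beta> < 1"
    and \<Phi> [measurable]: "case_prod \<Phi> \<in> borel_measurable (lborel \<Otimes>\<^sub>M lborel)"
    and \<Phi>_nonneg: "\<And>x z. 0 \<le> \<Phi> x z"
    and G [measurable]: "G \<in> borel_measurable borel"
    and corr: "\<And>z. fst z \<noteq> snd z \<Longrightarrow> (\<integral>\<^sup>+x. ennreal (\<Phi> x z) \<partial>lborel) = ennreal (G z)"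
    and G_bounds: "\<And>z. 0 \<le> G z" "\<And>z. G z \<le> c * \<bar>fst z - snd z\<bar> powr (- \<beta>)"
  shows "integrable lborel (\<lambda>x. LINT z|lborel. h (fst z) * h (snd z) * \<Phi> x z)"
    and "(LINT x|lborel. LINT z|lborel. h (fst z) * h (snd z) * \<Phi> x z) = (LINT z|lborel. h (fst z) * h (snd z) * G z)"
proof -
  define F where "F x z = h (fst z) * h (snd z) * \<Phi> x z" for x z
  have \<Phi>_sec [measurable]: "(\<lambda>x. \<Phi> x z) \<in> borel_measurable lborel" for z
    using measurable_Pair1[OF \<Phi>, of z] by simp
  have F [measurable]: "case_prod F \<in> borel_measurable (lborel \<Otimes>\<^sub>M lborel)"
  proof -
    have "(\<lambda>p. h (fst (snd p)) * h (snd (snd p)) * case_prod \<Phi> p) \<in> borel_measurable (lborel \<Otimes>\<^sub>M lborel)"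
      by (rule borel_measurable_times[OF _ \<Phi>]) measurable
    then show ?thesis by (simp only: F_def[abs_def] case_prod_beta')
  qed
  have "(\<integral>\<^sup>+p. ennreal (norm (case_prod F p)) \<partial>(lborel \<Otimes>\<^sub>M lborel)) = (\<integral>\<^sup>+z. \<integral>\<^sup>+x. ennreal (norm (F x z)) \<partial>lborel \<partial>lborel)"
    using lborel_pair.nn_integral_snd[of "\<lambda>p. ennreal (norm (case_prod F p))", symmetric] F
    by (simp only: case_prod_conv) measurable
  also have "\<dots> \<le> (\<integral>\<^sup>+z. ennreal \<bar>c\<bar> * ennreal (\<bar>h (fst z)\<bar> * \<bar>h (snd z)\<bar> * \<bar>fst z - snd z\<bar> powr (- \<beta>)) \<partial>lborel)"
  proof (rule nn_integral_mono_AE, use AE_lborel_fst_neq_snd in eventually_elim)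
    fix z :: "real \<times> real" assume z: "fst z \<noteq> snd z"
    let ?a = "\<bar>h (fst z)\<bar> * \<bar>h (snd z)\<bar>"
    have "(\<integral>\<^sup>+x. ennreal (norm (F x z)) \<partial>lborel) = (\<integral>\<^sup>+x. ennreal ?a * ennreal (\<Phi> x z) \<partial>lborel)"
      by (intro nn_integral_cong) (simp add: F_def abs_mult \<Phi>_nonneg ennreal_mult')
    also have "\<dots> = ennreal ?a * ennreal (G z)" using corr[OF z] by (simp add: nn_integral_cmult)
    also have "\<dots> = ennreal (?a * G z)" by (simp add: ennreal_mult' G_bounds)
    also have "\<dots> \<le> ennreal (\<bar>c\<bar> * (?a * \<bar>fst z - snd z\<bar> powr (- \<beta>)))"
    proof (rule ennreal_leI)
      have "G z \<le> \<bar>c\<bar> * \<bar>fst z - snd z\<bar> powr (- \<beta>)"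
        using G_bounds(2)[of z] mult_right_mono[OF abs_ge_self[of c], of "\<bar>fst z - snd z\<bar> powr (- \<beta>)"] by simp
      then have "?a * G z \<le> ?a * (\<bar>c\<bar> * \<bar>fst z - snd z\<bar> powr (- \<beta>))" by (intro mult_left_mono) auto
      then show "?a * G z \<le> \<bar>c\<bar> * (?a * \<bar>fst z - snd z\<bar> powr (- \<beta>))" by (simp only: mult_ac)
    qed
    also have "\<dots> = ennreal \<bar>c\<bar> * ennreal (?a * \<bar>fst z - snd z\<bar> powr (- \<beta>))" by (rule ennreal_mult) auto
    finally show "(\<integral>\<^sup>+x. ennreal (norm (F x z)) \<partial>lborel) \<le> ennreal \<bar>c\<bar> * ennreal (?a * \<bar>fst z - snd z\<bar> powr (- \<beta>))" .
  qed
  also have "\<dots> < \<infinity>"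
    using Riesz_finite[OF \<beta>] by (subst nn_integral_cmult) (simp_all add: ennreal_mult_less_top)
  finally have int: "integrable (lborel \<Otimes>\<^sub>M lborel) (case_prod F)"
    by (intro integrableI_bounded F)
  show "integrable lborel (\<lambda>x. LINT z|lborel. h (fst z) * h (snd z) * \<Phi> x z)"
    using lborel_pair.integrable_fst[OF int] unfolding F_def .
  have "(LINT x|lborel. LINT z|lborel. F x z) = (LINT z|lborel. LINT x|lborel. F x z)"
    by (rule lborel_pair.Fubini_integral[OF int, symmetric])
  also have "\<dots> = (LINT z|lborel. h (fst z) * h (snd z) * G z)"
  proof (rule integral_cong_AE)
    show "(\<lambda>z. LINT x|lborel. F x z) \<in> borel_measurable lborel"
      using lborel_pair.integrable_snd[OF int] by (rule borel_measurable_integrable)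
    show "AE z in lborel. (LINT x|lborel. F x z) = h (fst z) * h (snd z) * G z"
      using AE_lborel_fst_neq_snd
    proof eventually_elim
      fix z :: "real \<times> real" assume z: "fst z \<noteq> snd z"
      have "(LINT x|lborel. \<Phi> x z) = enn2real (\<integral>\<^sup>+x. ennreal (\<Phi> x z) \<partial>lborel)"
        by (rule integral_eq_nn_integral) (simp_all add: \<Phi>_nonneg)
      then have "(LINT x|lborel. \<Phi> x z) = G z" unfolding corr[OF z] by (simp add: G_bounds)
      then show "(LINT x|lborel. F x z) = h (fst z) * h (snd z) * G z"
        unfolding F_def integral_mult_right_zero by simp
    qed
  qed measurable
  finally show "(LINT x|lborel. LINT z|lborel. h (fst z) * h (snd z) * \<Phi> x z) = (LINT z|lborel. h (fst z) * h (snd z) * G z)"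
    unfolding F_def .
qed

lemma rker_mult_integrable:
  assumes \<sigma>: "0 \<le> \<sigma>" "\<sigma> < 1"
  shows "integrable lborel (\<lambda>t. rker \<sigma> (x - t) * h t)" "integrable lborel (\<lambda>t. rker \<sigma> (t - x) * h t)"
proof -
  have dom: "\<bar>rker \<sigma> a * h t\<bar> \<le> M * (rker \<sigma> a * indicator {..1} a) + \<bar>h t\<bar>" for a t
  proof (cases "a \<le> 1")
    case True
    have "rker \<sigma> a * \<bar>h t\<bar> \<le> rker \<sigma> a * M" by (intro mult_left_mono h_bound rker_nonneg)
    then show ?thesis using True by (simp add: abs_mult rker_nonneg mult.commute add_increasing2)
  next
    case False
    have "rker \<sigma> a * \<bar>h t\<bar> \<le> 1 * \<bar>h t\<bar>" using False \<sigma> by (intro mult_right_mono rker_le_1) auto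
    then show ?thesis using False by (simp add: abs_mult rker_nonneg)
  qed
  have base: "integrable lborel (\<lambda>z. rker \<sigma> z * indicator {..1} z)"
  proof (rule integrableI_bounded)
    have "(\<integral>\<^sup>+z. ennreal (norm (rker \<sigma> z * indicator {..1} z)) \<partial>lborel) = (\<integral>\<^sup>+z. ennreal (rker \<sigma> z) * indicator {..1} z \<partial>lborel)"
      by (intro nn_integral_cong) (simp add: indicator_def rker_nonneg)
    then show "(\<integral>\<^sup>+z. ennreal (norm (rker \<sigma> z * indicator {..1} z)) \<partial>lborel) < \<infinity>"
      unfolding nn_integral_rker_unit[OF \<sigma>(2)] by simp
  qed measurable
  have "integrable lborel (\<lambda>t. M * (rker \<sigma> (x - t) * indicator {..1} (x - t)) + \<bar>h t\<bar>)"
    using lborel_integrable_real_affine[OF base, of "-1" x] h_integrable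
    by (intro Bochner_Integration.integrable_add integrable_mult_right integrable_abs) simp_all
  then show "integrable lborel (\<lambda>t. rker \<sigma> (x - t) * h t)"
  proof (rule Bochner_Integration.integrable_bound)
    show "AE t in lborel. norm (rker \<sigma> (x - t) * h t) \<le> norm (M * (rker \<sigma> (x - t) * indicator {..1} (x - t)) + \<bar>h t\<bar>)"
      unfolding real_norm_def by (intro AE_I2 order_trans[OF dom abs_ge_self])
  qed measurable
  have "integrable lborel (\<lambda>t. M * (rker \<sigma> (t - x) * indicator {..1} (t - x)) + \<bar>h t\<bar>)"
    using lborel_integrable_real_affine[OF base, of 1 "-x"] h_integrable
    by (intro Bochner_Integration.integrable_add integrable_mult_right integrable_abs) (simp_all add: add.commute)
  then show "integrable lborel (\<lambda>t. rker \<sigma> (t - x) * h t)"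
  proof (rule Bochner_Integration.integrable_bound)
    show "AE t in lborel. norm (rker \<sigma> (t - x) * h t) \<le> norm (M * (rker \<sigma> (t - x) * indicator {..1} (t - x)) + \<bar>h t\<bar>)"
      unfolding real_norm_def by (intro AE_I2 order_trans[OF dom abs_ge_self])
  qed measurable
qed

text \<open>Unnormalised one-sided fractional integrals of order 1 - \<sigma>. With h the derivative
  of a test function they are the fractional derivatives up to the Gamma factor, and for the right
  one the sign.\<close>

definition Jl :: "real \<Rightarrow> real \<Rightarrow> real" where
  "Jl \<sigma> x = (LINT t|lborel. rker \<sigma> (x - t) * h t)"

definition Jr :: "real \<Rightarrow> real \<Rightarrow> real" where
  "Jr \<sigma> x = (LINT t|lborel. rker \<sigma> (t - x) * h t)"

text \<open>The Riesz energy of h over the full plane, in terms of which both squares and the mixed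
  product are expressed.\<close>

definition Q :: "real \<Rightarrow> real" where
  "Q \<beta> = (LINT z|lborel. h (fst z) * h (snd z) * \<bar>fst z - snd z\<bar> powr (- \<beta>))"

lemma J_measurable [measurable]: "Jl \<sigma> \<in> borel_measurable borel" "Jr \<sigma> \<in> borel_measurable borel"
  unfolding Jl_def[abs_def] Jr_def[abs_def] by measurable

lemma J_products:
  assumes \<sigma>: "0 \<le> \<sigma>" "\<sigma> < 1"
  shows "(LINT z|lborel. h (fst z) * h (snd z) * (rker \<sigma> (x - fst z) * rker \<sigma> (x - snd z))) = (Jl \<sigma> x)\<^sup>2"
    and "(LINT z|lborel. h (fst z) * h (snd z) * (rker \<sigma> (fst z - x) * rker \<sigma> (snd z - x))) = (Jr \<sigma> x)\<^sup>2"
    and "(LINT z|lborel. h (fst z) * h (snd z) * (rker \<sigma> (x - fst z) * rker \<sigma> (snd z - x))) = Jl \<sigma> x * Jr \<sigma> x"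
  using LINT_pair_mult_real(1)[OF rker_mult_integrable(1)[OF \<sigma>, of x] rker_mult_integrable(1)[OF \<sigma>, of x]]
    LINT_pair_mult_real(1)[OF rker_mult_integrable(2)[OF \<sigma>, of x] rker_mult_integrable(2)[OF \<sigma>, of x]]
    LINT_pair_mult_real(1)[OF rker_mult_integrable(1)[OF \<sigma>, of x] rker_mult_integrable(2)[OF \<sigma>, of x]]
  unfolding Jl_def Jr_def power2_eq_square by (simp_all only: mult_ac)

text \<open>Each square is a double integral in which x occurs only in the kernels, so x can be
  integrated out by the correlation formula. Left and right give the same value because the
  correlation depends on the distance alone.\<close>

lemma
  assumes \<sigma>: "1/2 < \<sigma>" "\<sigma> < 1"
  shows Jl_square_integrable: "integrable lborel (\<lambda>x. (Jl \<sigma> x)\<^sup>2)"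
    and Jl_square: "(LINT x|lborel. (Jl \<sigma> x)\<^sup>2) = same_const \<sigma> * Q (2 * \<sigma> - 1)"
    and Jr_square_integrable: "integrable lborel (\<lambda>x. (Jr \<sigma> x)\<^sup>2)"
    and Jr_square: "(LINT x|lborel. (Jr \<sigma> x)\<^sup>2) = same_const \<sigma> * Q (2 * \<sigma> - 1)"
proof -
  have \<sigma>': "0 \<le> \<sigma>" "\<sigma> < 1" "2 * \<sigma> - 1 < 1" using \<sigma> by auto
  have nn: "0 \<le> same_const \<sigma>" by (simp add: same_const_def)
  let ?G = "\<lambda>z :: real \<times> real. same_const \<sigma> * \<bar>fst z - snd z\<bar> powr (- (2 * \<sigma> - 1))"
  have QG: "(LINT z|lborel. h (fst z) * h (snd z) * ?G z) = same_const \<sigma> * Q (2 * \<sigma> - 1)"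
    unfolding Q_def integral_mult_right_zero[symmetric] by (simp only: mult_ac)
  have G: "?G \<in> borel_measurable borel" by measurable
  have G0: "0 \<le> ?G z" for z using nn by simp
  have L: "integrable lborel (\<lambda>x. LINT z|lborel. h (fst z) * h (snd z) * (rker \<sigma> (x - fst z) * rker \<sigma> (x - snd z)))"
    "(LINT x|lborel. LINT z|lborel. h (fst z) * h (snd z) * (rker \<sigma> (x - fst z) * rker \<sigma> (x - snd z))) = (LINT z|lborel. h (fst z) * h (snd z) * ?G z)"
  proof -
    have m: "case_prod (\<lambda>x z. rker \<sigma> (x - fst z) * rker \<sigma> (x - snd z)) \<in> borel_measurable (lborel \<Otimes>\<^sub>M lborel)"
      by measurable
    have c: "(\<integral>\<^sup>+x. ennreal (rker \<sigma> (x - fst z) * rker \<sigma> (x - snd z)) \<partial>lborel) = ennreal (?G z)" if "fst z \<noteq> snd z" for z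
      using rker_correlation_left[OF \<sigma> that] by simp
    have p: "0 \<le> rker \<sigma> (x - fst z) * rker \<sigma> (x - snd z)" for x and z :: "real \<times> real" by (simp add: rker_nonneg)
    show "integrable lborel (\<lambda>x. LINT z|lborel. h (fst z) * h (snd z) * (rker \<sigma> (x - fst z) * rker \<sigma> (x - snd z)))"
      "(LINT x|lborel. LINT z|lborel. h (fst z) * h (snd z) * (rker \<sigma> (x - fst z) * rker \<sigma> (x - snd z))) = (LINT z|lborel. h (fst z) * h (snd z) * ?G z)"
      by (rule kernel_Fubini[OF \<sigma>'(3) m p G c G0 order_refl], assumption)+
  qed
  have R: "integrable lborel (\<lambda>x. LINT z|lborel. h (fst z) * h (snd z) * (rker \<sigma> (fst z - x) * rker \<sigma> (snd z - x)))"
    "(LINT x|lborel. LINT z|lborel. h (fst z) * h (snd z) * (rker \<sigma> (fst z - x) * rker \<sigma> (snd z - x))) = (LINT z|lborel. h (fst z) * h (snd z) * ?G z)"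
  proof -
    have m: "case_prod (\<lambda>x z. rker \<sigma> (fst z - x) * rker \<sigma> (snd z - x)) \<in> borel_measurable (lborel \<Otimes>\<^sub>M lborel)"
      by measurable
    have c: "(\<integral>\<^sup>+x. ennreal (rker \<sigma> (fst z - x) * rker \<sigma> (snd z - x)) \<partial>lborel) = ennreal (?G z)" if "fst z \<noteq> snd z" for z
      using rker_correlation_right[OF \<sigma> that] by simp
    have p: "0 \<le> rker \<sigma> (fst z - x) * rker \<sigma> (snd z - x)" for x and z :: "real \<times> real" by (simp add: rker_nonneg)
    show "integrable lborel (\<lambda>x. LINT z|lborel. h (fst z) * h (snd z) * (rker \<sigma> (fst z - x) * rker \<sigma> (snd z - x)))"
      "(LINT x|lborel. LINT z|lborel. h (fst z) * h (snd z) * (rker \<sigma> (fst z - x) * rker \<sigma> (snd z - x))) = (LINT z|lborel. h (fst z) * h (snd z) * ?G z)"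
      by (rule kernel_Fubini[OF \<sigma>'(3) m p G c G0 order_refl], assumption)+
  qed
  note J = J_products[OF \<sigma>'(1,2)]
  show "integrable lborel (\<lambda>x. (Jl \<sigma> x)\<^sup>2)" "(LINT x|lborel. (Jl \<sigma> x)\<^sup>2) = same_const \<sigma> * Q (2 * \<sigma> - 1)"
    using L unfolding J QG .
  show "integrable lborel (\<lambda>x. (Jr \<sigma> x)\<^sup>2)" "(LINT x|lborel. (Jr \<sigma> x)\<^sup>2) = same_const \<sigma> * Q (2 * \<sigma> - 1)"
    using R unfolding J QG .
qed

lemma Riesz_integrable:
  assumes "\<beta> < 1"
  shows "integrable lborel (\<lambda>z. h (fst z) * h (snd z) * \<bar>fst z - snd z\<bar> powr (- \<beta>))"
  by (rule integrableI_bounded) (use Riesz_finite[OF assms] in \<open>simp_all add: abs_mult\<close>)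

text \<open>The correlation lives on the half plane fst < snd. Exchanging the two variables maps it
  to the other half plane and preserves the integrand, so it carries exactly half of the Riesz
  energy; this is the origin of the factor 1/2 and of positivity of the mixed form.\<close>

lemma Jl_Jr:
  assumes \<sigma>: "1/2 < \<sigma>" "\<sigma> < 1"
  shows "(LINT x|lborel. Jl \<sigma> x * Jr \<sigma> x) = mixed_const \<sigma> * Q (2 * \<sigma> - 1) / 2"
proof -
  have \<sigma>': "0 \<le> \<sigma>" "\<sigma> < 1" "2 * \<sigma> - 1 < 1" using \<sigma> by auto
  have nn: "0 \<le> mixed_const \<sigma>" by (simp add: mixed_const_def)
  define W where "W z = \<bar>fst z - snd z\<bar> powr (1 - 2 * \<sigma>)" for z :: "real \<times> real"
  define U where "U z = h (fst z) * h (snd z) * (if fst z < snd z then W z else 0)" for z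
  let ?G = "\<lambda>z :: real \<times> real. mixed_const \<sigma> * (if fst z < snd z then W z else 0)"
  have [measurable]: "W \<in> borel_measurable borel" unfolding W_def by measurable
  have U [measurable]: "U \<in> borel_measurable borel" unfolding U_def by measurable
  have "(LINT x|lborel. LINT z|lborel. h (fst z) * h (snd z) * (rker \<sigma> (x - fst z) * rker \<sigma> (snd z - x))) = (LINT z|lborel. h (fst z) * h (snd z) * ?G z)"
  proof (rule kernel_Fubini(2)[OF \<sigma>'(3), where c="mixed_const \<sigma>"])
    fix z :: "real \<times> real"
    show "?G z \<le> mixed_const \<sigma> * \<bar>fst z - snd z\<bar> powr - (2 * \<sigma> - 1)"
      using nn by (simp add: W_def)
    show "0 \<le> ?G z" using nn by (simp add: W_def)
    show "0 \<le> rker \<sigma> (x - fst z) * rker \<sigma> (snd z - x)" for x by (simp add: rker_nonneg)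
    show "(\<integral>\<^sup>+x. ennreal (rker \<sigma> (x - fst z) * rker \<sigma> (snd z - x)) \<partial>lborel) = ennreal (?G z)" if "fst z \<noteq> snd z"
      using rker_correlation_mixed[OF \<sigma>'(1,2) that] unfolding W_def .
  qed measurable
  then have "(LINT x|lborel. Jl \<sigma> x * Jr \<sigma> x) = mixed_const \<sigma> * (LINT z|lborel. U z)"
    unfolding J_products[OF \<sigma>'(1,2)] U_def integral_mult_right_zero[symmetric] by (simp only: mult_ac)
  moreover have "Q (2 * \<sigma> - 1) = 2 * (LINT z|lborel. U z)"
  proof -
    have intW: "integrable lborel (\<lambda>z. h (fst z) * h (snd z) * W z)"
      using Riesz_integrable[OF \<sigma>'(3)] by (simp add: W_def)
    have intU: "integrable lborel U"
    proof (rule Bochner_Integration.integrable_bound[OF intW])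
      show "AE z in lborel. norm (U z) \<le> norm (h (fst z) * h (snd z) * W z)" by (intro AE_I2) (simp add: U_def)
    qed measurable
    have swap: "(LINT z|lborel. U (snd z, fst z)) = (LINT z|lborel. U z)"
      using lborel_pair.integral_product_swap[of U] U unfolding lborel_prod by (simp add: case_prod_beta')
    have intU': "integrable lborel (\<lambda>z. U (snd z, fst z))"
      using lborel_pair.integrable_product_swap[of U] intU unfolding lborel_prod by (simp add: case_prod_beta')
    \<comment> \<open>The identity also holds on the diagonal, where \<open>0 powr _\<close> is 0
      and both halves vanish.\<close>
    have "h (fst z) * h (snd z) * \<bar>fst z - snd z\<bar> powr (- (2 * \<sigma> - 1)) = U z + U (snd z, fst z)" for z
      by (cases "fst z" "snd z" rule: linorder_cases) (simp_all add: U_def W_def abs_minus_commute mult.commute)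
    then have "Q (2 * \<sigma> - 1) = (LINT z|lborel. U z + U (snd z, fst z))"
      unfolding Q_def by (simp only:)
    then show ?thesis using intU intU' swap by simp
  qed
  ultimately show ?thesis by simp
qed

end

section \<open>Riesz forms in Fourier space\<close>

text \<open>Equals 2^(\<beta>/2 - 1) Gamma(\<beta>/2), the Mellin transform of a Gaussian; it
  normalises the superposition of Gaussians that yields the Riesz kernel.\<close>

definition gauss_const :: "real \<Rightarrow> real" where
  "gauss_const \<beta> = enn2real (\<integral>\<^sup>+\<rho>. ennreal (rker (1 - \<beta>) \<rho> * exp (- \<rho>\<^sup>2 / 2)) \<partial>lborel)"

text \<open>The absolute moment of order -\<beta> of a standard normal variable.\<close>

definition moment_const :: "real \<Rightarrow> real" where
  "moment_const \<beta> = enn2real (\<integral>\<^sup>+y. ennreal (std_normal_density y * \<bar>y\<bar> powr (- \<beta>)) \<partial>lborel)"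

text \<open>On (0,1] the Gaussian factor lies between exp(-1/2) and 1 and the power integrates to 1
  / \<beta>. Beyond 1 the power is at most 1, and sqrt(2 pi) \<le> 3 bounds the tail by 3. Since
  \<beta> < 1 the sum is at most 4 / \<beta>. Its reciprocal supplies the factor s - 1 of the
  coercivity constant.\<close>

lemma gauss_const:
  assumes \<beta>: "0 < \<beta>" "\<beta> < 1"
  shows "(\<integral>\<^sup>+\<rho>. ennreal (rker (1 - \<beta>) \<rho> * exp (- \<rho>\<^sup>2 / 2)) \<partial>lborel) = ennreal (gauss_const \<beta>)"
    and "0 < gauss_const \<beta>" and "gauss_const \<beta> \<le> 4 / \<beta>"
proof -
  let ?f = "\<lambda>\<rho>. ennreal (rker (1 - \<beta>) \<rho> * exp (- \<rho>\<^sup>2 / 2))"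
  let ?g = "\<lambda>\<rho>. ennreal (rker (1 - \<beta>) \<rho>) * indicator {..1} \<rho>"
  have unit: "(\<integral>\<^sup>+\<rho>. ?g \<rho> \<partial>lborel) = ennreal (1 / \<beta>)"
    using nn_integral_rker_unit[of "1 - \<beta>"] \<beta> by simp
  have normal: "(\<integral>\<^sup>+\<rho>. ennreal (3 * std_normal_density \<rho>) \<partial>lborel) = ennreal 3"
    using integral_std_normal by (subst nn_integral_eq_integral) (simp_all add: integrable_std_normal)
  have sqrt2pi: "sqrt (2 * pi) \<le> 3" using pi_less_4 by (intro real_le_lsqrt) auto
  have "(\<integral>\<^sup>+\<rho>. ?f \<rho> \<partial>lborel) \<le> (\<integral>\<^sup>+\<rho>. ?g \<rho> + ennreal (3 * std_normal_density \<rho>) \<partial>lborel)"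
  proof (intro nn_integral_mono)
    fix \<rho> :: real
    show "?f \<rho> \<le> ?g \<rho> + ennreal (3 * std_normal_density \<rho>)"
    proof (cases "\<rho> \<le> 1")
      case True
      have "rker (1 - \<beta>) \<rho> * exp (- \<rho>\<^sup>2 / 2) \<le> rker (1 - \<beta>) \<rho> * 1"
        by (intro mult_left_mono rker_nonneg) simp
      then have "?f \<rho> \<le> ?g \<rho>" using True by (simp add: ennreal_leI)
      then show ?thesis by (rule add_increasing2[rotated]) simp
    next
      case False
      have "rker (1 - \<beta>) \<rho> * exp (- \<rho>\<^sup>2 / 2) \<le> 1 * exp (- \<rho>\<^sup>2 / 2)"
        using False \<beta> by (intro mult_right_mono rker_le_1) auto
      also have "\<dots> = sqrt (2 * pi) * std_normal_density \<rho>"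
        by (simp add: std_normal_density_def)
      also have "\<dots> \<le> 3 * std_normal_density \<rho>"
        by (intro mult_right_mono sqrt2pi normal_density_nonneg)
      finally have "?f \<rho> \<le> ennreal (3 * std_normal_density \<rho>)" by (rule ennreal_leI)
      then show ?thesis by (rule add_increasing[rotated]) simp
    qed
  qed
  also have "\<dots> = ennreal (1 / \<beta>) + ennreal 3"
    unfolding unit[symmetric] normal[symmetric] by (rule nn_integral_add) simp_all
  also have "\<dots> = ennreal (1 / \<beta> + 3)" using \<beta> by (intro ennreal_plus[symmetric]) auto
  finally have le: "(\<integral>\<^sup>+\<rho>. ?f \<rho> \<partial>lborel) \<le> ennreal (1 / \<beta> + 3)" .
  then have "(\<integral>\<^sup>+\<rho>. ?f \<rho> \<partial>lborel) < \<infinity>" by (rule le_less_trans) simp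
  then show eq: "(\<integral>\<^sup>+\<rho>. ?f \<rho> \<partial>lborel) = ennreal (gauss_const \<beta>)"
    unfolding gauss_const_def by simp
  have "1 / \<beta> + 3 \<le> 4 / \<beta>" using \<beta> by (simp add: field_simps)
  moreover have "gauss_const \<beta> \<le> 1 / \<beta> + 3"
    using le \<beta> unfolding eq by (subst (asm) ennreal_le_iff) auto
  ultimately show "gauss_const \<beta> \<le> 4 / \<beta>" by linarith
  have "ennreal (exp (- 1 / 2) / \<beta>) = ennreal (exp (- 1 / 2)) * ennreal (1 / \<beta>)"
    using \<beta> by (subst ennreal_mult[symmetric]) auto
  also have "\<dots> = (\<integral>\<^sup>+\<rho>. ennreal (exp (- 1 / 2)) * ?g \<rho> \<partial>lborel)"
    unfolding unit[symmetric] by (rule nn_integral_cmult[symmetric]) measurable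
  also have "\<dots> \<le> (\<integral>\<^sup>+\<rho>. ?f \<rho> \<partial>lborel)"
  proof (intro nn_integral_mono)
    fix \<rho> :: real
    show "ennreal (exp (- 1 / 2)) * ?g \<rho> \<le> ?f \<rho>"
    proof (cases "0 < \<rho> \<and> \<rho> \<le> 1")
      case True
      then have "\<rho>\<^sup>2 \<le> 1" by (simp add: power_le_one)
      then have "exp (- 1 / 2) * rker (1 - \<beta>) \<rho> \<le> exp (- \<rho>\<^sup>2 / 2) * rker (1 - \<beta>) \<rho>"
        by (intro mult_right_mono rker_nonneg) simp
      then have "ennreal (exp (- 1 / 2) * rker (1 - \<beta>) \<rho>) \<le> ?f \<rho>"
        by (intro ennreal_leI) (simp only: mult.commute)
      then show ?thesis using True by (simp add: ennreal_mult' rker_nonneg)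
    next
      case False
      then have "?g \<rho> = 0" by (auto simp: rker_def indicator_def)
      then show ?thesis by (simp only: mult_zero_right zero_le)
    qed
  qed
  finally have "exp (- 1 / 2) / \<beta> \<le> gauss_const \<beta>"
    unfolding eq by (subst (asm) ennreal_le_iff) (simp_all add: gauss_const_def)
  moreover have "0 < exp (- 1 / 2) / \<beta>" using \<beta> by simp
  ultimately show "0 < gauss_const \<beta>" by linarith
qed

text \<open>Substituting \<rho> / \<bar>d\<bar> for \<rho> writes the singular kernel as a positive
  superposition of Gaussians in d, each with an explicit positive Fourier transform.\<close>

lemma gauss_scale:
  assumes \<beta>: "0 < \<beta>" "\<beta> < 1" and d: "d \<noteq> 0"
  shows "(\<integral>\<^sup>+\<rho>. ennreal (rker (1 - \<beta>) \<rho> * exp (- (\<rho> * d)\<^sup>2 / 2)) \<partial>lborel) = ennreal (gauss_const \<beta> * \<bar>d\<bar> powr (- \<beta>))"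
proof -
  define e where "e = 1 / \<bar>d\<bar>"
  have e: "0 < e" using d by (simp add: e_def)
  have "(\<integral>\<^sup>+\<rho>. ennreal (rker (1 - \<beta>) \<rho> * exp (- (\<rho> * d)\<^sup>2 / 2)) \<partial>lborel) =
    ennreal \<bar>e\<bar> * (\<integral>\<^sup>+\<rho>. ennreal (rker (1 - \<beta>) (0 + e * \<rho>) * exp (- ((0 + e * \<rho>) * d)\<^sup>2 / 2)) \<partial>lborel)"
    using e by (intro nn_integral_real_affine) auto
  also have "(\<lambda>\<rho>. ennreal (rker (1 - \<beta>) (0 + e * \<rho>) * exp (- ((0 + e * \<rho>) * d)\<^sup>2 / 2))) =
     (\<lambda>\<rho>. ennreal (e powr (\<beta> - 1)) * ennreal (rker (1 - \<beta>) \<rho> * exp (- \<rho>\<^sup>2 / 2)))"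
  proof
    fix \<rho>
    have "((0 + e * \<rho>) * d)\<^sup>2 = \<rho>\<^sup>2" using d by (simp add: e_def power_mult_distrib power_divide)
    then have "rker (1 - \<beta>) (0 + e * \<rho>) * exp (- ((0 + e * \<rho>) * d)\<^sup>2 / 2) =
      e powr (\<beta> - 1) * (rker (1 - \<beta>) \<rho> * exp (- \<rho>\<^sup>2 / 2))"
      using rker_scale[OF e, of "1 - \<beta>" \<rho>] by simp
    then show "ennreal (rker (1 - \<beta>) (0 + e * \<rho>) * exp (- ((0 + e * \<rho>) * d)\<^sup>2 / 2)) =
      ennreal (e powr (\<beta> - 1)) * ennreal (rker (1 - \<beta>) \<rho> * exp (- \<rho>\<^sup>2 / 2))"
      by (simp only:) (rule ennreal_mult, simp_all add: rker_nonneg)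
  qed
  also have "(\<integral>\<^sup>+\<rho>. ennreal (e powr (\<beta> - 1)) * ennreal (rker (1 - \<beta>) \<rho> * exp (- \<rho>\<^sup>2 / 2)) \<partial>lborel) =
     ennreal (e powr (\<beta> - 1)) * ennreal (gauss_const \<beta>)"
    unfolding gauss_const(1)[OF \<beta>, symmetric] by (rule nn_integral_cmult) measurable
  also have "ennreal \<bar>e\<bar> * (ennreal (e powr (\<beta> - 1)) * ennreal (gauss_const \<beta>)) = ennreal (e * (e powr (\<beta> - 1) * gauss_const \<beta>))"
    using e gauss_const(2)[OF \<beta>] by (simp add: ennreal_mult)
  also have "e * (e powr (\<beta> - 1) * gauss_const \<beta>) = gauss_const \<beta> * (e powr 1 * e powr (\<beta> - 1))"
    using e by simp
  also have "e powr 1 * e powr (\<beta> - 1) = \<bar>d\<bar> powr (- \<beta>)"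
    unfolding powr_add[symmetric] using d by (simp add: e_def powr_divide powr_minus_divide)
  finally show ?thesis .
qed

text \<open>The density is at most 1 near the singularity and the power at most 1 away from it. From
  below, the density on (0,1] is at least its value at 1. With \<beta> = 2 \<sigma> - 1 the bound is
  a multiple of 1 / (1 - \<sigma>), the second compensating power.\<close>

lemma moment_const:
  assumes \<beta>: "0 < \<beta>" "\<beta> < 1"
  shows "(\<integral>\<^sup>+y. ennreal (std_normal_density y * \<bar>y\<bar> powr (- \<beta>)) \<partial>lborel) = ennreal (moment_const \<beta>)"
    and "std_normal_density 1 / (1 - \<beta>) \<le> moment_const \<beta>"
proof -
  let ?f = "\<lambda>y. ennreal (std_normal_density y * \<bar>y\<bar> powr (- \<beta>))"
  let ?g = "\<lambda>y. ennreal (rker \<beta> y) * indicator {..1} y"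
  note unit = nn_integral_rker_unit[OF \<beta>(2)]
  have unit': "(\<integral>\<^sup>+y. ?g (- y) \<partial>lborel) = ennreal (1 / (1 - \<beta>))"
    using nn_integral_real_affine[of ?g "-1" 0] unit by simp
  have normal: "(\<integral>\<^sup>+y. ennreal (std_normal_density y) \<partial>lborel) = ennreal 1"
    using integral_std_normal by (subst nn_integral_eq_integral) (simp_all add: integrable_std_normal)
  have "(\<integral>\<^sup>+y. ?f y \<partial>lborel) \<le> (\<integral>\<^sup>+y. (?g y + ?g (- y)) + ennreal (std_normal_density y) \<partial>lborel)"
  proof (intro nn_integral_mono)
    fix y :: real
    consider "y = 0" | "0 < y" "y \<le> 1" | "- 1 \<le> y" "y < 0" | "1 \<le> \<bar>y\<bar>" by linarith
    then show "?f y \<le> (?g y + ?g (- y)) + ennreal (std_normal_density y)"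
    proof cases
      case 1
      then show ?thesis by simp
    next
      case 2
      have "std_normal_density y * \<bar>y\<bar> powr (- \<beta>) \<le> 1 * \<bar>y\<bar> powr (- \<beta>)"
        by (intro mult_right_mono std_normal_bound) simp
      then have "?f y \<le> ?g y" using 2 by (simp add: rker_def ennreal_leI)
      then show ?thesis by (metis add_increasing2 zero_le)
    next
      case 3
      have "std_normal_density y * \<bar>y\<bar> powr (- \<beta>) \<le> 1 * \<bar>y\<bar> powr (- \<beta>)"
        by (intro mult_right_mono std_normal_bound) simp
      then have "?f y \<le> ?g (- y)" using 3 by (simp add: rker_def ennreal_leI)
      then show ?thesis by (metis add_increasing2 add_increasing zero_le)
    next
      case 4
      have "\<bar>y\<bar> powr (- \<beta>) \<le> 1" using powr_mono2'[of "- \<beta>" 1 "\<bar>y\<bar>"] 4 \<beta> by simp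
      then have "std_normal_density y * \<bar>y\<bar> powr (- \<beta>) \<le> std_normal_density y * 1"
        by (intro mult_left_mono normal_density_nonneg)
      then have "?f y \<le> ennreal (std_normal_density y)" unfolding mult_1_right by (rule ennreal_leI)
      then show ?thesis by (metis add_increasing zero_le)
    qed
  qed
  also have "\<dots> = (ennreal (1 / (1 - \<beta>)) + ennreal (1 / (1 - \<beta>))) + ennreal 1"
    using unit unit' normal by (subst nn_integral_add, measurable) (subst nn_integral_add, auto)
  also have "\<dots> < \<infinity>" by (simp add: ennreal_add_eq_top less_top[symmetric])
  finally show eq: "(\<integral>\<^sup>+y. ?f y \<partial>lborel) = ennreal (moment_const \<beta>)"
    unfolding moment_const_def by simp
  have "ennreal (std_normal_density 1 / (1 - \<beta>)) = ennreal (std_normal_density 1) * ennreal (1 / (1 - \<beta>))"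
    using \<beta> by (subst ennreal_mult[symmetric]) (auto simp: normal_density_nonneg)
  also have "\<dots> = (\<integral>\<^sup>+y. ennreal (std_normal_density 1) * ?g y \<partial>lborel)"
    unfolding unit[symmetric] by (rule nn_integral_cmult[symmetric]) measurable
  also have "\<dots> \<le> (\<integral>\<^sup>+y. ?f y \<partial>lborel)"
  proof (intro nn_integral_mono)
    fix y :: real
    show "ennreal (std_normal_density 1) * ?g y \<le> ?f y"
    proof (cases "0 < y \<and> y \<le> 1")
      case True
      then have "y\<^sup>2 \<le> 1" by (simp add: power_le_one)
      then have "std_normal_density 1 \<le> std_normal_density y"
        unfolding std_normal_density_def by (intro mult_left_mono) auto
      then have "std_normal_density 1 * rker \<beta> y \<le> std_normal_density y * rker \<beta> y"
        by (intro mult_right_mono rker_nonneg)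
      then have "ennreal (std_normal_density 1 * rker \<beta> y) \<le> ?f y"
        using True by (intro ennreal_leI) (simp add: rker_def)
      moreover have "ennreal (std_normal_density 1) * ennreal (rker \<beta> y) = ennreal (std_normal_density 1 * rker \<beta> y)"
        by (rule ennreal_mult[symmetric]) (simp_all add: rker_nonneg normal_density_nonneg)
      moreover have "indicator {..1} y = (1 :: ennreal)" using True by simp
      ultimately show ?thesis by (simp only: mult_1_right)
    next
      case False
      then have "?g y = 0" by (auto simp: rker_def indicator_def)
      then show ?thesis by (simp only: mult_zero_right zero_le)
    qed
  qed
  finally show "std_normal_density 1 / (1 - \<beta>) \<le> moment_const \<beta>"
    unfolding eq by (subst (asm) ennreal_le_iff) (simp_all add: moment_const_def)
qed

context bounded_on_Omega
begin

text \<open>The power spectrum of h for the transform without normalisation; the factor 2 pi undoes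
  the unitary scaling.\<close>

definition pow :: "real \<Rightarrow> real" where
  "pow a = 2 * pi * (cmod (fourier h a))\<^sup>2"

lemma pow_measurable [measurable]: "pow \<in> borel_measurable borel"
proof -
  note [measurable] = fourier_measurable[OF h_measurable]
  show ?thesis unfolding pow_def[abs_def] by measurable
qed

lemma pow_nonneg: "0 \<le> pow a"
  by (simp add: pow_def)

lemma fourier_minus: "fourier h (- a) = cnj (fourier h a)"
proof -
  have "(LINT x|lborel. cis (- (- a * x)) * complex_of_real (h x)) = (LINT x|lborel. cnj (cis (- (a * x)) * complex_of_real (h x)))"
    by (intro Bochner_Integration.integral_cong refl) (simp add: cis_cnj)
  also have "\<dots> = cnj (LINT x|lborel. cis (- (a * x)) * complex_of_real (h x))"
    by (rule Bochner_Integration.integral_cnj)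
  finally show ?thesis by (simp add: fourier_def)
qed

lemma pow_abs: "pow \<bar>a\<bar> = pow a"
  by (cases "0 \<le> a") (simp_all add: pow_def fourier_minus)

lemma pow_bounded: "pow a \<le> (LINT x|lborel. \<bar>h x\<bar>)\<^sup>2"
proof -
  have "(cmod (fourier h a))\<^sup>2 \<le> ((LINT x|lborel. \<bar>h x\<bar>) / sqrt (2 * pi))\<^sup>2"
    by (intro power_mono fourier_bound norm_ge_zero)
  also have "\<dots> = (LINT x|lborel. \<bar>h x\<bar>)\<^sup>2 / (2 * pi)" by (simp add: power_divide)
  finally show ?thesis by (simp add: pow_def field_simps)
qed

lemma hh_integrable: "integrable lborel (\<lambda>z. h (fst z) * h (snd z))"
  by (rule LINT_pair_mult_real(2)[OF h_integrable h_integrable])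

text \<open>The squared modulus of the transform is a double integral with character exp(i a (r -
  t)). It is real, so taking real parts leaves the cosine.\<close>

lemma cos_form: "(LINT z|lborel. h (fst z) * h (snd z) * cos (a * (fst z - snd z))) = pow a"
proof -
  let ?F = "\<lambda>t. cis (- (a * t)) * complex_of_real (h t)"
  have F: "integrable lborel ?F" by (rule cis_integrable[OF h_integrable])
  have Fc: "integrable lborel (\<lambda>t. cnj (?F t))" using F by (rule integrable_cnj)
  have eq: "?F (fst z) * cnj (?F (snd z)) = of_real (h (fst z) * h (snd z)) * cis (a * (snd z - fst z))" for z
    by (simp add: cis_cnj right_diff_distrib cis_mult algebra_simps)
  have sF: "(LINT t|lborel. ?F t) = of_real (sqrt (2 * pi)) * fourier h a"
    by (simp add: fourier_def)
  have "(LINT z|lborel. ?F (fst z) * cnj (?F (snd z))) = (LINT t|lborel. ?F t) * (LINT t|lborel. cnj (?F t))"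
    by (rule LINT_pair_mult(1)[OF F Fc])
  also have "\<dots> = (LINT t|lborel. ?F t) * cnj (LINT t|lborel. ?F t)"
    by (simp only: Bochner_Integration.integral_cnj)
  also have "\<dots> = of_real ((cmod (LINT t|lborel. ?F t))\<^sup>2)"
    by (rule complex_norm_square[symmetric])
  also have "(cmod (LINT t|lborel. ?F t))\<^sup>2 = pow a"
    unfolding sF pow_def by (simp add: norm_mult power_mult_distrib)
  finally have "Re (LINT z|lborel. ?F (fst z) * cnj (?F (snd z))) = pow a" by simp
  moreover have "Re (LINT z|lborel. ?F (fst z) * cnj (?F (snd z))) = (LINT z|lborel. Re (?F (fst z) * cnj (?F (snd z))))"
    by (rule integral_Re[OF LINT_pair_mult(2)[OF F Fc], symmetric])
  moreover have "Re (?F (fst z) * cnj (?F (snd z))) = h (fst z) * h (snd z) * cos (a * (fst z - snd z))" for z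
  proof -
    have "cos (a * (snd z - fst z)) = cos (a * (fst z - snd z))"
      using cos_minus[of "a * (fst z - snd z)"] by (simp add: algebra_simps)
    then show ?thesis unfolding eq by simp
  qed
  ultimately show ?thesis by simp
qed

text \<open>The Gaussian is the expectation of cos(a Y) for a standard normal Y. Hence the Gaussian
  form is an average of power spectra and in particular nonnegative.\<close>

lemma gauss_form:
  "(LINT z|lborel. h (fst z) * h (snd z) * exp (- (\<rho> * (fst z - snd z))\<^sup>2 / 2)) = (LINT y|lborel. std_normal_density y * pow (\<rho> * y))"
proof -
  define F where "F y z = std_normal_density y * (h (fst z) * h (snd z) * cos (\<rho> * y * (fst z - snd z)))" for y and z :: "real \<times> real"
  have "(LINT y|lborel. LINT z|lborel. F y z) = (LINT z|lborel. LINT y|lborel. F y z)"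
  proof (rule Fubini_dominated[where f=std_normal_density and g="\<lambda>z. \<bar>h (fst z) * h (snd z)\<bar>"])
    show "case_prod F \<in> borel_measurable (lborel \<Otimes>\<^sub>M lborel)" unfolding F_def by measurable
    show "integrable lborel std_normal_density" by (rule integrable_std_normal)
    show "integrable lborel (\<lambda>z. \<bar>h (fst z) * h (snd z)\<bar>)" using hh_integrable by (rule integrable_abs)
    fix y and z :: "real \<times> real"
    have "\<bar>h (fst z) * h (snd z)\<bar> * \<bar>cos (\<rho> * y * (fst z - snd z))\<bar> \<le> \<bar>h (fst z) * h (snd z)\<bar> * 1"
      by (intro mult_left_mono abs_cos_le_one) simp
    then have "\<bar>h (fst z) * h (snd z) * cos (\<rho> * y * (fst z - snd z))\<bar> \<le> \<bar>h (fst z) * h (snd z)\<bar>"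
      by (simp add: abs_mult)
    then show "norm (F y z) \<le> std_normal_density y * \<bar>h (fst z) * h (snd z)\<bar>"
      unfolding F_def real_norm_def abs_mult[of "std_normal_density y"] abs_of_nonneg[OF normal_density_nonneg]
      by (intro mult_left_mono normal_density_nonneg)
  qed
  moreover have "(LINT z|lborel. F y z) = std_normal_density y * pow (\<rho> * y)" for y
    unfolding F_def integral_mult_right_zero cos_form ..
  moreover have "(LINT y|lborel. F y z) = h (fst z) * h (snd z) * exp (- (\<rho> * (fst z - snd z))\<^sup>2 / 2)" for z
  proof -
    have "(LINT y|lborel. F y z) = (LINT y|lborel. h (fst z) * h (snd z) * (std_normal_density y * cos (\<rho> * (fst z - snd z) * y)))"
      unfolding F_def by (simp only: mult_ac)
    then show ?thesis unfolding integral_mult_right_zero std_normal_cos .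
  qed
  ultimately show ?thesis by (simp only:)
qed

text \<open>Gaussians enter twice: integrating their inverse width gives the Riesz kernel, and
  expanding each one in cosines gives the spectrum at \<rho> y. Tonelli and the substitution
  \<omega> = \<rho> \<bar>y\<bar> separate the y-integral as \<open>moment_const\<close>. The
  identity is kept in \<open>ennreal\<close>, since finiteness of the frequency integral is not
  assumed.\<close>

lemma Q_Fourier:
  assumes \<beta>: "0 < \<beta>" "\<beta> < 1"
  shows "ennreal (gauss_const \<beta> * Q \<beta>) = ennreal (moment_const \<beta>) * (\<integral>\<^sup>+\<omega>. ennreal (rker (1 - \<beta>) \<omega> * pow \<omega>) \<partial>lborel)"
    and "0 \<le> Q \<beta>"
proof -
  define D where "D \<rho> = (LINT y|lborel. std_normal_density y * pow (\<rho> * y))" for \<rho>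
  define I where "I = (\<integral>\<^sup>+\<omega>. ennreal (rker (1 - \<beta>) \<omega> * pow \<omega>) \<partial>lborel)"
  let ?\<Phi> = "\<lambda>\<rho> z :: real \<times> real. rker (1 - \<beta>) \<rho> * exp (- (\<rho> * (fst z - snd z))\<^sup>2 / 2)"
  let ?G = "\<lambda>z :: real \<times> real. gauss_const \<beta> * \<bar>fst z - snd z\<bar> powr (- \<beta>)"
  have G0: "0 \<le> ?G z" for z using gauss_const(2)[OF \<beta>] by simp
  have corr: "(\<integral>\<^sup>+\<rho>. ennreal (?\<Phi> \<rho> z) \<partial>lborel) = ennreal (?G z)" if "fst z \<noteq> snd z" for z
    using that by (intro gauss_scale \<beta>) simp
  have m: "case_prod ?\<Phi> \<in> borel_measurable (lborel \<Otimes>\<^sub>M lborel)" by measurable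
  have p: "0 \<le> ?\<Phi> \<rho> z" for \<rho> z by (simp add: rker_nonneg)
  have G: "?G \<in> borel_measurable borel" by measurable
  have K: "integrable lborel (\<lambda>\<rho>. LINT z|lborel. h (fst z) * h (snd z) * ?\<Phi> \<rho> z)"
    "(LINT \<rho>|lborel. LINT z|lborel. h (fst z) * h (snd z) * ?\<Phi> \<rho> z) = (LINT z|lborel. h (fst z) * h (snd z) * ?G z)"
    by (rule kernel_Fubini[OF \<beta>(2) m p G corr G0 order_refl], assumption)+
  have inner: "(LINT z|lborel. h (fst z) * h (snd z) * ?\<Phi> \<rho> z) = rker (1 - \<beta>) \<rho> * D \<rho>" for \<rho>
  proof -
    have "(LINT z|lborel. h (fst z) * h (snd z) * ?\<Phi> \<rho> z) =
       (LINT z|lborel. rker (1 - \<beta>) \<rho> * (h (fst z) * h (snd z) * exp (- (\<rho> * (fst z - snd z))\<^sup>2 / 2)))"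
      by (simp only: mult_ac)
    then show ?thesis unfolding integral_mult_right_zero gauss_form D_def .
  qed
  have QG: "(LINT z|lborel. h (fst z) * h (snd z) * ?G z) = gauss_const \<beta> * Q \<beta>"
    unfolding Q_def integral_mult_right_zero[symmetric] by (simp only: mult_ac)
  have int: "integrable lborel (\<lambda>\<rho>. rker (1 - \<beta>) \<rho> * D \<rho>)"
    and eq: "(LINT \<rho>|lborel. rker (1 - \<beta>) \<rho> * D \<rho>) = gauss_const \<beta> * Q \<beta>"
    using K unfolding inner QG .
  have D0: "0 \<le> D \<rho>" for \<rho>
    unfolding D_def by (intro integral_nonneg_AE AE_I2 mult_nonneg_nonneg normal_density_nonneg pow_nonneg)
  have nn0: "0 \<le> rker (1 - \<beta>) \<rho> * D \<rho>" for \<rho> by (intro mult_nonneg_nonneg rker_nonneg D0)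
  \<comment> \<open>Positivity of the Riesz energy is inherited from that of every single Gaussian
    form.\<close>
  have "0 \<le> gauss_const \<beta> * Q \<beta>" unfolding eq[symmetric] by (intro integral_nonneg_AE AE_I2 nn0)
  then show "0 \<le> Q \<beta>" using gauss_const(2)[OF \<beta>] by (simp add: zero_le_mult_iff)
  have Dint: "integrable lborel (\<lambda>y. std_normal_density y * pow (\<rho> * y))" for \<rho>
  proof (rule Bochner_Integration.integrable_bound)
    show "integrable lborel (\<lambda>y. std_normal_density y * (LINT x|lborel. \<bar>h x\<bar>)\<^sup>2)"
      by (intro integrable_mult_left integrable_std_normal)
    show "AE y in lborel. norm (std_normal_density y * pow (\<rho> * y)) \<le> norm (std_normal_density y * (LINT x|lborel. \<bar>h x\<bar>)\<^sup>2)"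
    proof (rule AE_I2)
      fix y
      have "std_normal_density y * pow (\<rho> * y) \<le> std_normal_density y * (LINT x|lborel. \<bar>h x\<bar>)\<^sup>2"
        by (intro mult_left_mono pow_bounded normal_density_nonneg)
      moreover have "0 \<le> std_normal_density y * pow (\<rho> * y)"
        by (intro mult_nonneg_nonneg normal_density_nonneg pow_nonneg)
      ultimately show "norm (std_normal_density y * pow (\<rho> * y)) \<le> norm (std_normal_density y * (LINT x|lborel. \<bar>h x\<bar>)\<^sup>2)"
        unfolding real_norm_def by (metis abs_of_nonneg order_trans)
    qed
  qed measurable
  have D_nn: "ennreal (D \<rho>) = (\<integral>\<^sup>+y. ennreal (std_normal_density y * pow (\<rho> * y)) \<partial>lborel)" for \<rho>
    unfolding D_def
    by (rule nn_integral_eq_integral[OF Dint, symmetric])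
      (intro AE_I2 mult_nonneg_nonneg normal_density_nonneg pow_nonneg)
  \<comment> \<open>The spectrum is even because h is real, so y may be replaced by its modulus
    before rescaling.\<close>
  have scale: "(\<integral>\<^sup>+\<rho>. ennreal (rker (1 - \<beta>) \<rho>) * ennreal (pow (\<rho> * y)) \<partial>lborel) = ennreal (\<bar>y\<bar> powr (- \<beta>)) * I" if "y \<noteq> 0" for y
  proof -
    define d where "d = \<bar>y\<bar>"
    have d: "0 < d" using that by (simp add: d_def)
    have "I = ennreal \<bar>d\<bar> * (\<integral>\<^sup>+\<rho>. ennreal (rker (1 - \<beta>) (0 + d * \<rho>) * pow (0 + d * \<rho>)) \<partial>lborel)"
      unfolding I_def using d by (intro nn_integral_real_affine) auto
    also have "(\<lambda>\<rho>. ennreal (rker (1 - \<beta>) (0 + d * \<rho>) * pow (0 + d * \<rho>))) =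
       (\<lambda>\<rho>. ennreal (d powr (\<beta> - 1)) * (ennreal (rker (1 - \<beta>) \<rho>) * ennreal (pow (\<rho> * y))))"
    proof
      fix \<rho>
      have "pow (d * \<rho>) = pow (\<rho> * y)"
        using pow_abs[of "d * \<rho>"] pow_abs[of "\<rho> * y"] by (simp add: d_def abs_mult mult.commute)
      then have "rker (1 - \<beta>) (0 + d * \<rho>) * pow (0 + d * \<rho>) = d powr (\<beta> - 1) * (rker (1 - \<beta>) \<rho> * pow (\<rho> * y))"
        using rker_scale[OF d, of "1 - \<beta>" \<rho>] by simp
      then show "ennreal (rker (1 - \<beta>) (0 + d * \<rho>) * pow (0 + d * \<rho>)) =
        ennreal (d powr (\<beta> - 1)) * (ennreal (rker (1 - \<beta>) \<rho>) * ennreal (pow (\<rho> * y)))"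
        by (simp add: ennreal_mult rker_nonneg pow_nonneg)
    qed
    also have "(\<integral>\<^sup>+\<rho>. ennreal (d powr (\<beta> - 1)) * (ennreal (rker (1 - \<beta>) \<rho>) * ennreal (pow (\<rho> * y))) \<partial>lborel) =
       ennreal (d powr (\<beta> - 1)) * (\<integral>\<^sup>+\<rho>. ennreal (rker (1 - \<beta>) \<rho>) * ennreal (pow (\<rho> * y)) \<partial>lborel)"
      by (rule nn_integral_cmult) measurable
    finally have I: "I = ennreal d * (ennreal (d powr (\<beta> - 1)) * (\<integral>\<^sup>+\<rho>. ennreal (rker (1 - \<beta>) \<rho>) * ennreal (pow (\<rho> * y)) \<partial>lborel))"
      using d by simp
    have "d powr (- \<beta>) * (d * d powr (\<beta> - 1)) = d powr (- \<beta>) * (d powr 1 * d powr (\<beta> - 1))" using d by simp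
    also have "\<dots> = 1" unfolding powr_add[symmetric] using d by simp
    finally have one: "ennreal (d powr (- \<beta>)) * (ennreal d * ennreal (d powr (\<beta> - 1))) = 1"
      using d by (simp add: ennreal_mult[symmetric])
    have "ennreal (d powr (- \<beta>)) * I = (ennreal (d powr (- \<beta>)) * (ennreal d * ennreal (d powr (\<beta> - 1)))) * (\<integral>\<^sup>+\<rho>. ennreal (rker (1 - \<beta>) \<rho>) * ennreal (pow (\<rho> * y)) \<partial>lborel)"
      unfolding I by (simp only: mult.assoc)
    then show ?thesis unfolding one mult_1 d_def[symmetric] by (rule sym)
  qed
  have "ennreal (gauss_const \<beta> * Q \<beta>) = (\<integral>\<^sup>+\<rho>. ennreal (rker (1 - \<beta>) \<rho> * D \<rho>) \<partial>lborel)"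
    unfolding eq[symmetric] by (rule nn_integral_eq_integral[OF int, symmetric]) (intro AE_I2 nn0)
  also have "\<dots> = (\<integral>\<^sup>+\<rho>. \<integral>\<^sup>+y. ennreal (rker (1 - \<beta>) \<rho>) * ennreal (std_normal_density y * pow (\<rho> * y)) \<partial>lborel \<partial>lborel)"
  proof (rule nn_integral_cong)
    fix \<rho>
    have "ennreal (rker (1 - \<beta>) \<rho> * D \<rho>) = ennreal (rker (1 - \<beta>) \<rho>) * ennreal (D \<rho>)"
      by (rule ennreal_mult[OF rker_nonneg D0])
    also have "\<dots> = (\<integral>\<^sup>+y. ennreal (rker (1 - \<beta>) \<rho>) * ennreal (std_normal_density y * pow (\<rho> * y)) \<partial>lborel)"
      unfolding D_nn by (rule nn_integral_cmult[symmetric]) measurable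
    finally show "ennreal (rker (1 - \<beta>) \<rho> * D \<rho>) = (\<integral>\<^sup>+y. ennreal (rker (1 - \<beta>) \<rho>) * ennreal (std_normal_density y * pow (\<rho> * y)) \<partial>lborel)" .
  qed
  also have "\<dots> = (\<integral>\<^sup>+y. \<integral>\<^sup>+\<rho>. ennreal (rker (1 - \<beta>) \<rho>) * ennreal (std_normal_density y * pow (\<rho> * y)) \<partial>lborel \<partial>lborel)"
    by (rule lborel_pair.Fubini'[symmetric]) measurable
  also have "\<dots> = (\<integral>\<^sup>+y. ennreal (std_normal_density y * \<bar>y\<bar> powr (- \<beta>)) * I \<partial>lborel)"
  proof (rule nn_integral_cong_AE, use AE_lborel_singleton[of 0] in eventually_elim)
    fix y :: real assume y: "y \<noteq> 0"
    have "(\<integral>\<^sup>+\<rho>. ennreal (rker (1 - \<beta>) \<rho>) * ennreal (std_normal_density y * pow (\<rho> * y)) \<partial>lborel) =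
       (\<integral>\<^sup>+\<rho>. ennreal (std_normal_density y) * (ennreal (rker (1 - \<beta>) \<rho>) * ennreal (pow (\<rho> * y))) \<partial>lborel)"
      by (intro nn_integral_cong) (simp add: ennreal_mult normal_density_nonneg pow_nonneg mult_ac)
    also have "\<dots> = ennreal (std_normal_density y) * (ennreal (\<bar>y\<bar> powr (- \<beta>)) * I)"
      unfolding scale[OF y, symmetric] by (rule nn_integral_cmult) measurable
    also have "\<dots> = ennreal (std_normal_density y * \<bar>y\<bar> powr (- \<beta>)) * I"
      by (simp add: ennreal_mult normal_density_nonneg mult.assoc)
    finally show "(\<integral>\<^sup>+\<rho>. ennreal (rker (1 - \<beta>) \<rho>) * ennreal (std_normal_density y * pow (\<rho> * y)) \<partial>lborel) = ennreal (std_normal_density y * \<bar>y\<bar> powr (- \<beta>)) * I" .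
  qed
  also have "\<dots> = ennreal (moment_const \<beta>) * I"
    unfolding moment_const(1)[OF \<beta>, symmetric] by (rule nn_integral_multc) measurable
  finally show "ennreal (gauss_const \<beta> * Q \<beta>) = ennreal (moment_const \<beta>) * (\<integral>\<^sup>+\<omega>. ennreal (rker (1 - \<beta>) \<omega> * pow \<omega>) \<partial>lborel)"
    unfolding I_def .
qed

end

lemma test_bounded_on_Omega:
  assumes "\<phi> \<in> test_functions"
  obtains M where "bounded_on_Omega \<phi> M"
proof -
  obtain M where "\<And>x. \<bar>\<phi> x\<bar> \<le> M" using test_bounded[OF assms] by metis
  then have "bounded_on_Omega \<phi> M"
    by unfold_locales (use test_measurable[OF assms] test_zero[OF assms] in simp_all)
  then show ?thesis by (rule that)
qed

text \<open>\<open>Q_Fourier\<close> sees positive frequencies only. For a real function the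
  transform at the opposite frequency is the conjugate, so the density is even and half of the
  energy lies there.\<close>

lemma half_line_energy:
  assumes \<phi>: "\<phi> \<in> test_functions" and \<sigma>: "0 \<le> \<sigma>" "\<sigma> \<le> 1"
  shows "(\<integral>\<^sup>+\<omega>. ennreal (energy_density \<sigma> \<phi> \<omega>) * indicator {0<..} \<omega> \<partial>lborel) =
    ennreal ((LINT \<omega>|lborel. energy_density \<sigma> \<phi> \<omega>) / 2)"
proof -
  obtain M where "bounded_on_Omega \<phi> M" using test_bounded_on_Omega[OF \<phi>] by metis
  then interpret bounded_on_Omega \<phi> M .
  note [measurable] = borel_measurable_integrable[OF energy_integrable[OF \<phi> \<sigma>]]
  let ?e = "\<lambda>\<omega>. ennreal (energy_density \<sigma> \<phi> \<omega>)"
  have nn: "0 \<le> energy_density \<sigma> \<phi> \<omega>" for \<omega> by (simp add: energy_density_def)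
  have even: "energy_density \<sigma> \<phi> (- \<omega>) = energy_density \<sigma> \<phi> \<omega>" for \<omega>
    by (simp add: energy_density_def fourier_minus)
  let ?A = "\<integral>\<^sup>+\<omega>. ?e \<omega> * indicator {0<..} \<omega> \<partial>lborel"
  have "?A = (\<integral>\<^sup>+\<omega>. ?e (0 + (- 1) * \<omega>) * indicator {0<..} (0 + (- 1) * \<omega>) \<partial>lborel)"
    using nn_integral_real_affine[of "\<lambda>\<omega>. ?e \<omega> * indicator {0<..} \<omega>" "-1" 0] by simp
  then have neg: "(\<integral>\<^sup>+\<omega>. ?e \<omega> * indicator {0<..} (- \<omega>) \<partial>lborel) = ?A" by (simp add: even)
  have split: "?e \<omega> = ?e \<omega> * indicator {0<..} \<omega> + ?e \<omega> * indicator {0<..} (- \<omega>)" if "\<omega> \<noteq> 0" for \<omega>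
    using that by (cases "0 < \<omega>") auto
  have "ennreal (LINT \<omega>|lborel. energy_density \<sigma> \<phi> \<omega>) = (\<integral>\<^sup>+\<omega>. ?e \<omega> \<partial>lborel)"
    by (rule nn_integral_eq_integral[OF energy_integrable[OF \<phi> \<sigma>], symmetric]) (intro AE_I2 nn)
  also have "\<dots> = (\<integral>\<^sup>+\<omega>. ?e \<omega> * indicator {0<..} \<omega> + ?e \<omega> * indicator {0<..} (- \<omega>) \<partial>lborel)"
    by (rule nn_integral_cong_AE, use AE_lborel_singleton[of 0] in eventually_elim) (rule split)
  also have "\<dots> = ?A + ?A"
    by (subst nn_integral_add) (use neg in simp_all)
  finally have sum: "ennreal (LINT \<omega>|lborel. energy_density \<sigma> \<phi> \<omega>) = ?A + ?A" .
  then have "?A < \<infinity>" by (metis ennreal_add_eq_top ennreal_neq_top infinity_ennreal_def less_top)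
  then obtain a where a: "0 \<le> a" "?A = ennreal a" by (cases ?A) auto
  have "(LINT \<omega>|lborel. energy_density \<sigma> \<phi> \<omega>) = a + a"
  proof -
    have "ennreal (LINT \<omega>|lborel. energy_density \<sigma> \<phi> \<omega>) = ennreal (a + a)" unfolding sum a(2) by (rule ennreal_plus[OF a(1) a(1), symmetric])
    then show ?thesis
      by (subst (asm) ennreal_inj) (use a(1) nn in \<open>auto intro!: integral_nonneg_AE\<close>)
  qed
  then show ?thesis unfolding a(2) by simp
qed

text \<open>The transform of the derivative contributes \<omega>^2, and \<omega>^(2 \<sigma> - 2)
  \<omega>^2 is the energy weight. The factor pi is 2 pi from \<open>pow\<close> times 1/2 from the
  half line.\<close>

lemma Q_energy:
  assumes \<phi>: "\<phi> \<in> test_functions" and \<sigma>: "1/2 < \<sigma>" "\<sigma> < 1"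
  shows "gauss_const (2 * \<sigma> - 1) * bounded_on_Omega.Q (deriv \<phi>) (2 * \<sigma> - 1) =
      moment_const (2 * \<sigma> - 1) * (pi * (LINT \<omega>|lborel. energy_density \<sigma> \<phi> \<omega>))"
    and "0 \<le> bounded_on_Omega.Q (deriv \<phi>) (2 * \<sigma> - 1)"
proof -
  obtain M where "bounded_on_Omega (deriv \<phi>) M" using test_bounded_on_Omega[OF test_deriv[OF \<phi>]] by metis
  then interpret bounded_on_Omega "deriv \<phi>" M .
  have \<beta>: "0 < 2 * \<sigma> - 1" "2 * \<sigma> - 1 < 1" and \<sigma>': "0 \<le> \<sigma>" "\<sigma> \<le> 1" using \<sigma> by auto
  define E where "E = (LINT \<omega>|lborel. energy_density \<sigma> \<phi> \<omega>)"
  note [measurable] = borel_measurable_integrable[OF energy_integrable[OF \<phi> \<sigma>']]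
  have E0: "0 \<le> E" unfolding E_def by (intro integral_nonneg_AE AE_I2) (simp add: energy_density_def)
  have dens: "ennreal (rker (1 - (2 * \<sigma> - 1)) \<omega> * pow \<omega>) = ennreal (2 * pi) * (ennreal (energy_density \<sigma> \<phi> \<omega>) * indicator {0<..} \<omega>)" for \<omega>
  proof (cases "0 < \<omega>")
    case True
    have "rker (1 - (2 * \<sigma> - 1)) \<omega> * \<omega>\<^sup>2 = \<omega> powr (2 * \<sigma> - 2) * \<omega> powr 2"
      using True by (simp add: rker_def)
    also have "\<dots> = \<omega> powr (2 * \<sigma>)" unfolding powr_add[symmetric] by simp
    finally have "rker (1 - (2 * \<sigma> - 1)) \<omega> * \<omega>\<^sup>2 = \<omega> powr (2 * \<sigma>)" .
    then have "rker (1 - (2 * \<sigma> - 1)) \<omega> * pow \<omega> = 2 * pi * energy_density \<sigma> \<phi> \<omega>"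
      using True by (simp add: pow_def fourier_deriv[OF \<phi>] energy_density_def norm_mult power_mult_distrib)
    then show ?thesis using True by (simp add: ennreal_mult energy_density_def)
  next
    case False
    then show ?thesis by (simp add: rker_def)
  qed
  have "(\<integral>\<^sup>+\<omega>. ennreal (rker (1 - (2 * \<sigma> - 1)) \<omega> * pow \<omega>) \<partial>lborel) = ennreal (2 * pi) * ennreal (E / 2)"
    unfolding dens half_line_energy[OF \<phi> \<sigma>', folded E_def, symmetric]
    by (rule nn_integral_cmult) measurable
  also have "\<dots> = ennreal (pi * E)"
    using E0 by (subst ennreal_mult[symmetric]) auto
  finally have int: "(\<integral>\<^sup>+\<omega>. ennreal (rker (1 - (2 * \<sigma> - 1)) \<omega> * pow \<omega>) \<partial>lborel) = ennreal (pi * E)" .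
  have m0: "0 \<le> moment_const (2 * \<sigma> - 1)" by (simp add: moment_const_def)
  show Q0: "0 \<le> Q (2 * \<sigma> - 1)" by (rule Q_Fourier(2)[OF \<beta>])
  have "ennreal (gauss_const (2 * \<sigma> - 1) * Q (2 * \<sigma> - 1)) = ennreal (moment_const (2 * \<sigma> - 1) * (pi * E))"
    unfolding Q_Fourier(1)[OF \<beta>] int using m0 E0 by (intro ennreal_mult[symmetric]) auto
  then show "gauss_const (2 * \<sigma> - 1) * Q (2 * \<sigma> - 1) = moment_const (2 * \<sigma> - 1) * (pi * E)"
    using m0 E0 Q0 gauss_const(2)[OF \<beta>] by (subst (asm) ennreal_inj) (auto intro!: mult_nonneg_nonneg)
qed

text \<open>All constants meet here. The denominator 16 is 2 from the half plane, 4 from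
  \<open>gauss_const\<close> and 2 from 1 - \<beta> = 2 (1 - \<sigma>). The squared 1 - \<sigma>
  collects the bounds of \<open>mixed_const\<close> and \<open>moment_const\<close>.\<close>

lemma
  assumes \<phi>: "\<phi> \<in> test_functions" and \<sigma>: "1/2 < \<sigma>" "\<sigma> < 1"
  defines "E \<equiv> (LINT \<omega>|lborel. energy_density \<sigma> \<phi> \<omega>)"
    and "K \<equiv> same_const \<sigma> * (moment_const (2 * \<sigma> - 1) * pi / gauss_const (2 * \<sigma> - 1))"
  shows J_energy: "(LINT x|lborel. (bounded_on_Omega.Jl (deriv \<phi>) \<sigma> x)\<^sup>2) = K * E" "(LINT x|lborel. (bounded_on_Omega.Jr (deriv \<phi>) \<sigma> x)\<^sup>2) = K * E"
    and J_coercive: "std_normal_density 1 * pi / 16 * ((2 * \<sigma> - 1) / (1 - \<sigma>)\<^sup>2) * E \<le> (LINT x|lborel. bounded_on_Omega.Jl (deriv \<phi>) \<sigma> x * bounded_on_Omega.Jr (deriv \<phi>) \<sigma> x)"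
proof -
  obtain M where "bounded_on_Omega (deriv \<phi>) M" using test_bounded_on_Omega[OF test_deriv[OF \<phi>]] by metis
  then interpret bounded_on_Omega "deriv \<phi>" M .
  let ?\<beta> = "2 * \<sigma> - 1"
  have \<beta>: "0 < ?\<beta>" "?\<beta> < 1" using \<sigma> by auto
  note g = gauss_const[OF \<beta>] and m = moment_const(2)[OF \<beta>]
  have E0: "0 \<le> E" unfolding E_def by (intro integral_nonneg_AE AE_I2) (simp add: energy_density_def)
  have QE: "gauss_const ?\<beta> * Q ?\<beta> = moment_const ?\<beta> * (pi * E)" "0 \<le> Q ?\<beta>"
    using Q_energy[OF \<phi> \<sigma>] unfolding E_def by auto
  have "Q ?\<beta> = moment_const ?\<beta> * pi / gauss_const ?\<beta> * E"
    using QE(1) g(2) by (simp add: field_simps)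
  then show "(LINT x|lborel. (Jl \<sigma> x)\<^sup>2) = K * E" "(LINT x|lborel. (Jr \<sigma> x)\<^sup>2) = K * E"
    unfolding K_def Jl_square[OF \<sigma>] Jr_square[OF \<sigma>] by simp_all
  define N where "N = std_normal_density 1"
  have N0: "0 \<le> N" by (simp add: N_def normal_density_nonneg)
  have "N / (2 * (1 - \<sigma>)) * (pi * E) \<le> moment_const ?\<beta> * (pi * E)"
    using m E0 unfolding N_def by (intro mult_right_mono) (simp_all add: algebra_simps)
  also have "\<dots> \<le> (4 / ?\<beta>) * Q ?\<beta>"
    unfolding QE(1)[symmetric] by (intro mult_right_mono g(3) QE(2))
  finally have "?\<beta> / 4 * (N / (2 * (1 - \<sigma>)) * (pi * E)) \<le> ?\<beta> / 4 * ((4 / ?\<beta>) * Q ?\<beta>)"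
    using \<beta> by (intro mult_left_mono) auto
  also have "\<dots> = Q ?\<beta>" using \<beta> by simp
  finally have Q: "?\<beta> / 4 * (N / (2 * (1 - \<sigma>)) * (pi * E)) \<le> Q ?\<beta>" .
  have "1 / (1 - \<sigma>) * (?\<beta> / 4 * (N / (2 * (1 - \<sigma>)) * (pi * E))) \<le> mixed_const \<sigma> * Q ?\<beta>"
    using \<sigma> mixed_const(2)[of \<sigma>] Q E0 N0 by (intro mult_mono) (auto simp: mixed_const_def)
  moreover have "N * pi / 16 * (b / q\<^sup>2) * E = 1 / q * (b / 4 * (N / (2 * q) * (pi * E))) / 2" for b q
    by (simp add: power2_eq_square)
  ultimately show "std_normal_density 1 * pi / 16 * (?\<beta> / (1 - \<sigma>)\<^sup>2) * E \<le> (LINT x|lborel. Jl \<sigma> x * Jr \<sigma> x)"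
    unfolding Jl_Jr[OF \<sigma>] N_def[symmetric] by (simp only: divide_right_mono[of _ _ 2])
qed

section \<open>Riemann-Liouville derivatives\<close>

lemma test_lipschitz:
  assumes \<phi>: "\<phi> \<in> test_functions"
  obtains B where "0 < B" "\<And>a b. \<bar>\<phi> b - \<phi> a\<bar> \<le> B * \<bar>b - a\<bar>"
proof -
  obtain B where B: "0 < B" "\<And>x. \<bar>deriv \<phi> x\<bar> \<le> B" using test_bounded[OF test_deriv[OF \<phi>]] by metis
  have "norm (\<phi> b - \<phi> a) \<le> B * norm (b - a)" for a b
    by (rule field_differentiable_bound[of UNIV \<phi> "deriv \<phi>"]) (use B(2) test_has_deriv[OF \<phi>] in auto)
  then show ?thesis using that B(1) by simp
qed

text \<open>The mean value bound is applied to \<phi> minus its linear part, on the ball around a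
  that reaches b; there the derivative differs from its value at a by at most a Lipschitz constant
  times the distance.\<close>

lemma test_Taylor:
  assumes \<phi>: "\<phi> \<in> test_functions"
  obtains B where "0 < B" "\<And>a b. \<bar>\<phi> b - \<phi> a - (b - a) * deriv \<phi> a\<bar> \<le> B * (b - a)\<^sup>2"
proof -
  obtain B where B: "0 < B" "\<And>a b. \<bar>deriv \<phi> b - deriv \<phi> a\<bar> \<le> B * \<bar>b - a\<bar>"
    using test_lipschitz[OF test_deriv[OF \<phi>]] by metis
  have "\<bar>\<phi> b - \<phi> a - (b - a) * deriv \<phi> a\<bar> \<le> B * (b - a)\<^sup>2" for a b
  proof -
    let ?f = "\<lambda>x. \<phi> x - x * deriv \<phi> a"
    have "norm (?f b - ?f a) \<le> (B * \<bar>b - a\<bar>) * norm (b - a)"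
    proof (rule field_differentiable_bound[of "cball a \<bar>b - a\<bar>" ?f "\<lambda>x. deriv \<phi> x - deriv \<phi> a"])
      fix z assume "z \<in> cball a \<bar>b - a\<bar>"
      then have "B * \<bar>z - a\<bar> \<le> B * \<bar>b - a\<bar>" using B(1) by (simp add: dist_real_def abs_minus_commute)
      then show "norm (deriv \<phi> z - deriv \<phi> a) \<le> B * \<bar>b - a\<bar>" using B(2)[of z a] by simp
      have "(?f has_real_derivative deriv \<phi> z - deriv \<phi> a) (at z)"
        using test_has_deriv[OF \<phi>, of z] by (auto intro!: derivative_eq_intros)
      then show "(?f has_real_derivative deriv \<phi> z - deriv \<phi> a) (at z within cball a \<bar>b - a\<bar>)"
        by (rule has_field_derivative_at_within)
    qed (auto simp: dist_real_def)
    then show ?thesis by (simp add: algebra_simps power2_eq_square abs_mult_self_eq flip: abs_mult)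
  qed
  then show ?thesis using that B(1) by blast
qed

text \<open>A change of variables moves the dependence on y from the singular kernel to the smooth
  factor, where it can be differentiated.\<close>

lemma rker_conv:
  assumes \<phi>: "\<phi> \<in> test_functions" and \<sigma>: "0 \<le> \<sigma>" "\<sigma> < 1"
  shows "integrable lborel (\<lambda>z. rker \<sigma> z * \<phi> (y - z))" "integrable lborel (\<lambda>z. rker \<sigma> z * \<phi> (y + z))"
    and "(LINT t|lborel. rker \<sigma> (y - t) * \<phi> t) = (LINT z|lborel. rker \<sigma> z * \<phi> (y - z))"
    and "(LINT t|lborel. rker \<sigma> (t - y) * \<phi> t) = (LINT z|lborel. rker \<sigma> z * \<phi> (y + z))"
proof -
  obtain M where "bounded_on_Omega \<phi> M" using test_bounded_on_Omega[OF \<phi>] by metis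
  then interpret bounded_on_Omega \<phi> M .
  note int = rker_mult_integrable[OF \<sigma>, of y]
  show "integrable lborel (\<lambda>z. rker \<sigma> z * \<phi> (y - z))"
    using lborel_integrable_real_affine[OF int(1), of "-1" y] by simp
  show "integrable lborel (\<lambda>z. rker \<sigma> z * \<phi> (y + z))"
    using lborel_integrable_real_affine[OF int(2), of 1 y] by simp
  show "(LINT t|lborel. rker \<sigma> (y - t) * \<phi> t) = (LINT z|lborel. rker \<sigma> z * \<phi> (y - z))"
    using lborel_integral_real_affine[of "-1" "\<lambda>t. rker \<sigma> (y - t) * \<phi> t" y] by simp
  show "(LINT t|lborel. rker \<sigma> (t - y) * \<phi> t) = (LINT z|lborel. rker \<sigma> z * \<phi> (y + z))"
    using lborel_integral_real_affine[of 1 "\<lambda>t. rker \<sigma> (t - y) * \<phi> t" y] by simp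
qed

text \<open>The bound 4 is sized for differentiating convolutions: with \<bar>y\<bar> < 2 and
  \<bar>h\<bar> < 1, a shift by z > 4 in either direction leaves the support of the test
  function.\<close>

lemma rker_integrable_bounded_interval:
  assumes \<sigma>: "0 \<le> \<sigma>" "\<sigma> < 1"
  shows "integrable lborel (\<lambda>z. rker \<sigma> z * indicator {..4} z)"
proof (rule integrableI_bounded)
  have "(\<integral>\<^sup>+z. ennreal (norm (rker \<sigma> z * indicator {..4} z)) \<partial>lborel) \<le>
     (\<integral>\<^sup>+z. ennreal (rker \<sigma> z) * indicator {..1} z + indicator {0..4} z \<partial>lborel)"
  proof (rule nn_integral_mono)
    fix z :: real
    have "ennreal (rker \<sigma> z) \<le> 1" if "1 < z"
      using rker_le_1[of \<sigma> z] that \<sigma> by (simp add: ennreal_le_1)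
    then show "ennreal (norm (rker \<sigma> z * indicator {..4} z)) \<le> ennreal (rker \<sigma> z) * indicator {..1} z + indicator {0..4} z"
      by (cases "z \<le> 1"; cases "z \<le> 4") (auto simp: rker_nonneg add_increasing2 indicator_def)
  qed
  also have "\<dots> = ennreal (1 / (1 - \<sigma>)) + 4"
    using nn_integral_rker_unit[OF \<sigma>(2)] by (subst nn_integral_add) auto
  also have "\<dots> < \<infinity>" by (simp add: ennreal_add_eq_top less_top[symmetric])
  finally show "(\<integral>\<^sup>+z. ennreal (norm (rker \<sigma> z * indicator {..4} z)) \<partial>lborel) < \<infinity>" .
qed measurable

text \<open>The Taylor remainder of \<phi> is quadratic in h uniformly in z, and integrates against
  the kernel over a bounded range. The sign c treats the left- and right-sided convolutions
  together.\<close>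

lemma conv_has_derivative:
  assumes \<phi>: "\<phi> \<in> test_functions" and \<sigma>: "0 \<le> \<sigma>" "\<sigma> < 1" and c: "c = 1 \<or> c = (- 1 :: real)" and y: "\<bar>y\<bar> < 2"
  shows "((\<lambda>y. LINT z|lborel. rker \<sigma> z * \<phi> (y + c * z)) has_real_derivative
     (LINT z|lborel. rker \<sigma> z * deriv \<phi> (y + c * z))) (at y)"
proof -
  define G where "G y = (LINT z|lborel. rker \<sigma> z * \<phi> (y + c * z))" for y
  define D where "D = (LINT z|lborel. rker \<sigma> z * deriv \<phi> (y + c * z))"
  define C where "C = (LINT z|lborel. rker \<sigma> z * indicator {..4} z)"
  obtain B where B: "0 < B" "\<And>a b. \<bar>\<phi> b - \<phi> a - (b - a) * deriv \<phi> a\<bar> \<le> B * (b - a)\<^sup>2"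
    using test_Taylor[OF \<phi>] by metis
  note d\<phi> = test_deriv[OF \<phi>]
  have int: "integrable lborel (\<lambda>z. rker \<sigma> z * \<psi> (y + c * z))" if "\<psi> \<in> test_functions" for \<psi> y
    using c rker_conv(1,2)[OF that \<sigma>, of y] by auto
  have C0: "0 \<le> C" unfolding C_def by (intro integral_nonneg_AE AE_I2) (simp add: rker_nonneg)
  have est: "\<bar>G (y + h) - G y - h * D\<bar> \<le> B * C * h\<^sup>2" if h: "\<bar>h\<bar> < 1" for h
  proof -
    let ?r = "\<lambda>z. rker \<sigma> z * \<phi> (y + h + c * z) - rker \<sigma> z * \<phi> (y + c * z) - h * (rker \<sigma> z * deriv \<phi> (y + c * z))"
    have ri: "integrable lborel ?r"
      by (intro Bochner_Integration.integrable_diff integrable_mult_right int \<phi> d\<phi>)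
    have "G (y + h) - G y - h * D = (LINT z|lborel. ?r z)"
      unfolding G_def D_def
      using int[OF \<phi>, of "y + h"] int[OF \<phi>, of y] int[OF d\<phi>, of y] by simp
    moreover have "\<bar>LINT z|lborel. ?r z\<bar> \<le> (LINT z|lborel. (B * h\<^sup>2) * (rker \<sigma> z * indicator {..4} z))"
    proof (rule order_trans[OF integral_abs_bound], rule integral_mono)
      show "integrable lborel (\<lambda>z. \<bar>?r z\<bar>)" using ri by (rule integrable_abs)
      show "integrable lborel (\<lambda>z. (B * h\<^sup>2) * (rker \<sigma> z * indicator {..4} z))"
        by (intro integrable_mult_right rker_integrable_bounded_interval \<sigma>)
      fix z :: real
      show "\<bar>?r z\<bar> \<le> (B * h\<^sup>2) * (rker \<sigma> z * indicator {..4} z)"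
      proof (cases "z \<le> 4")
        case True
        have "?r z = rker \<sigma> z * (\<phi> (y + h + c * z) - \<phi> (y + c * z) - h * deriv \<phi> (y + c * z))"
          by (simp add: algebra_simps)
        also have "\<bar>\<dots>\<bar> = rker \<sigma> z * \<bar>\<phi> (y + h + c * z) - \<phi> (y + c * z) - h * deriv \<phi> (y + c * z)\<bar>"
          by (simp add: abs_mult rker_nonneg)
        also have "\<dots> \<le> rker \<sigma> z * (B * h\<^sup>2)"
          using B(2)[where b = "y + h + c * z" and a = "y + c * z"] by (intro mult_left_mono rker_nonneg) simp
        finally show ?thesis using True by (simp add: mult.commute)
      next
        case False
        have "y + h + c * z \<notin> Omega" "y + c * z \<notin> Omega" using False c h y by (auto simp: Omega_def)
        then show ?thesis using False test_zero[OF \<phi>] test_zero[OF d\<phi>] by simp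
      qed
    qed
    moreover have "(LINT z|lborel. (B * h\<^sup>2) * (rker \<sigma> z * indicator {..4} z)) = B * C * h\<^sup>2"
      unfolding integral_mult_right_zero C_def by simp
    ultimately show ?thesis by linarith
  qed
  have "(G has_real_derivative D) (at y)"
    unfolding DERIV_def
  proof (rule LIM_zero_cancel, rule Lim_null_comparison)
    have "\<forall>\<^sub>F h in at 0. \<bar>h\<bar> < 1 \<and> h \<noteq> (0::real)"
      unfolding eventually_at by (intro exI[of _ 1]) (auto simp: dist_real_def)
    then show "\<forall>\<^sub>F h in at 0. norm ((G (y + h) - G y) / h - D) \<le> B * C * \<bar>h\<bar>"
    proof eventually_elim
      case (elim h)
      have "(G (y + h) - G y) / h - D = (G (y + h) - G y - h * D) / h" using elim by (simp add: field_simps)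
      then have "norm ((G (y + h) - G y) / h - D) = \<bar>G (y + h) - G y - h * D\<bar> / \<bar>h\<bar>" by (simp add: abs_divide)
      also have "\<dots> \<le> (B * C * h\<^sup>2) / \<bar>h\<bar>" using est[of h] elim by (intro divide_right_mono) auto
      also have "\<dots> = B * C * \<bar>h\<bar>" using elim by (simp add: power2_eq_square abs_if)
      finally show ?case .
    qed
    show "((\<lambda>h. B * C * \<bar>h\<bar>) \<longlongrightarrow> 0) (at 0)"
      by (rule tendsto_mult_right_zero) (rule tendsto_rabs_zero[OF tendsto_ident_at])
  qed
  then show ?thesis unfolding G_def D_def .
qed

text \<open>\<open>Jl\<close> for h the derivative of \<phi>, but with \<phi> as an argument, so
  that linearity in \<phi> can be stated outside the locale.\<close>

definition JL :: "real \<Rightarrow> (real \<Rightarrow> real) \<Rightarrow> real \<Rightarrow> real" where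
  "JL \<sigma> \<phi> x = (LINT t|lborel. rker \<sigma> (x - t) * deriv \<phi> t)"

definition JR :: "real \<Rightarrow> (real \<Rightarrow> real) \<Rightarrow> real \<Rightarrow> real" where
  "JR \<sigma> \<phi> x = (LINT t|lborel. rker \<sigma> (t - x) * deriv \<phi> t)"

text \<open>For test functions the Riemann-Liouville and Caputo forms coincide. The set integral
  extends to the line since \<phi> vanishes to the left of 0 and the kernel to the right of y; then
  the derivative falls on \<phi>.\<close>

lemma RL_left_eq:
  assumes \<phi>: "\<phi> \<in> test_functions" and \<sigma>: "0 \<le> \<sigma>" "\<sigma> < 1" and x: "x \<in> Omega"
  shows "RL_left \<sigma> \<phi> x = 1 / Gamma (1 - \<sigma>) * JL \<sigma> \<phi> x"
proof -
  have pt: "indicator {0..y} t *\<^sub>R ((y - t) powr (- \<sigma>) * \<phi> t) = rker \<sigma> (y - t) * \<phi> t" for y t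
    using test_zero[OF \<phi>, of t] by (auto simp: rker_def indicator_def Omega_def)
  have eq: "(LINT t:{0..y}|lborel. (y - t) powr (- \<sigma>) * \<phi> t) = (LINT z|lborel. rker \<sigma> z * \<phi> (y + (- 1) * z))" for y
    unfolding set_lebesgue_integral_def pt rker_conv(3)[OF \<phi> \<sigma>] by simp
  have x2: "\<bar>x\<bar> < 2" using x by (simp add: Omega_def)
  have D: "((\<lambda>y. LINT z|lborel. rker \<sigma> z * \<phi> (y + (- 1) * z)) has_real_derivative JL \<sigma> \<phi> x) (at x)"
    using conv_has_derivative[OF \<phi> \<sigma> _ x2, of "- 1"]
    unfolding JL_def rker_conv(3)[OF test_deriv[OF \<phi>] \<sigma>] by simp
  show ?thesis unfolding RL_left_def eq by (rule DERIV_imp_deriv[OF DERIV_cmult[OF D]])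
qed

lemma RL_right_eq:
  assumes \<phi>: "\<phi> \<in> test_functions" and \<sigma>: "0 \<le> \<sigma>" "\<sigma> < 1" and x: "x \<in> Omega"
  shows "RL_right \<sigma> \<phi> x = - (1 / Gamma (1 - \<sigma>) * JR \<sigma> \<phi> x)"
proof -
  have pt: "indicator {y..1} t *\<^sub>R ((t - y) powr (- \<sigma>) * \<phi> t) = rker \<sigma> (t - y) * \<phi> t" for y t
    using test_zero[OF \<phi>, of t] by (auto simp: rker_def indicator_def Omega_def)
  have eq: "(LINT t:{y..1}|lborel. (t - y) powr (- \<sigma>) * \<phi> t) = (LINT z|lborel. rker \<sigma> z * \<phi> (y + 1 * z))" for y
    unfolding set_lebesgue_integral_def pt rker_conv(4)[OF \<phi> \<sigma>] by simp
  have x2: "\<bar>x\<bar> < 2" using x by (simp add: Omega_def)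
  have D: "((\<lambda>y. LINT z|lborel. rker \<sigma> z * \<phi> (y + 1 * z)) has_real_derivative JR \<sigma> \<phi> x) (at x)"
    using conv_has_derivative[OF \<phi> \<sigma> _ x2, of 1]
    unfolding JR_def rker_conv(4)[OF test_deriv[OF \<phi>] \<sigma>] by simp
  show ?thesis unfolding RL_right_def eq
    by (rule arg_cong[where f=uminus]) (rule DERIV_imp_deriv[OF DERIV_cmult[OF D]])
qed

lemma deriv_test_lincomb:
  assumes "\<phi> \<in> test_functions" "\<psi> \<in> test_functions"
  shows "deriv (\<lambda>x. a * \<phi> x + b * \<psi> x) = (\<lambda>x. a * deriv \<phi> x + b * deriv \<psi> x)"
  using test_has_deriv[OF assms(1)] test_has_deriv[OF assms(2)]
  by (intro ext DERIV_imp_deriv) (auto intro!: derivative_eq_intros)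

lemma J_lincomb:
  assumes "\<phi> \<in> test_functions" "\<psi> \<in> test_functions" and \<sigma>: "0 \<le> \<sigma>" "\<sigma> < 1"
  shows "JL \<sigma> (\<lambda>x. a * \<phi> x + b * \<psi> x) x = a * JL \<sigma> \<phi> x + b * JL \<sigma> \<psi> x"
    and "JR \<sigma> (\<lambda>x. a * \<phi> x + b * \<psi> x) x = a * JR \<sigma> \<phi> x + b * JR \<sigma> \<psi> x"
proof -
  obtain M where "bounded_on_Omega (deriv \<phi>) M" using test_bounded_on_Omega[OF test_deriv[OF assms(1)]] by metis
  note A = bounded_on_Omega.rker_mult_integrable[OF this \<sigma>, of x]
  obtain M where "bounded_on_Omega (deriv \<psi>) M" using test_bounded_on_Omega[OF test_deriv[OF assms(2)]] by metis
  note B = bounded_on_Omega.rker_mult_integrable[OF this \<sigma>, of x]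
  show "JL \<sigma> (\<lambda>x. a * \<phi> x + b * \<psi> x) x = a * JL \<sigma> \<phi> x + b * JL \<sigma> \<psi> x"
    "JR \<sigma> (\<lambda>x. a * \<phi> x + b * \<psi> x) x = a * JR \<sigma> \<phi> x + b * JR \<sigma> \<psi> x"
    unfolding JL_def JR_def deriv_test_lincomb[OF assms(1,2)] distrib_left mult.left_commute[of "rker _ _"]
    using A B by simp_all
qed

lemma
  assumes "\<phi> \<in> test_functions" "\<psi> \<in> test_functions" and \<sigma>: "0 \<le> \<sigma>" "\<sigma> < 1" and x: "x \<in> Omega"
  shows RL_left_lincomb: "RL_left \<sigma> (\<lambda>x. a * \<phi> x + b * \<psi> x) x = a * RL_left \<sigma> \<phi> x + b * RL_left \<sigma> \<psi> x"
    and RL_right_lincomb: "RL_right \<sigma> (\<lambda>x. a * \<phi> x + b * \<psi> x) x = a * RL_right \<sigma> \<phi> x + b * RL_right \<sigma> \<psi> x"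
  by (simp_all add: RL_left_eq[OF _ \<sigma> x] RL_right_eq[OF _ \<sigma> x] assms(1,2) test_lincomb J_lincomb[OF assms(1-4)] add_divide_distrib)

lemma L2_norm_cong:
  assumes "\<And>x. x \<in> Omega \<Longrightarrow> f x = g x"
  shows "L2_norm f = L2_norm g"
proof -
  have "indicator Omega x *\<^sub>R (f x * f x) = indicator Omega x *\<^sub>R (g x * g x)" for x
    using assms[of x] by (cases "x \<in> Omega") auto
  then show ?thesis unfolding L2_norm_def L2_inner_def set_lebesgue_integral_def by (simp only:)
qed

text \<open>The energies are computed on the whole line while the operators map into the interval;
  restriction does not increase the norm.\<close>

lemma
  assumes [measurable]: "G \<in> borel_measurable borel" and G: "integrable lborel (\<lambda>x. (G x)\<^sup>2)"
    and eq: "\<And>x. x \<in> Omega \<Longrightarrow> f x = c * G x"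
  shows L2_Omega_of_line: "f \<in> L2_Omega"
    and L2_norm_le_line: "L2_norm f \<le> \<bar>c\<bar> * sqrt (LINT x|lborel. (G x)\<^sup>2)"
proof -
  have cG: "integrable lborel (\<lambda>x. (c * G x)\<^sup>2)" using G by (simp add: power_mult_distrib)
  have 1: "indicator Omega x *\<^sub>R f x = indicator Omega x * (c * G x)" for x
    using eq[of x] by (cases "x \<in> Omega") auto
  have 2: "indicator Omega x *\<^sub>R (f x)\<^sup>2 = indicator Omega x *\<^sub>R (c * G x)\<^sup>2" for x
    using eq[of x] by (cases "x \<in> Omega") auto
  show "f \<in> L2_Omega"
    unfolding L2_Omega_def set_borel_measurable_def set_integrable_def mem_Collect_eq 1 2
    using integrable_mult_indicator[OF Omega_sets(1) cG] by simp
  have "L2_norm f = L2_norm (\<lambda>x. c * G x)" by (rule L2_norm_cong[OF eq])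
  also have "\<dots> = sqrt (LINT x|lborel. indicator Omega x *\<^sub>R (c * G x)\<^sup>2)"
    by (simp only: L2_norm_def L2_inner_def set_lebesgue_integral_def power2_eq_square)
  also have "\<dots> \<le> sqrt (LINT x|lborel. (c * G x)\<^sup>2)"
  proof (intro real_sqrt_le_mono integral_mono cG integrable_mult_indicator[OF Omega_sets(1) cG])
    show "indicator Omega x *\<^sub>R (c * G x)\<^sup>2 \<le> (c * G x)\<^sup>2" for x by (cases "x \<in> Omega") auto
  qed
  also have "\<dots> = \<bar>c\<bar> * sqrt (LINT x|lborel. (G x)\<^sup>2)"
    by (simp add: power_mult_distrib real_sqrt_mult)
  finally show "L2_norm f \<le> \<bar>c\<bar> * sqrt (LINT x|lborel. (G x)\<^sup>2)" .
qed

lemma J_L2: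
  assumes \<phi>: "\<phi> \<in> test_functions" and \<sigma>: "1/2 < \<sigma>" "\<sigma> < 1"
  shows "JL \<sigma> \<phi> \<in> borel_measurable borel" "JR \<sigma> \<phi> \<in> borel_measurable borel"
    "integrable lborel (\<lambda>x. (JL \<sigma> \<phi> x)\<^sup>2)" "integrable lborel (\<lambda>x. (JR \<sigma> \<phi> x)\<^sup>2)"
    "JL \<sigma> \<phi> = bounded_on_Omega.Jl (deriv \<phi>) \<sigma>" "JR \<sigma> \<phi> = bounded_on_Omega.Jr (deriv \<phi>) \<sigma>"
proof -
  obtain M where "bounded_on_Omega (deriv \<phi>) M" using test_bounded_on_Omega[OF test_deriv[OF \<phi>]] by metis
  then interpret bounded_on_Omega "deriv \<phi>" M .
  show eq: "JL \<sigma> \<phi> = Jl \<sigma>" "JR \<sigma> \<phi> = Jr \<sigma>"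
    by (simp_all add: fun_eq_iff JL_def JR_def Jl_def Jr_def)
  show "JL \<sigma> \<phi> \<in> borel_measurable borel" "JR \<sigma> \<phi> \<in> borel_measurable borel"
    "integrable lborel (\<lambda>x. (JL \<sigma> \<phi> x)\<^sup>2)" "integrable lborel (\<lambda>x. (JR \<sigma> \<phi> x)\<^sup>2)"
    unfolding eq using J_measurable Jl_square_integrable[OF \<sigma>] Jr_square_integrable[OF \<sigma>] by auto
qed

lemma
  assumes \<phi>: "\<phi> \<in> test_functions" and \<sigma>: "1/2 < \<sigma>" "\<sigma> < 1"
  shows RL_left_L2: "RL_left \<sigma> \<phi> \<in> L2_Omega" and RL_right_L2: "RL_right \<sigma> \<phi> \<in> L2_Omega"
proof -
  have \<sigma>': "0 \<le> \<sigma>" using \<sigma> by simp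
  note J = J_L2[OF \<phi> \<sigma>]
  show "RL_left \<sigma> \<phi> \<in> L2_Omega"
    by (rule L2_Omega_of_line[OF J(1,3) RL_left_eq[OF \<phi> \<sigma>' \<sigma>(2)]])
  show "RL_right \<sigma> \<phi> \<in> L2_Omega"
    by (rule L2_Omega_of_line[OF J(2,4), of _ "- (1 / Gamma (1 - \<sigma>))"]) (simp add: RL_right_eq[OF \<phi> \<sigma>' \<sigma>(2)])
qed

text \<open>\<open>J_energy\<close> gives the line norms exactly and the energy is dominated by the
  Sobolev norm. The bound K may depend on \<sigma>: it serves the extension by continuity and
  disappears in the limit of the coercivity estimate.\<close>

lemma RL_bounded:
  assumes \<sigma>: "1/2 < \<sigma>" "\<sigma> < 1"
  obtains K where "0 \<le> K"
    "\<And>\<phi>. \<phi> \<in> test_functions \<Longrightarrow> L2_norm (RL_left \<sigma> \<phi>) \<le> K * H_norm \<sigma> \<phi>"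
    "\<And>\<phi>. \<phi> \<in> test_functions \<Longrightarrow> L2_norm (RL_right \<sigma> \<phi>) \<le> K * H_norm \<sigma> \<phi>"
proof -
  have \<sigma>': "0 \<le> \<sigma>" "\<sigma> \<le> 1" using \<sigma> by auto
  define k where "k = same_const \<sigma> * (moment_const (2 * \<sigma> - 1) * pi / gauss_const (2 * \<sigma> - 1))"
  define g where "g = \<bar>1 / Gamma (1 - \<sigma>)\<bar>"
  have "0 < gauss_const (2 * \<sigma> - 1)" using \<sigma> by (intro gauss_const) auto
  then have k0: "0 \<le> k" by (simp add: k_def same_const_def moment_const_def)
  have E: "sqrt (k * (LINT \<omega>|lborel. energy_density \<sigma> \<phi> \<omega>)) \<le> sqrt k * H_norm \<sigma> \<phi>" if \<phi>: "\<phi> \<in> test_functions" for \<phi>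
  proof -
    have "(LINT \<omega>|lborel. energy_density \<sigma> \<phi> \<omega>) \<le> (H_norm \<sigma> \<phi>)\<^sup>2"
      unfolding H_norm_square
      using energy_integrable[OF \<phi> \<sigma>'] test_H_Omega[OF \<phi> \<sigma>'(2)] energy_density_le[OF \<sigma>'(1)]
      by (intro integral_mono) (auto simp: H_Omega_def)
    then have "sqrt (LINT \<omega>|lborel. energy_density \<sigma> \<phi> \<omega>) \<le> sqrt ((H_norm \<sigma> \<phi>)\<^sup>2)" by (rule real_sqrt_le_mono)
    then have "sqrt (LINT \<omega>|lborel. energy_density \<sigma> \<phi> \<omega>) \<le> H_norm \<sigma> \<phi>" by (simp add: H_norm_nonneg)
    then have "sqrt k * sqrt (LINT \<omega>|lborel. energy_density \<sigma> \<phi> \<omega>) \<le> sqrt k * H_norm \<sigma> \<phi>"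
      using k0 by (intro mult_left_mono) auto
    then show ?thesis by (simp only: real_sqrt_mult)
  qed
  have L: "L2_norm (RL_left \<sigma> \<phi>) \<le> (g * sqrt k) * H_norm \<sigma> \<phi>" if \<phi>: "\<phi> \<in> test_functions" for \<phi>
  proof -
    note J = J_L2[OF \<phi> \<sigma>]
    have "L2_norm (RL_left \<sigma> \<phi>) \<le> g * sqrt (LINT x|lborel. (JL \<sigma> \<phi> x)\<^sup>2)"
      unfolding g_def by (rule L2_norm_le_line[OF J(1,3) RL_left_eq[OF \<phi> \<sigma>'(1) \<sigma>(2)]])
    also have "\<dots> = g * sqrt (k * (LINT \<omega>|lborel. energy_density \<sigma> \<phi> \<omega>))"
      unfolding J(5) J_energy(1)[OF \<phi> \<sigma>] k_def ..
    also have "\<dots> \<le> g * (sqrt k * H_norm \<sigma> \<phi>)" by (intro mult_left_mono E \<phi>) (simp add: g_def)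
    finally show ?thesis by (simp only: mult.assoc)
  qed
  have R: "L2_norm (RL_right \<sigma> \<phi>) \<le> (g * sqrt k) * H_norm \<sigma> \<phi>" if \<phi>: "\<phi> \<in> test_functions" for \<phi>
  proof -
    note J = J_L2[OF \<phi> \<sigma>]
    have "L2_norm (RL_right \<sigma> \<phi>) \<le> \<bar>- (1 / Gamma (1 - \<sigma>))\<bar> * sqrt (LINT x|lborel. (JR \<sigma> \<phi> x)\<^sup>2)"
      by (rule L2_norm_le_line[OF J(2,4)]) (simp add: RL_right_eq[OF \<phi> \<sigma>'(1) \<sigma>(2)])
    also have "\<dots> = g * sqrt (k * (LINT \<omega>|lborel. energy_density \<sigma> \<phi> \<omega>))"
      unfolding J(6) J_energy(2)[OF \<phi> \<sigma>] k_def g_def by simp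
    also have "\<dots> \<le> g * (sqrt k * H_norm \<sigma> \<phi>)" by (intro mult_left_mono E \<phi>) (simp add: g_def)
    finally show ?thesis by (simp only: mult.assoc)
  qed
  have "0 \<le> g * sqrt k" using k0 by (simp add: g_def)
  then show ?thesis using L R by (rule that)
qed

lemma
  assumes "\<phi> \<in> test_functions" "\<psi> \<in> test_functions" and \<sigma>: "1/2 < \<sigma>" "\<sigma> < 1"
  shows RL_left_diff: "L2_norm (\<lambda>x. RL_left \<sigma> \<phi> x - RL_left \<sigma> \<psi> x) = L2_norm (RL_left \<sigma> (\<lambda>x. \<phi> x - \<psi> x))"
    and RL_right_diff: "L2_norm (\<lambda>x. RL_right \<sigma> \<phi> x - RL_right \<sigma> \<psi> x) = L2_norm (RL_right \<sigma> (\<lambda>x. \<phi> x - \<psi> x))"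
proof -
  have \<sigma>': "0 \<le> \<sigma>" using \<sigma> by simp
  note L = RL_left_lincomb[OF assms(1,2) \<sigma>' \<sigma>(2), of _ 1 "-1"]
  note R = RL_right_lincomb[OF assms(1,2) \<sigma>' \<sigma>(2), of _ 1 "-1"]
  show "L2_norm (\<lambda>x. RL_left \<sigma> \<phi> x - RL_left \<sigma> \<psi> x) = L2_norm (RL_left \<sigma> (\<lambda>x. \<phi> x - \<psi> x))"
    by (rule L2_norm_cong) (use L in simp)
  show "L2_norm (\<lambda>x. RL_right \<sigma> \<phi> x - RL_right \<sigma> \<psi> x) = L2_norm (RL_right \<sigma> (\<lambda>x. \<phi> x - \<psi> x))"
    by (rule L2_norm_cong) (use R in simp)
qed

section \<open>Coercivity on test functions with a constant uniform in the order\<close>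

lemma Gamma_bound: obtains g where "0 < g" "\<And>x::real. x \<in> {1..2} \<Longrightarrow> Gamma x \<le> g"
proof -
  have "continuous_on {1..2::real} Gamma"
    by (intro continuous_on_Gamma continuous_on_id) (auto simp: nonpos_Ints_def)
  then have "compact (Gamma ` {1..2::real})" by (rule compact_continuous_image) (rule compact_Icc)
  then have "bounded (Gamma ` {1..2::real})" by (rule compact_imp_bounded)
  then obtain M where M: "\<forall>y\<in>Gamma ` {1..2::real}. norm y \<le> M" unfolding bounded_iff ..
  have "Gamma x \<le> max M 1" if "x \<in> {1..2}" for x :: real
    using M[rule_format, OF imageI[OF that]] by simp
  then show ?thesis by (intro that[of "max M 1"]) auto
qed

text \<open>The identity (1 - \<sigma>) Gamma(1 - \<sigma>) = Gamma(2 - \<sigma>), bounded for the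
  orders in question, shows that the Gamma factors cancel the growth (1 - \<sigma>)^-2 of
  \<open>J_coercive\<close>. Hence \<kappa> is independent of \<sigma>. The 6 in it is the constant
  of the Poincare inequality.\<close>

lemma RL_coercive:
  obtains \<kappa> where "0 < \<kappa>"
    "\<And>\<sigma> \<phi>. 1/2 < \<sigma> \<Longrightarrow> \<sigma> < 1 \<Longrightarrow> \<phi> \<in> test_functions \<Longrightarrow>
       \<kappa> * (2 * \<sigma> - 1) * (H_norm \<sigma> \<phi>)\<^sup>2 \<le> - L2_inner (RL_left \<sigma> \<phi>) (RL_right \<sigma> \<phi>)"
proof -
  obtain g where g: "0 < g" "\<And>x::real. x \<in> {1..2} \<Longrightarrow> Gamma x \<le> g" using Gamma_bound by metis
  define N where "N = std_normal_density 1 * pi / 16"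
  have N: "0 < N" by (simp add: N_def std_normal_density_def)
  define \<kappa> where "\<kappa> = N / (6 * g\<^sup>2)"
  have \<kappa>: "0 < \<kappa>" using N g(1) by (simp add: \<kappa>_def)
  have main: "\<kappa> * (2 * \<sigma> - 1) * (H_norm \<sigma> \<phi>)\<^sup>2 \<le> - L2_inner (RL_left \<sigma> \<phi>) (RL_right \<sigma> \<phi>)"
    if \<sigma>: "1/2 < \<sigma>" "\<sigma> < 1" and \<phi>: "\<phi> \<in> test_functions" for \<sigma> \<phi>
  proof -
    have \<sigma>': "0 \<le> \<sigma>" "\<sigma> \<le> 1" using \<sigma> by auto
    note J = J_L2[OF \<phi> \<sigma>]
    define E where "E = (LINT \<omega>|lborel. energy_density \<sigma> \<phi> \<omega>)"
    define G where "G = Gamma (1 - \<sigma>)"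
    have G0: "0 < G" unfolding G_def using \<sigma> by (intro Gamma_real_pos) simp
    have "(1 - \<sigma>) * G = Gamma (1 - \<sigma> + 1)"
      unfolding G_def using \<sigma> by (intro Gamma_plus1[symmetric]) (auto elim!: nonpos_Ints_cases)
    also have "\<dots> \<le> g" using \<sigma> by (intro g) auto
    finally have G: "(1 - \<sigma>) * G \<le> g" .
    \<comment> \<open>Each factor alone has a tail outside the interval, but the left one vanishes
      up to 0 and the right one from 1 on. So the inner product over the interval is the integral
      over the line.\<close>
    have supp: "JL \<sigma> \<phi> x * JR \<sigma> \<phi> x = 0" if "x \<notin> Omega" for x
    proof (cases "x \<le> 0")
      case True
      have "rker \<sigma> (x - t) * deriv \<phi> t = 0" for t
        using True test_zero[OF test_deriv[OF \<phi>], of t] by (cases "t \<in> Omega") (auto simp: rker_def Omega_def)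
      then have "JL \<sigma> \<phi> x = (LINT t|(lborel :: real measure). 0)" unfolding JL_def by (simp only:)
      then show ?thesis by simp
    next
      case False
      then have "1 \<le> x" using that by (simp add: Omega_def)
      then have "rker \<sigma> (t - x) * deriv \<phi> t = 0" for t
        using test_zero[OF test_deriv[OF \<phi>], of t] by (cases "t \<in> Omega") (auto simp: rker_def Omega_def)
      then have "JR \<sigma> \<phi> x = (LINT t|(lborel :: real measure). 0)" unfolding JR_def by (simp only:)
      then show ?thesis by simp
    qed
    have pt: "indicator Omega x *\<^sub>R (RL_left \<sigma> \<phi> x * RL_right \<sigma> \<phi> x) = - (1 / G\<^sup>2) * (JL \<sigma> \<phi> x * JR \<sigma> \<phi> x)" for x
    proof (cases "x \<in> Omega")
      case True
      then show ?thesis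
        unfolding RL_left_eq[OF \<phi> \<sigma>'(1) \<sigma>(2) True] RL_right_eq[OF \<phi> \<sigma>'(1) \<sigma>(2) True]
        by (simp add: G_def power2_eq_square)
    next
      case False
      then show ?thesis using supp[OF False] by simp
    qed
    have inner: "- L2_inner (RL_left \<sigma> \<phi>) (RL_right \<sigma> \<phi>) = (1 / G\<^sup>2) * (LINT x|lborel. JL \<sigma> \<phi> x * JR \<sigma> \<phi> x)"
      unfolding L2_inner_def set_lebesgue_integral_def pt integral_mult_right_zero by simp
    have "(H_norm \<sigma> \<phi>)\<^sup>2 \<le> 6 * E" unfolding E_def by (rule H_norm_le_energy[OF \<phi> \<sigma>'])
    then have "\<kappa> * (2 * \<sigma> - 1) * (H_norm \<sigma> \<phi>)\<^sup>2 \<le> \<kappa> * (2 * \<sigma> - 1) * (6 * E)"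
      using \<kappa> \<sigma> by (intro mult_left_mono) auto
    also have "\<dots> = (1 / g\<^sup>2) * (N * (2 * \<sigma> - 1) * E)" by (simp add: \<kappa>_def)
    also have "\<dots> \<le> (1 / ((1 - \<sigma>) * G)\<^sup>2) * (N * (2 * \<sigma> - 1) * E)"
    proof (intro mult_right_mono divide_left_mono power_mono G)
      have "0 \<le> E" unfolding E_def by (intro integral_nonneg_AE AE_I2) (simp add: energy_density_def)
      then show "0 \<le> N * (2 * \<sigma> - 1) * E" using N \<sigma> by simp
      show "0 \<le> (1 - \<sigma>) * G" using G0 \<sigma> by simp
      show "0 < g\<^sup>2 * ((1 - \<sigma>) * G)\<^sup>2" using G0 \<sigma> g(1) by simp
    qed simp
    also have "\<dots> = (1 / G\<^sup>2) * (N * ((2 * \<sigma> - 1) / (1 - \<sigma>)\<^sup>2) * E)" by (simp add: power_mult_distrib mult_ac)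
    also have "\<dots> \<le> (1 / G\<^sup>2) * (LINT x|lborel. JL \<sigma> \<phi> x * JR \<sigma> \<phi> x)"
      unfolding J(5,6) E_def N_def using J_coercive[OF \<phi> \<sigma>] by (intro mult_left_mono) auto
    finally show ?thesis unfolding inner .
  qed
  from \<kappa> main show ?thesis by (rule that)
qed

section \<open>The variational problem\<close>

text \<open>Common setting for the left and right derivatives. Linearity is built into the Lipschitz
  estimate \<open>T_diff\<close>, the form in which it is used for extending by continuity.\<close>

locale L2_bounded_operator =
  fixes \<sigma> :: real and T :: "(real \<Rightarrow> real) \<Rightarrow> real \<Rightarrow> real" and K :: real
  assumes \<sigma>_le_1: "\<sigma> \<le> 1"
    and T_L2: "\<phi> \<in> test_functions \<Longrightarrow> T \<phi> \<in> L2_Omega"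
    and T_diff: "\<phi> \<in> test_functions \<Longrightarrow> \<psi> \<in> test_functions \<Longrightarrow>
      L2_norm (\<lambda>x. T \<phi> x - T \<psi> x) \<le> K * H_norm \<sigma> (\<lambda>x. \<phi> x - \<psi> x)"
    and K_nonneg: "0 \<le> K"
begin

lemma L2_dist_le:
  assumes "u \<in> H_Omega \<sigma>" "\<phi> \<in> test_functions" "\<psi> \<in> test_functions"
  shows "L2_norm (\<lambda>x. T \<phi> x - T \<psi> x) \<le> K * (H_norm \<sigma> (\<lambda>x. \<phi> x - u x) + H_norm \<sigma> (\<lambda>x. \<psi> x - u x))"
proof -
  note t = test_H_Omega[OF assms(2) \<sigma>_le_1] test_H_Omega[OF assms(3) \<sigma>_le_1]
  have "H_norm \<sigma> (\<lambda>x. \<phi> x - \<psi> x) \<le> H_norm \<sigma> (\<lambda>x. \<phi> x - u x) + H_norm \<sigma> (\<lambda>x. \<psi> x - u x)"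
    using H_norm_diff_triangle[OF t(1) assms(1) t(2)] H_norm_diff_commute[OF assms(1) t(2)] by simp
  then have "K * H_norm \<sigma> (\<lambda>x. \<phi> x - \<psi> x) \<le> K * (H_norm \<sigma> (\<lambda>x. \<phi> x - u x) + H_norm \<sigma> (\<lambda>x. \<psi> x - u x))"
    using K_nonneg by (rule mult_left_mono)
  then show ?thesis using T_diff[OF assms(2,3)] by linarith
qed

text \<open>Images of an approximating sequence are Cauchy and L2(0,1) is complete. This justifies
  the choice in \<open>L2_extension\<close>.\<close>

lemma L2_extension_exists:
  assumes u: "u \<in> H_tilde \<sigma>"
  shows "\<exists>g. g \<in> L2_Omega \<and> (\<exists>\<phi>. (\<forall>k::nat. \<phi> k \<in> test_functions) \<and>
    (\<lambda>k. H_norm \<sigma> (\<lambda>x. \<phi> k x - u x)) \<longlonglongrightarrow> 0 \<and> (\<lambda>k. L2_norm (\<lambda>x. T (\<phi> k) x - g x)) \<longlonglongrightarrow> 0)"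
proof -
  note uO = H_tilde_H_Omega[OF u]
  obtain \<phi> where \<phi>: "\<And>k::nat. \<phi> k \<in> test_functions" "(\<lambda>k. H_norm \<sigma> (\<lambda>x. \<phi> k x - u x)) \<longlonglongrightarrow> 0"
    using H_tilde_approx[OF u] by metis
  have lim: "(\<lambda>k. K * H_norm \<sigma> (\<lambda>x. \<phi> k x - u x)) \<longlonglongrightarrow> 0"
    by (rule tendsto_mult_right_zero[OF \<phi>(2)])
  have Cauchy: "\<exists>N. \<forall>i\<ge>N. \<forall>j\<ge>N. L2_norm (\<lambda>x. T (\<phi> i) x - T (\<phi> j) x) < e" if "0 < e" for e
  proof -
    have "0 < e / 2" using that by simp
    from LIMSEQ_D[OF lim this] obtain N
      where N: "\<forall>k\<ge>N. norm (K * H_norm \<sigma> (\<lambda>x. \<phi> k x - u x) - 0) < e / 2" ..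
    have "L2_norm (\<lambda>x. T (\<phi> i) x - T (\<phi> j) x) < e" if "i \<ge> N" "j \<ge> N" for i j
      using L2_dist_le[OF uO \<phi>(1)[of i] \<phi>(1)[of j]] N[rule_format, OF that(1)] N[rule_format, OF that(2)]
      unfolding distrib_left real_norm_def by linarith
    then show ?thesis by blast
  qed
  show ?thesis
  proof (rule L2_Omega_complete[of "\<lambda>k. T (\<phi> k)"])
    show "T (\<phi> k) \<in> L2_Omega" for k by (rule T_L2[OF \<phi>(1)])
    show "\<exists>N. \<forall>i\<ge>N. \<forall>j\<ge>N. L2_norm (\<lambda>x. T (\<phi> i) x - T (\<phi> j) x) < e" if "0 < e" for e
      by (rule Cauchy[OF that])
    fix G assume "G \<in> L2_Omega" "(\<lambda>k. L2_norm (\<lambda>x. T (\<phi> k) x - G x)) \<longlonglongrightarrow> 0"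
    then show ?thesis by (intro exI[of _ G] exI[of _ \<phi>] conjI allI \<phi>)
  qed
qed

lemma L2_extension_L2: "u \<in> H_tilde \<sigma> \<Longrightarrow> L2_extension \<sigma> T u \<in> L2_Omega"
  unfolding L2_extension_def by (rule conjunct1[OF someI_ex[OF L2_extension_exists]])

text \<open>The chosen value comes with some approximating sequence; any other one has images at
  vanishing distance from it, so the same limit is reached along every sequence.\<close>

lemma L2_extension_limit:
  assumes u: "u \<in> H_tilde \<sigma>" and \<psi>: "\<And>k::nat. \<psi> k \<in> test_functions" "(\<lambda>k. H_norm \<sigma> (\<lambda>x. \<psi> k x - u x)) \<longlonglongrightarrow> 0"
  shows "(\<lambda>k. L2_norm (\<lambda>x. T (\<psi> k) x - L2_extension \<sigma> T u x)) \<longlonglongrightarrow> 0"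
proof -
  note uO = H_tilde_H_Omega[OF u]
  have "\<exists>\<phi>. (\<forall>k::nat. \<phi> k \<in> test_functions) \<and> (\<lambda>k. H_norm \<sigma> (\<lambda>x. \<phi> k x - u x)) \<longlonglongrightarrow> 0 \<and>
     (\<lambda>k. L2_norm (\<lambda>x. T (\<phi> k) x - L2_extension \<sigma> T u x)) \<longlonglongrightarrow> 0"
    unfolding L2_extension_def by (rule conjunct2[OF someI_ex[OF L2_extension_exists[OF u]]])
  then obtain \<phi> where \<phi>: "\<And>k::nat. \<phi> k \<in> test_functions" "(\<lambda>k. H_norm \<sigma> (\<lambda>x. \<phi> k x - u x)) \<longlonglongrightarrow> 0"
    "(\<lambda>k. L2_norm (\<lambda>x. T (\<phi> k) x - L2_extension \<sigma> T u x)) \<longlonglongrightarrow> 0" by blast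
  let ?b = "\<lambda>k. K * (H_norm \<sigma> (\<lambda>x. \<psi> k x - u x) + H_norm \<sigma> (\<lambda>x. \<phi> k x - u x)) + L2_norm (\<lambda>x. T (\<phi> k) x - L2_extension \<sigma> T u x)"
  have "?b \<longlonglongrightarrow> K * (0 + 0) + 0" by (intro tendsto_intros \<phi> \<psi>)
  then have b: "?b \<longlonglongrightarrow> 0" by simp
  have le: "L2_norm (\<lambda>x. T (\<psi> k) x - L2_extension \<sigma> T u x) \<le> ?b k" for k
  proof -
    have "L2_norm (\<lambda>x. (T (\<psi> k) x - T (\<phi> k) x) + (T (\<phi> k) x - L2_extension \<sigma> T u x)) \<le>
      L2_norm (\<lambda>x. T (\<psi> k) x - T (\<phi> k) x) + L2_norm (\<lambda>x. T (\<phi> k) x - L2_extension \<sigma> T u x)"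
      by (intro L2_norm_triangle L2_diff T_L2 \<phi> \<psi> L2_extension_L2 u)
    then show ?thesis using L2_dist_le[OF uO \<psi>(1)[of k] \<phi>(1)[of k]] by simp
  qed
  show ?thesis
    by (rule tendsto_sandwich[OF always_eventually always_eventually tendsto_const b])
      (use L2_norm_nonneg le in auto)
qed

lemma L2_extension_test:
  assumes "\<phi> \<in> test_functions"
  shows "L2_norm (\<lambda>x. T \<phi> x - L2_extension \<sigma> T \<phi> x) = 0"
proof -
  have "(\<lambda>k::nat. L2_norm (\<lambda>x. T \<phi> x - L2_extension \<sigma> T \<phi> x)) \<longlonglongrightarrow> 0"
    by (rule L2_extension_limit[OF test_H_tilde[OF assms \<sigma>_le_1]]) (simp_all add: assms H_norm_zero)
  then show ?thesis by (simp add: LIMSEQ_const_iff)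
qed

end

text \<open>The extension is determined only up to null sets, so agreement with the operator on test
  functions is expressed through inner products.\<close>

lemma L2_inner_eq_of_norm_zero:
  assumes "f \<in> L2_Omega" "g \<in> L2_Omega" "h \<in> L2_Omega" "L2_norm (\<lambda>x. g x - h x) = 0"
  shows "L2_inner f g = L2_inner f h"
proof -
  have "\<bar>L2_inner (\<lambda>x. 1 * g x + (-1) * h x) f\<bar> \<le> L2_norm (\<lambda>x. 1 * g x + (-1) * h x) * L2_norm f"
    by (intro L2_inner_bound L2_lincomb assms)
  also have "\<dots> = 0" using assms(4) by simp
  finally have "L2_inner (\<lambda>x. 1 * g x + (-1) * h x) f = 0" by simp
  then have "L2_inner g f = L2_inner h f" using L2_inner_lincomb[OF assms(2,3,1), of 1 "-1"] by simp
  then show ?thesis by (simp only: L2_inner_commute)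
qed

section \<open>The bilinear form on the closure of the test functions\<close>

locale fractional_order =
  fixes \<sigma> :: real
  assumes \<sigma>: "1/2 < \<sigma>" "\<sigma> < 1"
begin

text \<open>Chosen once so that the same constant can be handed to both sublocales as a
  parameter.\<close>

definition K where
  "K = (SOME K. 0 \<le> K \<and> (\<forall>\<phi>\<in>test_functions. L2_norm (RL_left \<sigma> \<phi>) \<le> K * H_norm \<sigma> \<phi>) \<and>
    (\<forall>\<phi>\<in>test_functions. L2_norm (RL_right \<sigma> \<phi>) \<le> K * H_norm \<sigma> \<phi>))"

lemma K: "0 \<le> K" "\<phi> \<in> test_functions \<Longrightarrow> L2_norm (RL_left \<sigma> \<phi>) \<le> K * H_norm \<sigma> \<phi>"
  "\<phi> \<in> test_functions \<Longrightarrow> L2_norm (RL_right \<sigma> \<phi>) \<le> K * H_norm \<sigma> \<phi>"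
proof -
  have "\<exists>K. 0 \<le> K \<and> (\<forall>\<phi>\<in>test_functions. L2_norm (RL_left \<sigma> \<phi>) \<le> K * H_norm \<sigma> \<phi>) \<and>
    (\<forall>\<phi>\<in>test_functions. L2_norm (RL_right \<sigma> \<phi>) \<le> K * H_norm \<sigma> \<phi>)"
    using RL_bounded[OF \<sigma>] by metis
  from someI_ex[OF this] show "0 \<le> K" "\<phi> \<in> test_functions \<Longrightarrow> L2_norm (RL_left \<sigma> \<phi>) \<le> K * H_norm \<sigma> \<phi>"
    "\<phi> \<in> test_functions \<Longrightarrow> L2_norm (RL_right \<sigma> \<phi>) \<le> K * H_norm \<sigma> \<phi>"
    unfolding K_def by blast+
qed

sublocale left: L2_bounded_operator \<sigma> "RL_left \<sigma>" K
proof
  show "L2_norm (\<lambda>x. RL_left \<sigma> \<phi> x - RL_left \<sigma> \<psi> x) \<le> K * H_norm \<sigma> (\<lambda>x. \<phi> x - \<psi> x)"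
    if "\<phi> \<in> test_functions" "\<psi> \<in> test_functions" for \<phi> \<psi>
    unfolding RL_left_diff[OF that \<sigma>] by (intro K test_diff that)
qed (use \<sigma> RL_left_L2[OF _ \<sigma>] K(1) in auto)

sublocale right: L2_bounded_operator \<sigma> "RL_right \<sigma>" K
proof
  show "L2_norm (\<lambda>x. RL_right \<sigma> \<phi> x - RL_right \<sigma> \<psi> x) \<le> K * H_norm \<sigma> (\<lambda>x. \<phi> x - \<psi> x)"
    if "\<phi> \<in> test_functions" "\<psi> \<in> test_functions" for \<phi> \<psi>
    unfolding RL_right_diff[OF that \<sigma>] by (intro K test_diff that)
qed (use \<sigma> RL_right_L2[OF _ \<sigma>] K(1) in auto)

lemma D_left_L2: "w \<in> H_tilde \<sigma> \<Longrightarrow> D_left \<sigma> w \<in> L2_Omega"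
  unfolding D_left_def by (rule left.L2_extension_L2)

lemma D_left_limit:
  assumes "w \<in> H_tilde \<sigma>" "\<And>k::nat. \<phi> k \<in> test_functions" "(\<lambda>k. H_norm \<sigma> (\<lambda>x. \<phi> k x - w x)) \<longlonglongrightarrow> 0"
  shows "(\<lambda>k. L2_norm (\<lambda>x. RL_left \<sigma> (\<phi> k) x - D_left \<sigma> w x)) \<longlonglongrightarrow> 0"
  unfolding D_left_def by (rule left.L2_extension_limit[OF assms])

lemma D_right_test:
  assumes "f \<in> L2_Omega" and \<phi>: "\<phi> \<in> test_functions"
  shows "L2_inner f (D_right \<sigma> \<phi>) = L2_inner f (RL_right \<sigma> \<phi>)"
  unfolding D_right_def
  by (rule L2_inner_eq_of_norm_zero[symmetric])
    (use assms right.T_L2 right.L2_extension_L2 right.L2_extension_test test_H_tilde right.\<sigma>_le_1 in auto)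

lemma D_left_inner_limit:
  assumes w: "w \<in> H_tilde \<sigma>" and \<phi>: "\<And>k::nat. \<phi> k \<in> test_functions" "(\<lambda>k. H_norm \<sigma> (\<lambda>x. \<phi> k x - w x)) \<longlonglongrightarrow> 0"
    and h: "h \<in> L2_Omega"
  shows "(\<lambda>k. L2_inner (RL_left \<sigma> (\<phi> k)) h) \<longlonglongrightarrow> L2_inner (D_left \<sigma> w) h"
proof (rule LIM_zero_cancel, rule Lim_null_comparison)
  let ?d = "\<lambda>k x. RL_left \<sigma> (\<phi> k) x - D_left \<sigma> w x"
  have eq: "L2_inner (RL_left \<sigma> (\<phi> k)) h - L2_inner (D_left \<sigma> w) h = L2_inner (?d k) h" for k
    using L2_inner_lincomb[OF left.T_L2[OF \<phi>(1)[of k]] D_left_L2[OF w] h, of 1 "-1"] by simp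
  have "\<bar>L2_inner (?d k) h\<bar> \<le> L2_norm (?d k) * L2_norm h" for k
    by (intro L2_inner_bound L2_diff left.T_L2 \<phi> D_left_L2 w h)
  then show "\<forall>\<^sub>F k in sequentially. norm (L2_inner (RL_left \<sigma> (\<phi> k)) h - L2_inner (D_left \<sigma> w) h) \<le> L2_norm (?d k) * L2_norm h"
    unfolding eq by (intro always_eventually allI) simp
  show "(\<lambda>k. L2_norm (?d k) * L2_norm h) \<longlonglongrightarrow> 0"
    by (rule tendsto_mult_left_zero[OF D_left_limit[OF w \<phi>]])
qed

text \<open>The representatives are picked independently for each argument and need not add up
  pointwise. Linearity is therefore stated after pairing with a fixed function, where it follows
  from uniqueness of limits.\<close>

lemma D_left_inner_lincomb:
  assumes v: "v \<in> H_tilde \<sigma>" and w: "w \<in> H_tilde \<sigma>" and h: "h \<in> L2_Omega"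
  shows "L2_inner (D_left \<sigma> (\<lambda>x. a * v x + b * w x)) h = a * L2_inner (D_left \<sigma> v) h + b * L2_inner (D_left \<sigma> w) h"
proof -
  obtain \<phi> where \<phi>: "\<And>k::nat. \<phi> k \<in> test_functions" "(\<lambda>k. H_norm \<sigma> (\<lambda>x. \<phi> k x - v x)) \<longlonglongrightarrow> 0"
    using H_tilde_approx[OF v] by metis
  obtain \<psi> where \<psi>: "\<And>k::nat. \<psi> k \<in> test_functions" "(\<lambda>k. H_norm \<sigma> (\<lambda>x. \<psi> k x - w x)) \<longlonglongrightarrow> 0"
    using H_tilde_approx[OF w] by metis
  have \<sigma>': "0 \<le> \<sigma>" using \<sigma> by simp
  have cong: "L2_inner (RL_left \<sigma> (\<lambda>x. a * \<phi> k x + b * \<psi> k x)) h = a * L2_inner (RL_left \<sigma> (\<phi> k)) h + b * L2_inner (RL_left \<sigma> (\<psi> k)) h" for k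
  proof -
    have "indicator Omega x *\<^sub>R (RL_left \<sigma> (\<lambda>x. a * \<phi> k x + b * \<psi> k x) x * h x) =
       indicator Omega x *\<^sub>R ((a * RL_left \<sigma> (\<phi> k) x + b * RL_left \<sigma> (\<psi> k) x) * h x)" for x
      using RL_left_lincomb[OF \<phi>(1)[of k] \<psi>(1)[of k] \<sigma>' \<sigma>(2), of x a b] by (cases "x \<in> Omega") auto
    then have "L2_inner (RL_left \<sigma> (\<lambda>x. a * \<phi> k x + b * \<psi> k x)) h = L2_inner (\<lambda>x. a * RL_left \<sigma> (\<phi> k) x + b * RL_left \<sigma> (\<psi> k) x) h"
      unfolding L2_inner_def set_lebesgue_integral_def by (simp only:)
    then show ?thesis using L2_inner_lincomb[OF left.T_L2[OF \<phi>(1)] left.T_L2[OF \<psi>(1)] h] by simp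
  qed
  have "(\<lambda>k. L2_inner (RL_left \<sigma> (\<lambda>x. a * \<phi> k x + b * \<psi> k x)) h) \<longlonglongrightarrow> L2_inner (D_left \<sigma> (\<lambda>x. a * v x + b * w x)) h"
    by (rule D_left_inner_limit[OF H_tilde_lincomb[OF left.\<sigma>_le_1 v w] test_lincomb[OF \<phi>(1) \<psi>(1)]
        approx_lincomb[OF left.\<sigma>_le_1 H_tilde_H_Omega[OF v] H_tilde_H_Omega[OF w] \<phi> \<psi>] h])
  moreover have "(\<lambda>k. L2_inner (RL_left \<sigma> (\<lambda>x. a * \<phi> k x + b * \<psi> k x)) h) \<longlonglongrightarrow> a * L2_inner (D_left \<sigma> v) h + b * L2_inner (D_left \<sigma> w) h"
    unfolding cong by (intro tendsto_intros D_left_inner_limit v w \<phi> \<psi> h)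
  ultimately show ?thesis by (rule LIMSEQ_unique)
qed

definition form :: "real \<Rightarrow> (real \<Rightarrow> real) \<Rightarrow> (real \<Rightarrow> real) \<Rightarrow> real" where
  "form \<mu> w v = - L2_inner (D_left \<sigma> w) (D_right \<sigma> v) + \<mu> * L2_inner w v"

lemma form_lincomb:
  assumes "v \<in> H_tilde \<sigma>" "w \<in> H_tilde \<sigma>" "\<phi> \<in> test_functions"
  shows "form \<mu> (\<lambda>x. a * v x + b * w x) \<phi> = a * form \<mu> v \<phi> + b * form \<mu> w \<phi>"
proof -
  note h = right.L2_extension_L2[OF test_H_tilde[OF assms(3) right.\<sigma>_le_1], folded D_right_def]
  note L = H_Omega_L2_Omega[OF H_tilde_H_Omega]
  show ?thesis
    unfolding form_def D_left_inner_lincomb[OF assms(1,2) h]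
      L2_inner_lincomb[OF L[OF assms(1)] L[OF assms(2)] L[OF test_H_tilde[OF assms(3) right.\<sigma>_le_1]]]
    by (simp add: algebra_simps)
qed

lemma form_shift: "form \<mu> w v = form \<nu> w v + (\<mu> - \<nu>) * L2_inner w v"
  by (simp add: form_def algebra_simps)

text \<open>The equation is tested with approximations of w instead of w itself. Then the right
  derivative acts on test functions only, the coercivity of test functions applies directly, and
  continuity is required of the left derivative alone. The zero-order term has a favourable sign
  because \<mu> \<ge> 0.\<close>

lemma form_coercive:
  assumes \<gamma>: "0 < \<gamma>" "\<And>\<phi>. \<phi> \<in> test_functions \<Longrightarrow> \<gamma> * (H_norm \<sigma> \<phi>)\<^sup>2 \<le> - L2_inner (RL_left \<sigma> \<phi>) (RL_right \<sigma> \<phi>)"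
    and w: "w \<in> H_tilde \<sigma>" and p: "p \<in> H_tilde \<sigma>" and \<mu>: "0 \<le> \<mu>"
    and eq: "\<And>\<phi>. \<phi> \<in> test_functions \<Longrightarrow> form \<mu> w \<phi> = - L2_inner p \<phi>"
  shows "\<gamma> * H_norm \<sigma> w \<le> H_norm \<sigma> p"
proof -
  have \<sigma>': "0 \<le> \<sigma>" "\<sigma> \<le> 1" using \<sigma> by auto
  note wO = H_tilde_H_Omega[OF w] and pO = H_tilde_H_Omega[OF p]
  obtain \<phi> where \<phi>: "\<And>k::nat. \<phi> k \<in> test_functions" "(\<lambda>k. H_norm \<sigma> (\<lambda>x. \<phi> k x - w x)) \<longlonglongrightarrow> 0"
    using H_tilde_approx[OF w] by metis
  define d where "d k = L2_norm (\<lambda>x. RL_left \<sigma> (\<phi> k) x - D_left \<sigma> w x)" for k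
  define e where "e k = H_norm \<sigma> (\<lambda>x. \<phi> k x - w x)" for k
  define N where "N k = H_norm \<sigma> (\<phi> k)" for k
  have d: "d \<longlonglongrightarrow> 0" unfolding d_def by (rule D_left_limit[OF w \<phi>])
  have e: "e \<longlonglongrightarrow> 0" unfolding e_def by (rule \<phi>(2))
  note \<phi>O = test_H_Omega[OF \<phi>(1) \<sigma>'(2)]
  have N: "N \<longlonglongrightarrow> H_norm \<sigma> w"
  proof (rule LIM_zero_cancel, rule Lim_null_comparison[OF always_eventually e], rule allI)
    fix k
    show "norm (N k - H_norm \<sigma> w) \<le> e k"
      using H_norm_le_add[OF \<phi>O[of k] wO] H_norm_le_add[OF wO \<phi>O[of k]] H_norm_diff_commute[OF wO \<phi>O[of k]]
      unfolding N_def e_def real_norm_def by linarith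
  qed
  \<comment> \<open>The error \<open>K * d k\<close> comes from replacing the left derivative of the
    approximation by that of w. The error \<open>\<mu> * e k\<close> comes from comparing (w,
    \<phi>) with the nonnegative (\<phi>, \<phi>).\<close>
  have est: "\<gamma> * (N k)\<^sup>2 \<le> (H_norm \<sigma> p + \<mu> * e k + K * d k) * N k" for k
  proof -
    note Lk = left.T_L2[OF \<phi>(1)[of k]] and Rk = right.T_L2[OF \<phi>(1)[of k]] and Dw = D_left_L2[OF w]
    have N0: "0 \<le> N k" unfolding N_def by (rule H_norm_nonneg)
    have 1: "\<gamma> * (N k)\<^sup>2 \<le> - L2_inner (RL_left \<sigma> (\<phi> k)) (RL_right \<sigma> (\<phi> k))"
      unfolding N_def by (rule \<gamma>(2)[OF \<phi>(1)])
    have 2: "L2_inner (RL_left \<sigma> (\<phi> k)) (RL_right \<sigma> (\<phi> k)) - L2_inner (D_left \<sigma> w) (RL_right \<sigma> (\<phi> k)) =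
      L2_inner (\<lambda>x. RL_left \<sigma> (\<phi> k) x - D_left \<sigma> w x) (RL_right \<sigma> (\<phi> k))"
      using L2_inner_lincomb[OF Lk Dw Rk, of 1 "-1"] by simp
    have "\<bar>L2_inner (\<lambda>x. RL_left \<sigma> (\<phi> k) x - D_left \<sigma> w x) (RL_right \<sigma> (\<phi> k))\<bar> \<le> d k * L2_norm (RL_right \<sigma> (\<phi> k))"
      unfolding d_def by (intro L2_inner_bound L2_diff Lk Dw Rk)
    also have "\<dots> \<le> d k * (K * N k)"
      unfolding N_def by (intro mult_left_mono K \<phi>) (simp add: d_def L2_norm_nonneg)
    finally have 3: "\<bar>L2_inner (\<lambda>x. RL_left \<sigma> (\<phi> k) x - D_left \<sigma> w x) (RL_right \<sigma> (\<phi> k))\<bar> \<le> K * d k * N k"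
      by (simp add: mult_ac)
    have 4: "- L2_inner (D_left \<sigma> w) (RL_right \<sigma> (\<phi> k)) = - L2_inner p (\<phi> k) - \<mu> * L2_inner w (\<phi> k)"
      using eq[OF \<phi>(1)[of k]] unfolding form_def D_right_test[OF Dw \<phi>(1)[of k]] by simp
    have 5: "- L2_inner p (\<phi> k) \<le> H_norm \<sigma> p * N k"
      using L2_inner_H_bound[OF pO \<phi>(1)[of k] \<sigma>'] unfolding N_def by linarith
    have "0 \<le> L2_inner (\<phi> k) (\<phi> k)"
      unfolding L2_inner_eq by (intro integral_nonneg_AE AE_I2) simp
    moreover have "L2_inner (\<phi> k) (\<phi> k) - L2_inner w (\<phi> k) = L2_inner (\<lambda>x. \<phi> k x - w x) (\<phi> k)"
      using L2_inner_lincomb[OF H_Omega_L2_Omega[OF \<phi>O[of k]] H_Omega_L2_Omega[OF wO] H_Omega_L2_Omega[OF \<phi>O[of k]], of 1 "-1"] by simp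
    moreover have "\<bar>L2_inner (\<lambda>x. \<phi> k x - w x) (\<phi> k)\<bar> \<le> e k * N k"
      unfolding e_def N_def by (intro L2_inner_H_bound H_Omega_diff \<phi>O wO \<phi>(1) \<sigma>')
    ultimately have "- L2_inner w (\<phi> k) \<le> e k * N k" by linarith
    then have "\<mu> * (- L2_inner w (\<phi> k)) \<le> \<mu> * (e k * N k)" using \<mu> by (rule mult_left_mono)
    then have 6: "- (\<mu> * L2_inner w (\<phi> k)) \<le> \<mu> * e k * N k" by (simp add: mult.assoc)
    have "\<gamma> * (N k)\<^sup>2 \<le> H_norm \<sigma> p * N k + \<mu> * e k * N k + K * d k * N k"
      using 1 2 3 4 5 6 by linarith
    then show ?thesis by (simp only: distrib_right)
  qed
  have "(\<lambda>k. \<gamma> * (N k)\<^sup>2) \<longlonglongrightarrow> \<gamma> * (H_norm \<sigma> w)\<^sup>2" by (intro tendsto_intros N)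
  moreover have "(\<lambda>k. (H_norm \<sigma> p + \<mu> * e k + K * d k) * N k) \<longlonglongrightarrow> (H_norm \<sigma> p + \<mu> * 0 + K * 0) * H_norm \<sigma> w"
    by (intro tendsto_intros N d e)
  ultimately have "\<gamma> * (H_norm \<sigma> w)\<^sup>2 \<le> (H_norm \<sigma> p + \<mu> * 0 + K * 0) * H_norm \<sigma> w"
    by (rule LIMSEQ_le) (use est in auto)
  then have main: "(\<gamma> * H_norm \<sigma> w) * H_norm \<sigma> w \<le> H_norm \<sigma> p * H_norm \<sigma> w"
    by (simp add: power2_eq_square mult.assoc)
  show ?thesis
  proof (cases "H_norm \<sigma> w = 0")
    case True
    then show ?thesis by (simp add: H_norm_nonneg)
  next
    case False
    then have "0 < H_norm \<sigma> w" using H_norm_nonneg[of \<sigma> w] by linarith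
    then show ?thesis using main by (simp only: mult_le_cancel_right_pos)
  qed
qed

end

section \<open>Divided differences of the solution map\<close>

locale parametric_problem = fractional_order +
  fixes \<gamma> \<mu>max :: real and f :: "real \<Rightarrow> real" and u :: "real \<Rightarrow> real \<Rightarrow> real"
  assumes \<gamma>_pos: "0 < \<gamma>"
    and \<gamma>_coercive: "\<phi> \<in> test_functions \<Longrightarrow> \<gamma> * (H_norm \<sigma> \<phi>)\<^sup>2 \<le> - L2_inner (RL_left \<sigma> \<phi>) (RL_right \<sigma> \<phi>)"
    and solution: "\<mu> \<in> {0..\<mu>max} \<Longrightarrow> weak_solution (2 * \<sigma>) \<mu> f (u \<mu>)"
begin

lemma u_H_tilde: "\<mu> \<in> {0..\<mu>max} \<Longrightarrow> u \<mu> \<in> H_tilde \<sigma>"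
  using solution[of \<mu>] by (simp add: weak_solution_def)

lemma u_form:
  assumes "\<mu> \<in> {0..\<mu>max}" "\<phi> \<in> test_functions"
  shows "form \<mu> (u \<mu>) \<phi> = L2_inner f \<phi>"
  using solution[OF assms(1)] test_H_tilde[OF assms(2) left.\<sigma>_le_1]
  by (simp add: weak_solution_def form_def)

text \<open>
  Newton's divided differences \<open>u[m 0, \<dots>, m (k - 1), \<mu>]\<close>. By the resolvent identity the equation
  satisfied by \<open>newton m k \<mu>\<close> has a right-hand side that does not depend on \<open>\<mu>\<close>. This replaces
  the Taylor expansion of the solution map and needs no existence theory for other data.
\<close>

fun newton :: "(nat \<Rightarrow> real) \<Rightarrow> nat \<Rightarrow> real \<Rightarrow> real \<Rightarrow> real" where
  "newton m 0 \<mu> = u \<mu>"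
| "newton m (Suc k) \<mu> = (\<lambda>x. 1 / (\<mu> - m k) * newton m k \<mu> x + (- 1 / (\<mu> - m k)) * newton m k (m k) x)"

context
  fixes m :: "nat \<Rightarrow> real"
  assumes m_range: "\<And>k. m k \<in> {0..\<mu>max}"
begin

lemma newton_H_tilde: "\<mu> \<in> {0..\<mu>max} \<Longrightarrow> newton m k \<mu> \<in> H_tilde \<sigma>"
  by (induction k arbitrary: \<mu>) (simp_all only: newton.simps u_H_tilde H_tilde_lincomb[OF left.\<sigma>_le_1] m_range)

text \<open>Both claims go through one induction. If the forms at level k agree for \<mu> and the
  node m k, they cancel in the difference quotient, and shifting the parameter from m k to \<mu>
  leaves only an L2 pairing with the divided difference at that node. This no longer mentions \<mu>,
  which is the first claim at level k + 1.\<close>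

lemma newton_form_indep:
  assumes "inj m" "\<mu> \<in> {0..\<mu>max}" "\<mu> \<notin> m ` {..<k}" "\<nu> \<in> {0..\<mu>max}" "\<nu> \<notin> m ` {..<k}" "\<phi> \<in> test_functions"
  shows "form \<mu> (newton m k \<mu>) \<phi> = form \<nu> (newton m k \<nu>) \<phi>"
    and "k = Suc j \<Longrightarrow> form \<mu> (newton m k \<mu>) \<phi> = - L2_inner (newton m j (m j)) \<phi>"
proof -
  have main: "(\<forall>\<mu> \<nu>. \<mu> \<in> {0..\<mu>max} \<longrightarrow> \<mu> \<notin> m ` {..<k} \<longrightarrow> \<nu> \<in> {0..\<mu>max} \<longrightarrow> \<nu> \<notin> m ` {..<k} \<longrightarrow>
      form \<mu> (newton m k \<mu>) \<phi> = form \<nu> (newton m k \<nu>) \<phi>) \<and>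
    (\<forall>j \<mu>. k = Suc j \<longrightarrow> \<mu> \<in> {0..\<mu>max} \<longrightarrow> \<mu> \<notin> m ` {..<k} \<longrightarrow>
      form \<mu> (newton m k \<mu>) \<phi> = - L2_inner (newton m j (m j)) \<phi>)" for k
  proof (induction k)
    case 0
    then show ?case using u_form assms(6) by simp
  next
    case (Suc k)
    have "form \<mu> (newton m (Suc k) \<mu>) \<phi> = - L2_inner (newton m k (m k)) \<phi>"
      if \<mu>: "\<mu> \<in> {0..\<mu>max}" "\<mu> \<notin> m ` {..<Suc k}" for \<mu>
    proof -
      have ne: "\<mu> - m k \<noteq> 0" and nk: "\<mu> \<notin> m ` {..<k}" using \<mu>(2) by auto
      have mk: "m k \<notin> m ` {..<k}" using \<open>inj m\<close> by (auto simp: inj_eq)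
      have ih: "form \<mu> (newton m k \<mu>) \<phi> = form (m k) (newton m k (m k)) \<phi>"
        using Suc.IH \<mu>(1) nk m_range mk by blast
      have "form \<mu> (newton m (Suc k) \<mu>) \<phi> =
        1 / (\<mu> - m k) * form \<mu> (newton m k \<mu>) \<phi> + (- 1 / (\<mu> - m k)) * form \<mu> (newton m k (m k)) \<phi>"
        unfolding newton.simps by (intro form_lincomb newton_H_tilde \<mu> m_range assms(6))
      also have "form \<mu> (newton m k (m k)) \<phi> = form (m k) (newton m k (m k)) \<phi> + (\<mu> - m k) * L2_inner (newton m k (m k)) \<phi>"
        by (rule form_shift)
      finally show ?thesis unfolding ih using ne by (simp add: divide_simps)
    qed
    then show ?case by simp
  qed
  show "form \<mu> (newton m k \<mu>) \<phi> = form \<nu> (newton m k \<nu>) \<phi>" using main[of k] assms by blast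
  show "k = Suc j \<Longrightarrow> form \<mu> (newton m k \<mu>) \<phi> = - L2_inner (newton m j (m j)) \<phi>"
    using main[of k] assms by blast
qed

text \<open>Coercivity bounds each level by the preceding one at its node, with a factor 1 /
  \<gamma>. Distinctness of the nodes makes the next node admissible as a parameter in the
  induction.\<close>

lemma newton_norm:
  assumes "inj m" "\<mu> \<in> {0..\<mu>max}" "\<mu> \<notin> m ` {..<Suc k}"
  shows "H_norm \<sigma> (newton m (Suc k) \<mu>) \<le> H_norm \<sigma> (u (m 0)) / \<gamma> ^ Suc k"
  using assms(2,3)
proof (induction k arbitrary: \<mu>)
  have step: "H_norm \<sigma> (newton m (Suc k) \<mu>) \<le> H_norm \<sigma> (newton m k (m k)) / \<gamma>"
    if \<mu>: "\<mu> \<in> {0..\<mu>max}" "\<mu> \<notin> m ` {..<Suc k}" for k \<mu>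
  proof -
    have "\<gamma> * H_norm \<sigma> (newton m (Suc k) \<mu>) \<le> H_norm \<sigma> (newton m k (m k))"
    proof (rule form_coercive[OF \<gamma>_pos \<gamma>_coercive newton_H_tilde[OF \<mu>(1)] newton_H_tilde[OF m_range]])
      show "0 \<le> \<mu>" using \<mu>(1) by simp
      show "form \<mu> (newton m (Suc k) \<mu>) \<phi> = - L2_inner (newton m k (m k)) \<phi>" if "\<phi> \<in> test_functions" for \<phi>
        using newton_form_indep(2)[OF assms(1) \<mu> \<mu> that refl] .
    qed
    then show ?thesis using \<gamma>_pos by (simp add: pos_le_divide_eq mult.commute)
  qed
  {
    case 0
    then show ?case using step[of \<mu> 0] by simp
  next
    case (Suc k)
    have "m (Suc k) \<notin> m ` {..<Suc k}" using assms(1) by (auto simp: inj_eq)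
    then have "H_norm \<sigma> (newton m (Suc k) (m (Suc k))) \<le> H_norm \<sigma> (u (m 0)) / \<gamma> ^ Suc k"
      by (rule Suc.IH[OF m_range])
    then have "H_norm \<sigma> (newton m (Suc k) (m (Suc k))) / \<gamma> \<le> H_norm \<sigma> (u (m 0)) / \<gamma> ^ Suc k / \<gamma>"
      using \<gamma>_pos by (intro divide_right_mono) auto
    also have "\<dots> = H_norm \<sigma> (u (m 0)) / \<gamma> ^ Suc (Suc k)" by (simp add: mult.commute)
    finally show ?case using step[OF Suc.prems] by linarith
  }
qed

lemma newton_expansion:
  "u \<mu> x = (\<Sum>k<n. (\<Prod>i<k. \<mu> - m i) * newton m k (m k) x) + (\<Prod>i<n. \<mu> - m i) * newton m n \<mu> x"
proof (induction n)
  case (Suc n)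
  have alg: "P * a = P * b + P * d * (1 / d * a + (- 1 / d) * b)" if "d \<noteq> 0" for P a b d :: real
    using that by (simp add: field_simps)
  have "(\<Prod>i<n. \<mu> - m i) * newton m n \<mu> x =
    (\<Prod>i<n. \<mu> - m i) * newton m n (m n) x + (\<Prod>i<Suc n. \<mu> - m i) * newton m (Suc n) \<mu> x"
  proof (cases "\<mu> = m n")
    \<comment> \<open>At a node the new product has a zero factor, so the remainder vanishes
      whatever the division by zero yields.\<close>
    case True
    then show ?thesis by simp
  next
    case False
    then show ?thesis unfolding newton.simps prod.lessThan_Suc by (intro alg) simp
  qed
  then show ?case using Suc by simp
qed simp

text \<open>The n factors of the product are each at most l and the divided difference contributes
  \<gamma>^-n. Nodes, which \<open>newton_norm\<close> excludes, are covered because the product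
  vanishes there.\<close>

lemma newton_remainder:
  assumes "inj m" "\<mu> \<in> {0..\<mu>max}" "\<And>i. \<bar>\<mu> - m i\<bar> \<le> l" and n: "0 < n"
  shows "H_norm \<sigma> (\<lambda>x. (\<Prod>i<n. \<mu> - m i) * newton m n \<mu> x) \<le> (l / \<gamma>) ^ n * H_norm \<sigma> (u (m 0))"
proof -
  have l0: "0 \<le> l" using assms(3)[of 0] by linarith
  have eq: "H_norm \<sigma> (\<lambda>x. (\<Prod>i<n. \<mu> - m i) * newton m n \<mu> x) = \<bar>\<Prod>i<n. \<mu> - m i\<bar> * H_norm \<sigma> (newton m n \<mu>)"
    by (rule H_norm_cmult[OF H_tilde_H_Omega[OF newton_H_tilde[OF assms(2)]]])
  show ?thesis
  proof (cases "\<mu> \<in> m ` {..<n}")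
    case True
    then have "\<exists>i\<in>{..<n}. \<mu> - m i = 0" by auto
    then have "(\<Prod>i<n. \<mu> - m i) = 0" by (rule prod_zero[OF finite_lessThan])
    moreover have "0 \<le> (l / \<gamma>) ^ n * H_norm \<sigma> (u (m 0))"
      using l0 \<gamma>_pos by (intro mult_nonneg_nonneg zero_le_power H_norm_nonneg) simp
    ultimately show ?thesis unfolding eq by (simp only: abs_zero mult_zero_left)
  next
    case False
    obtain k where k: "n = Suc k" using n by (cases n) auto
    have "\<bar>\<Prod>i<n. \<mu> - m i\<bar> = (\<Prod>i<n. \<bar>\<mu> - m i\<bar>)" by (rule abs_prod)
    also have "\<dots> \<le> (\<Prod>i<n. l)" by (intro prod_mono) (use assms(3) in auto)
    finally have "\<bar>\<Prod>i<n. \<mu> - m i\<bar> \<le> l ^ n" by simp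
    then have "\<bar>\<Prod>i<n. \<mu> - m i\<bar> * H_norm \<sigma> (newton m n \<mu>) \<le> l ^ n * (H_norm \<sigma> (u (m 0)) / \<gamma> ^ n)"
      using newton_norm[OF assms(1,2), of k] False l0 unfolding k
      by (intro mult_mono) (auto simp: H_norm_nonneg)
    then show ?thesis unfolding eq by (simp add: power_divide)
  qed
qed

end

text \<open>The difference quotient of the solution at 0 solves a problem with right-hand side
  -u(0). This controls the solution at all nodes by a single norm, independent of the choice of
  interval.\<close>

lemma u_bound:
  assumes "\<mu> \<in> {0..\<mu>max}"
  shows "H_norm \<sigma> (u \<mu>) \<le> H_norm \<sigma> (u 0) * (1 + \<mu>max / \<gamma>)"
proof -
  have z: "0 \<in> {0..\<mu>max}" and \<mu>0: "0 \<le> \<mu>max" using assms by auto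
  show ?thesis
  proof (cases "\<mu> = 0")
    case True
    have "H_norm \<sigma> (u 0) * 1 \<le> H_norm \<sigma> (u 0) * (1 + \<mu>max / \<gamma>)"
      using \<gamma>_pos \<mu>0 by (intro mult_left_mono H_norm_nonneg) simp
    then show ?thesis using True by simp
  next
    case False
    have "\<gamma> * H_norm \<sigma> (\<lambda>x. 1 / \<mu> * u \<mu> x + (- 1 / \<mu>) * u 0 x) \<le> H_norm \<sigma> (u 0)"
    proof (rule form_coercive[OF \<gamma>_pos \<gamma>_coercive H_tilde_lincomb[OF left.\<sigma>_le_1 u_H_tilde[OF assms] u_H_tilde[OF z]] u_H_tilde[OF z]])
      show "0 \<le> \<mu>" using assms by simp
      fix \<phi> assume \<phi>: "\<phi> \<in> test_functions"
      have "form \<mu> (u 0) \<phi> = L2_inner f \<phi> + \<mu> * L2_inner (u 0) \<phi>"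
        using form_shift[of \<mu> "u 0" \<phi> 0] u_form[OF z \<phi>] by simp
      then show "form \<mu> (\<lambda>x. 1 / \<mu> * u \<mu> x + (- 1 / \<mu>) * u 0 x) \<phi> = - L2_inner (u 0) \<phi>"
        unfolding form_lincomb[OF u_H_tilde[OF assms] u_H_tilde[OF z] \<phi>] u_form[OF assms \<phi>]
        using False by (simp add: field_simps)
    qed
    also have "(\<lambda>x. 1 / \<mu> * u \<mu> x + (- 1 / \<mu>) * u 0 x) = (\<lambda>x. (1 / \<mu>) * (u \<mu> x - u 0 x))"
      by (simp add: diff_divide_distrib)
    also have "H_norm \<sigma> (\<lambda>x. (1 / \<mu>) * (u \<mu> x - u 0 x)) = \<bar>1 / \<mu>\<bar> * H_norm \<sigma> (\<lambda>x. u \<mu> x - u 0 x)"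
      by (intro H_norm_cmult H_Omega_diff H_tilde_H_Omega u_H_tilde assms z)
    finally have "H_norm \<sigma> (\<lambda>x. u \<mu> x - u 0 x) \<le> \<mu> / \<gamma> * H_norm \<sigma> (u 0)"
      using \<gamma>_pos False assms by (simp add: field_simps)
    also have "\<dots> \<le> \<mu>max / \<gamma> * H_norm \<sigma> (u 0)"
      using assms \<gamma>_pos by (intro mult_right_mono divide_right_mono H_norm_nonneg) auto
    finally show ?thesis
      using H_norm_le_add[OF H_tilde_H_Omega[OF u_H_tilde[OF assms]] H_tilde_H_Omega[OF u_H_tilde[OF z]]]
      by (simp add: algebra_simps)
  qed
qed

end

section \<open>Finite-dimensional subspaces\<close>

definition wpoly :: "real \<Rightarrow> real \<Rightarrow> real poly" where
  "wpoly a b = [:- a, 1:] * [:b, - 1:]"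

lemma poly_wpoly: "poly (wpoly a b) x = (x - a) * (b - x)"
  by (simp add: wpoly_def algebra_simps)

text \<open>The extra p and k close the family under differentiation, so that smoothness of all
  orders reduces to one derivative formula. The bump proper is p = 1, k = 0.\<close>

definition bump :: "real \<Rightarrow> real \<Rightarrow> real poly \<Rightarrow> nat \<Rightarrow> real \<Rightarrow> real" where
  "bump a b p k x = (if a < x \<and> x < b
     then poly p x / poly (wpoly a b) x ^ k * exp (- 1 / poly (wpoly a b) x) else 0)"

text \<open>A single term of the exponential series bounds exp(1/q) from below; take
  reciprocals.\<close>

lemma power_exp_bound:
  assumes "0 < (q::real)"
  shows "exp (- 1 / q) \<le> fact n * q ^ n"
proof -
  let ?f = "\<lambda>i. (1 / q) ^ i /\<^sub>R fact i"
  have "sum ?f {n} \<le> suminf ?f"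
    by (rule sum_le_suminf[OF sums_summable[OF exp_converges]]) (use assms in auto)
  also have "suminf ?f = exp (1 / q)" by (rule sums_unique[OF exp_converges, symmetric])
  finally have le: "(1 / q) ^ n / fact n \<le> exp (1 / q)" by (simp add: divide_inverse mult.commute)
  have pos: "0 < (1 / q) ^ n / fact n" using assms by simp
  have "inverse (exp (1 / q)) \<le> inverse ((1 / q) ^ n / fact n)" by (rule le_imp_inverse_le[OF le pos])
  also have "\<dots> = fact n * q ^ n" using assms by (simp add: power_divide)
  finally show ?thesis by (simp add: exp_minus)
qed

text \<open>Using exponent k + 2 in \<open>power_exp_bound\<close> beats the pole of order k and
  leaves q^2, where q vanishes simply at both ends. Quadratic vanishing gives derivative zero at the
  two gluing points.\<close>

lemma bump_bound:
  assumes "a < b"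
  obtains C where "0 \<le> C" "\<And>x. \<bar>bump a b p k x\<bar> \<le> C * (x - a)\<^sup>2" "\<And>x. \<bar>bump a b p k x\<bar> \<le> C * (x - b)\<^sup>2"
proof -
  have "compact (poly p ` {a..b})"
    by (rule compact_continuous_image[OF _ compact_Icc]) (intro continuous_intros)
  then have "bounded (poly p ` {a..b})" by (rule compact_imp_bounded)
  then obtain M where M': "\<forall>y\<in>poly p ` {a..b}. norm y \<le> M" unfolding bounded_iff ..
  have M: "\<bar>poly p x\<bar> \<le> M" if "x \<in> {a..b}" for x
    using M'[rule_format, OF imageI[OF that]] by simp
  have M0: "0 \<le> M" using M[of a] assms by simp
  define C where "C = M * fact (k + 2) * (b - a)\<^sup>2"
  have C0: "0 \<le> C" using M0 by (simp add: C_def)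
  have main: "\<bar>bump a b p k x\<bar> \<le> M * fact (k + 2) * ((x - a) * (b - x))\<^sup>2" if x: "a < x" "x < b" for x
  proof -
    define q where "q = (x - a) * (b - x)"
    have q: "0 < q" using x by (simp add: q_def)
    have "\<bar>bump a b p k x\<bar> = \<bar>poly p x\<bar> / q ^ k * exp (- 1 / q)"
      using x q by (simp add: bump_def poly_wpoly q_def[symmetric] abs_mult)
    also have "\<dots> \<le> M / q ^ k * (fact (k + 2) * q ^ (k + 2))"
      using q M[of x] x M0 by (intro mult_mono divide_right_mono power_exp_bound) auto
    also have "\<dots> = M * fact (k + 2) * q\<^sup>2" using q by (simp add: power_add power2_eq_square)
    finally show ?thesis unfolding q_def .
  qed
  have "\<bar>bump a b p k x\<bar> \<le> C * (x - a)\<^sup>2" for x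
  proof (cases "a < x \<and> x < b")
    case True
    have "(b - x)\<^sup>2 \<le> (b - a)\<^sup>2" using True by (intro power_mono) auto
    then have "M * fact (k + 2) * (x - a)\<^sup>2 * (b - x)\<^sup>2 \<le> M * fact (k + 2) * (x - a)\<^sup>2 * (b - a)\<^sup>2"
      using M0 by (intro mult_left_mono) auto
    then show ?thesis using main[of x] True by (simp add: C_def power_mult_distrib mult_ac)
  next
    case False
    then show ?thesis using C0 by (auto simp: bump_def)
  qed
  moreover have "\<bar>bump a b p k x\<bar> \<le> C * (x - b)\<^sup>2" for x
  proof (cases "a < x \<and> x < b")
    case True
    have "(x - a)\<^sup>2 \<le> (b - a)\<^sup>2" using True by (intro power_mono) auto
    then have "M * fact (k + 2) * (b - x)\<^sup>2 * (x - a)\<^sup>2 \<le> M * fact (k + 2) * (b - x)\<^sup>2 * (b - a)\<^sup>2"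
      using M0 by (intro mult_left_mono) auto
    then show ?thesis using main[of x] True by (simp add: C_def power_mult_distrib mult_ac power2_commute[of x b])
  next
    case False
    then show ?thesis using C0 by (auto simp: bump_def)
  qed
  ultimately show ?thesis by (intro that[OF C0])
qed

lemma quadratic_bound_imp_deriv_zero:
  fixes f :: "real \<Rightarrow> real"
  assumes "\<And>x. \<bar>f x\<bar> \<le> C * (x - c)\<^sup>2"
  shows "(f has_real_derivative 0) (at c)"
  unfolding DERIV_def
proof (rule Lim_null_comparison)
  have f0: "f c = 0" using assms[of c] by simp
  show "\<forall>\<^sub>F h in at 0. norm ((f (c + h) - f c) / h) \<le> C * \<bar>h\<bar>"
  proof (rule eventually_mono[OF eventually_at_filter[THEN iffD2]])
    show "\<forall>\<^sub>F h in nhds 0. h \<noteq> 0 \<longrightarrow> h \<in> UNIV \<longrightarrow> h \<noteq> (0::real)" by simp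
    fix h :: real assume h: "h \<noteq> 0"
    have "norm ((f (c + h) - f c) / h) = \<bar>f (c + h)\<bar> / \<bar>h\<bar>" by (simp add: f0)
    also have "\<dots> \<le> (C * h\<^sup>2) / \<bar>h\<bar>" using assms[of "c + h"] by (intro divide_right_mono) auto
    also have "\<dots> = C * \<bar>h\<bar>" using h by (simp add: power2_eq_square abs_if)
    finally show "norm ((f (c + h) - f c) / h) \<le> C * \<bar>h\<bar>" .
  qed
  show "((\<lambda>h. C * \<bar>h\<bar>) \<longlongrightarrow> 0) (at 0)"
    by (rule tendsto_mult_right_zero) (rule tendsto_rabs_zero[OF tendsto_ident_at])
qed

text \<open>The numerator in (p w^-k exp(-1/w))' = (p' w^2 - k p w' w + p w') w^(-k-2) exp(-1/w),
  where w is the weight polynomial.\<close>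

definition bump_next :: "real \<Rightarrow> real \<Rightarrow> real poly \<Rightarrow> nat \<Rightarrow> real poly" where
  "bump_next a b p k = pderiv p * (wpoly a b)\<^sup>2 - of_nat k * p * pderiv (wpoly a b) * wpoly a b + p * pderiv (wpoly a b)"

lemma bump_deriv:
  assumes "a < b"
  shows "(bump a b p k has_real_derivative bump a b (bump_next a b p k) (k + 2) x) (at x)"
proof -
  obtain C where C: "0 \<le> C" "\<And>x. \<bar>bump a b p k x\<bar> \<le> C * (x - a)\<^sup>2" "\<And>x. \<bar>bump a b p k x\<bar> \<le> C * (x - b)\<^sup>2"
    using bump_bound[OF assms, of p k] by metis
  consider "x < a" | "x = a" | "a < x" "x < b" | "x = b" | "b < x" by linarith
  then show ?thesis
  proof cases
    case 1
    have "((\<lambda>_. 0) has_real_derivative 0) (at x)" by simp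
    then have "(bump a b p k has_real_derivative 0) (at x)"
      by (rule has_field_derivative_transform_within_open[of _ _ _ "{..<a}"]) (use 1 in \<open>auto simp: bump_def\<close>)
    then show ?thesis using 1 by (simp add: bump_def)
  next
    case 2
    then have "bump a b (bump_next a b p k) (k + 2) x = 0" by (simp add: bump_def)
    then show ?thesis using quadratic_bound_imp_deriv_zero[OF C(2)] 2 by (simp only:)
  next
    case 4
    then have "bump a b (bump_next a b p k) (k + 2) x = 0" by (simp add: bump_def)
    then show ?thesis using quadratic_bound_imp_deriv_zero[OF C(3)] 4 by (simp only:)
  next
    case 5
    have "((\<lambda>_. 0) has_real_derivative 0) (at x)" by simp
    then have "(bump a b p k has_real_derivative 0) (at x)"
      by (rule has_field_derivative_transform_within_open[of _ _ _ "{b<..}"]) (use 5 in \<open>auto simp: bump_def\<close>)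
    then show ?thesis using 5 by (simp add: bump_def)
  next
    case 3
    define w where "w = wpoly a b"
    define P P' Q Q' where "P = poly p x" and "P' = poly (pderiv p) x" and "Q = poly w x" and "Q' = poly (pderiv w) x"
    have Q: "0 < Q" using 3 by (simp add: Q_def w_def poly_wpoly)
    have e: "((\<lambda>x. exp (- 1 / poly w x)) has_real_derivative (Q' / Q\<^sup>2 * exp (- 1 / Q))) (at x)"
      using Q unfolding Q_def Q'_def by (auto intro!: derivative_eq_intros simp: power2_eq_square)
    have f: "((\<lambda>x. poly p x / poly w x ^ k) has_real_derivative (P' * Q ^ k - P * (of_nat k * Q ^ (k - 1) * Q')) / (Q ^ k * Q ^ k)) (at x)"
      using Q unfolding P_def P'_def Q_def Q'_def by (auto intro!: derivative_eq_intros)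
    \<comment> \<open>Removes the truncated exponent k - 1, so that k = 0 needs no separate
      treatment below.\<close>
    have kk: "of_nat k * Q ^ (k - 1) = of_nat k * Q ^ k / Q"
      using Q by (cases k) auto
    have "((\<lambda>x. poly p x / poly w x ^ k * exp (- 1 / poly w x)) has_real_derivative
       (P' * Q ^ k - P * (of_nat k * Q ^ (k - 1) * Q')) / (Q ^ k * Q ^ k) * exp (- 1 / Q) + (Q' / Q\<^sup>2 * exp (- 1 / Q)) * (P / Q ^ k)) (at x)"
      using DERIV_mult[OF f e] by (simp add: P_def Q_def)
    also have "(P' * Q ^ k - P * (of_nat k * Q ^ (k - 1) * Q')) / (Q ^ k * Q ^ k) * exp (- 1 / Q) + (Q' / Q\<^sup>2 * exp (- 1 / Q)) * (P / Q ^ k) =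
       (P' * Q\<^sup>2 - of_nat k * P * Q' * Q + P * Q') / Q ^ (k + 2) * exp (- 1 / Q)"
    proof -
      have alg: "(P' * z - P * (n * z / Q * Q')) / (z * z) * E + (Q' / Q\<^sup>2 * E) * (P / z) =
         (P' * Q\<^sup>2 - n * P * Q' * Q + P * Q') / (z * Q\<^sup>2) * E" if "z \<noteq> 0" for z n E
        using that Q by (simp add: divide_simps power2_eq_square) (simp add: algebra_simps)
      show ?thesis unfolding kk power_add using Q by (intro alg) simp
    qed
    also have "\<dots> = bump a b (bump_next a b p k) (k + 2) x"
      using 3 unfolding bump_def bump_next_def w_def[symmetric] P_def P'_def Q_def Q'_def by simp
    finally show ?thesis
      by (rule has_field_derivative_transform_within_open[of _ _ _ "{a<..<b}"]) (use 3 in \<open>auto simp: bump_def w_def\<close>)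
  qed
qed

lemma bump_iterated_deriv:
  assumes "a < b"
  shows "\<exists>p' k'. (deriv ^^ n) (bump a b p k) = bump a b p' k'"
proof (induction n)
  case (Suc n)
  then obtain p' k' where eq: "(deriv ^^ n) (bump a b p k) = bump a b p' k'" by blast
  have "deriv (bump a b p' k') = bump a b (bump_next a b p' k') (k' + 2)"
    by (intro ext DERIV_imp_deriv bump_deriv assms)
  then show ?case unfolding funpow.simps comp_apply eq by blast
qed auto

lemma bump_test:
  assumes "0 < a" "a < b" "b < 1"
  shows "bump a b p k \<in> test_functions"
proof -
  have diff: "((deriv ^^ n) (bump a b p k)) field_differentiable (at x)" for n x
  proof -
    obtain p' k' where "(deriv ^^ n) (bump a b p k) = bump a b p' k'"
      using bump_iterated_deriv[OF assms(2)] by blast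
    then show ?thesis using bump_deriv[OF assms(2), of p' k' x] by (auto simp: field_differentiable_def)
  qed
  have sub: "closure {x. bump a b p k x \<noteq> 0} \<subseteq> {a..b}"
    by (rule closure_minimal) (auto simp: bump_def)
  have "compact ({a..b} \<inter> closure {x. bump a b p k x \<noteq> 0})"
    by (rule compact_Int_closed[OF compact_Icc closed_closure])
  then have "compact (closure {x. bump a b p k x \<noteq> 0})" unfolding Int_absorb1[OF sub] .
  moreover have "closure {x. bump a b p k x \<noteq> 0} \<subseteq> Omega" using sub assms by (auto simp: Omega_def)
  ultimately show ?thesis using diff unfolding test_functions_def by blast
qed

text \<open>Consecutive intervals shrinking towards 0 give infinitely many test functions with
  disjoint supports inside (0,1).\<close>

definition ebump :: "nat \<Rightarrow> real \<Rightarrow> real" where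
  "ebump j = bump (1 / (real j + 3)) (1 / (real j + 2)) 1 0"

lemma ebump_test: "ebump j \<in> test_functions"
  unfolding ebump_def by (rule bump_test) (auto simp: divide_simps)

lemma ebump_pos: "1 / (real j + 3) < x \<Longrightarrow> x < 1 / (real j + 2) \<Longrightarrow> 0 < ebump j x"
  by (simp add: ebump_def bump_def)

lemma ebump_disjoint:
  assumes "1 / (real j + 3) < x" "x < 1 / (real j + 2)" "i \<noteq> j"
  shows "ebump i x = 0"
proof (cases "i < j")
  case True
  have "1 / (real j + 2) \<le> 1 / (real i + 3)" using True by (intro divide_left_mono) auto
  then show ?thesis using assms by (simp add: ebump_def bump_def)
next
  case False
  then have "1 / (real i + 2) \<le> 1 / (real j + 3)" using assms(3) by (intro divide_left_mono) auto
  then show ?thesis using assms by (simp add: ebump_def bump_def)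
qed

lemma AE_lborel_interval_point:
  assumes "AE x in lborel. P x" "a < (b::real)"
  obtains x where "a < x" "x < b" "P x"
proof (rule ccontr)
  assume "\<not> thesis"
  then have no: "\<not> P x" if "a < x" "x < b" for x using that \<open>\<And>x. a < x \<Longrightarrow> x < b \<Longrightarrow> P x \<Longrightarrow> thesis\<close> by blast
  have "AE x in lborel. x \<notin> {a<..<b}"
    using assms(1) by eventually_elim (use no in auto)
  then have "{a<..<b} \<in> null_sets lborel"
    by (subst AE_iff_null_sets) auto
  then have "emeasure lborel {a<..<b} = 0" by (rule null_setsD1)
  then show False using assms(2) by simp
qed

section \<open>Linear dependence modulo null sets\<close>

lemma homogeneous_system:
  fixes M :: "'j \<Rightarrow> 'i \<Rightarrow> real"
  assumes "finite I" "finite J" "card I < card J"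
  shows "\<exists>c. (\<exists>j\<in>J. c j \<noteq> 0) \<and> (\<forall>i\<in>I. (\<Sum>j\<in>J. c j * M j i) = 0)"
  using assms
proof (induction I arbitrary: J M rule: finite_induct)
  case empty
  then obtain j where "j \<in> J" by fastforce
  then show ?case by (intro exI[of _ "\<lambda>_. 1"]) auto
next
  case (insert i0 I)
  show ?case
  proof (cases "\<forall>j\<in>J. M j i0 = 0")
    case True
    have "card I < card J" using insert by simp
    from insert.IH[OF insert.prems(1) this, of M] obtain c
      where c: "\<exists>j\<in>J. c j \<noteq> 0" "\<forall>i\<in>I. (\<Sum>j\<in>J. c j * M j i) = 0" by blast
    have "(\<Sum>j\<in>J. c j * M j i0) = 0" using True by (intro sum.neutral) auto
    then show ?thesis using c by blast
  next
    case False
    then obtain r where r: "r \<in> J" "M r i0 \<noteq> 0" by blast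
    define J' where "J' = J - {r}"
    have J': "finite J'" "card I < card J'" using insert r by (auto simp: J'_def)
    \<comment> \<open>Gaussian elimination with pivot r: N is the system after removing the unknown
      r by means of equation i0, and c r below is recovered from that equation.\<close>
    define N where "N j i = M j i - M j i0 / M r i0 * M r i" for j i
    from insert.IH[OF J', of N] obtain d
      where d: "\<exists>j\<in>J'. d j \<noteq> 0" "\<forall>i\<in>I. (\<Sum>j\<in>J'. d j * N j i) = 0" by blast
    define c where "c j = (if j = r then - (\<Sum>l\<in>J'. d l * M l i0) / M r i0 else d j)" for j
    have cJ': "c j = d j" if "j \<in> J'" for j using that by (simp add: c_def J'_def)
    have split: "(\<Sum>j\<in>J. c j * M j i) = c r * M r i + (\<Sum>j\<in>J'. d j * M j i)" for i
      using r(1) insert.prems(1) cJ' unfolding J'_def by (simp add: sum.remove)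
    have "(\<Sum>j\<in>J. c j * M j i) = 0" if "i \<in> I" for i
    proof -
      have "(\<Sum>j\<in>J'. d j * N j i) = (\<Sum>j\<in>J'. d j * M j i) - (\<Sum>j\<in>J'. d j * M j i0) / M r i0 * M r i"
        unfolding N_def by (simp add: right_diff_distrib sum_subtractf sum_divide_distrib sum_distrib_right mult.assoc)
      then show ?thesis using d(2) that unfolding split by (simp add: c_def)
    qed
    moreover have "(\<Sum>j\<in>J. c j * M j i0) = 0" unfolding split using r(2) by (simp add: c_def)
    moreover have "\<exists>j\<in>J. c j \<noteq> 0"
    proof -
      obtain j where j: "j \<in> J'" "d j \<noteq> 0" using d(1) by blast
      then have "j \<in> J" "c j \<noteq> 0" using cJ'[OF j(1)] by (simp_all add: J'_def)
      then show ?thesis by blast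
    qed
    ultimately show ?thesis by blast
  qed
qed

definition ae_span :: "nat \<Rightarrow> (nat \<Rightarrow> real \<Rightarrow> real) \<Rightarrow> (real \<Rightarrow> real) \<Rightarrow> bool" where
  "ae_span n b v \<longleftrightarrow> (\<exists>a. AE x in lborel. v x = (\<Sum>i<n. a i * b i x))"

definition ae_independent :: "nat \<Rightarrow> (nat \<Rightarrow> real \<Rightarrow> real) \<Rightarrow> bool" where
  "ae_independent n b \<longleftrightarrow> (\<forall>a. (AE x in lborel. (\<Sum>i<n. a i * b i x) = 0) \<longrightarrow> (\<forall>i<n. a i = 0))"

text \<open>If n functions spanned all bumps, then n + 1 of them would satisfy a nontrivial relation
  almost everywhere. At a point of an interval with nonzero coefficient all other bumps vanish,
  which is a contradiction.\<close>

lemma exists_test_outside_span: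
  obtains j where "\<not> ae_span n b (ebump j)"
proof -
  have "\<exists>j. \<not> ae_span n b (ebump j)"
  proof (rule ccontr)
    assume "\<nexists>j. \<not> ae_span n b (ebump j)"
    then have "\<forall>j. \<exists>a. AE x in lborel. ebump j x = (\<Sum>i<n. a i * b i x)" by (simp add: ae_span_def)
    from choice[OF this] obtain M where M: "\<forall>j. AE x in lborel. ebump j x = (\<Sum>i<n. M j i * b i x)" ..
    have "\<exists>c. (\<exists>j\<in>{..n}. c j \<noteq> 0) \<and> (\<forall>i\<in>{..<n}. (\<Sum>j\<in>{..n}. c j * M j i) = 0)"
      by (rule homogeneous_system) auto
    then obtain c where "\<exists>j\<in>{..n}. c j \<noteq> 0" and c': "\<forall>i\<in>{..<n}. (\<Sum>j\<le>n. c j * M j i) = 0" by blast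
    then obtain j0 where "j0 \<le> n" "c j0 \<noteq> 0" by blast
    note c = this c'
    have "AE x in lborel. \<forall>j\<in>{..n}. ebump j x = (\<Sum>i<n. M j i * b i x)"
      by (rule AE_finite_allI) (use M in auto)
    then have AE: "AE x in lborel. (\<Sum>j\<le>n. c j * ebump j x) = 0"
    proof eventually_elim
      case (elim x)
      have "(\<Sum>j\<le>n. c j * ebump j x) = (\<Sum>j\<le>n. \<Sum>i<n. c j * M j i * b i x)"
        using elim by (intro sum.cong refl) (simp add: sum_distrib_left mult.assoc)
      also have "\<dots> = (\<Sum>i<n. (\<Sum>j\<le>n. c j * M j i) * b i x)"
        by (subst sum.swap) (simp add: sum_distrib_right)
      also have "\<dots> = 0" by (intro sum.neutral ballI) (simp only: c'[rule_format] mult_zero_left)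
      finally show ?case .
    qed
    have "1 / (real j0 + 3) < 1 / (real j0 + 2)" by (simp add: divide_simps)
    from AE_lborel_interval_point[OF AE this] obtain x
      where x: "1 / (real j0 + 3) < x" "x < 1 / (real j0 + 2)" "(\<Sum>j\<le>n. c j * ebump j x) = 0" .
    have "(\<Sum>j\<le>n. c j * ebump j x) = c j0 * ebump j0 x + (\<Sum>j\<in>{..n} - {j0}. c j * ebump j x)"
      using c(1) by (intro sum.remove) auto
    also have "(\<Sum>j\<in>{..n} - {j0}. c j * ebump j x) = 0"
      by (intro sum.neutral) (use ebump_disjoint[OF x(1,2)] in auto)
    finally have "c j0 * ebump j0 x = 0" using x(3) by simp
    then show False using c(2) ebump_pos[OF x(1,2)] by simp
  qed
  then show ?thesis using that by blast
qed

lemma ae_span_unit: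
  assumes "k < n"
  shows "ae_span n b (b k)"
proof -
  have "b k x = (\<Sum>i<n. (if i = k then 1 else 0) * b i x)" for x
    using assms by (simp add: if_distrib[of "\<lambda>c. c * _"] cong: if_cong)
  then show ?thesis unfolding ae_span_def by (intro exI[of _ "\<lambda>i. if i = k then 1 else 0"] AE_I2)
qed

lemma ae_span_extend:
  assumes "ae_span n b v"
  shows "ae_span (Suc n) (b(n := e)) v"
proof -
  obtain a where a: "AE x in lborel. v x = (\<Sum>i<n. a i * b i x)" using assms unfolding ae_span_def by blast
  have "(\<Sum>i<Suc n. (a(n := 0)) i * (b(n := e)) i x) = (\<Sum>i<n. a i * b i x)" for x by simp
  then show ?thesis unfolding ae_span_def using a by (intro exI[of _ "a(n := 0)"]) (simp only:)
qed

lemma ae_independent_extend: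
  assumes ind: "ae_independent n b" and e: "\<not> ae_span n b e"
  shows "ae_independent (Suc n) (b(n := e))"
  unfolding ae_independent_def
proof (intro allI impI)
  fix a i
  assume "AE x in lborel. (\<Sum>i<Suc n. a i * (b(n := e)) i x) = 0" and i: "i < Suc n"
  then have AE: "AE x in lborel. (\<Sum>i<n. a i * b i x) + a n * e x = 0" by simp
  have an: "a n = 0"
  proof (rule ccontr)
    assume an: "a n \<noteq> 0"
    have "AE x in lborel. e x = (\<Sum>i<n. (- a i / a n) * b i x)"
      using AE
    proof eventually_elim
      case (elim x)
      have "(\<Sum>i<n. (- a i / a n) * b i x) = - (\<Sum>i<n. a i * b i x) / a n"
        by (simp add: sum_negf sum_divide_distrib)
      moreover have "e x = - (\<Sum>i<n. a i * b i x) / a n" using elim an by (simp add: field_simps)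
      ultimately show ?case by (simp only:)
    qed
    then have "ae_span n b e" unfolding ae_span_def by (rule exI[of _ "\<lambda>i. - a i / a n"])
    then show False using e by blast
  qed
  then have "AE x in lborel. (\<Sum>i<n. a i * b i x) = 0" using AE by simp
  then have "\<forall>i<n. a i = 0" using ind unfolding ae_independent_def by blast
  then show "a i = 0" using an i by (cases "i = n") auto
qed

text \<open>A function already in the span adds no dimension, so a bump outside the span is adjoined
  in its place. In this way the count is exactly n even for dependent families.\<close>

lemma independent_family_spanning:
  assumes "\<And>i. i < n \<Longrightarrow> v i \<in> V" and tests: "test_functions \<subseteq> V"
  shows "\<exists>b. (\<forall>i<n. b i \<in> V) \<and> ae_independent n b \<and> (\<forall>k<n. ae_span n b (v k))"
  using assms(1)
proof (induction n)
  case 0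
  then show ?case by (simp add: ae_independent_def)
next
  case (Suc n)
  then obtain b where b: "\<forall>i<n. b i \<in> V" "ae_independent n b" "\<forall>k<n. ae_span n b (v k)" by auto
  show ?case
  proof (cases "ae_span n b (v n)")
    case False
    have sp: "ae_span (Suc n) (b(n := v n)) (v k)" if "k < Suc n" for k
    proof (cases "k = n")
      case True
      then show ?thesis using ae_span_unit[of n "Suc n" "b(n := v n)"] by (simp only: fun_upd_same lessI)
    next
      case False
      then have "k < n" using that by simp
      then show ?thesis by (intro ae_span_extend b(3)[rule_format])
    qed
    have V: "\<forall>i<Suc n. (b(n := v n)) i \<in> V" using b(1) Suc.prems by (auto simp: less_Suc_eq)
    show ?thesis
      by (intro exI[of _ "b(n := v n)"] conjI V ae_independent_extend[OF b(2) False] allI impI sp)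
  next
    case True
    obtain j where j: "\<not> ae_span n b (ebump j)" by (rule exists_test_outside_span)
    have sp: "ae_span (Suc n) (b(n := ebump j)) (v k)" if "k < Suc n" for k
    proof (rule ae_span_extend, cases "k = n")
      assume "k \<noteq> n"
      then show "ae_span n b (v k)" using that by (intro b(3)[rule_format]) simp
    qed (use True in simp)
    have "ebump j \<in> V" using tests ebump_test by blast
    then have V: "\<forall>i<Suc n. (b(n := ebump j)) i \<in> V" using b(1) by (auto simp: less_Suc_eq)
    show ?thesis
      by (intro exI[of _ "b(n := ebump j)"] conjI V ae_independent_extend[OF b(2) j] allI impI sp)
  qed
qed

text \<open>The given functions lie in the space only up to null sets, so each combination has a
  representative in W that agrees with it almost everywhere. That is enough, since the Sobolev norm
  ignores null sets.\<close>

lemma subspace_containing: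
  assumes \<sigma>: "\<sigma> \<le> 1" and v: "\<And>i. i < n \<Longrightarrow> v i \<in> H_tilde \<sigma>"
  shows "\<exists>W. subspace_of_dim (H_tilde \<sigma>) n W \<and>
    (\<forall>c. \<exists>y\<in>W. y \<in> borel_measurable borel \<and> (AE x in lborel. y x = (\<Sum>i<n. c i * v i x)))"
proof -
  have tests: "test_functions \<subseteq> H_tilde \<sigma>" using test_H_tilde[OF _ \<sigma>] by blast
  obtain b where b: "\<forall>i<n. b i \<in> H_tilde \<sigma>" "ae_independent n b" "\<forall>k<n. ae_span n b (v k)"
    using independent_family_spanning[of n v, OF v tests] by blast
  define W where "W = {\<lambda>x. \<Sum>i<n. a i * b i x | a :: nat \<Rightarrow> real. True}"
  have "subspace_of_dim (H_tilde \<sigma>) n W"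
    using b(1,2) unfolding subspace_of_dim_def ae_independent_def W_def by blast
  moreover have "\<exists>y\<in>W. y \<in> borel_measurable borel \<and> (AE x in lborel. y x = (\<Sum>i<n. c i * v i x))" for c
  proof -
    have "\<forall>k. \<exists>a. k < n \<longrightarrow> (AE x in lborel. v k x = (\<Sum>i<n. a i * b i x))"
      using b(3) unfolding ae_span_def by blast
    from choice[OF this] obtain A
      where A: "\<forall>k. k < n \<longrightarrow> (AE x in lborel. v k x = (\<Sum>i<n. A k i * b i x))" ..
    define y where "y x = (\<Sum>i<n. (\<Sum>k<n. c k * A k i) * b i x)" for x
    have b_meas: "b i \<in> borel_measurable borel" if "i < n" for i
      using H_OmegaD(1)[OF H_tilde_H_Omega] b(1) that by blast
    have "y \<in> borel_measurable borel"
      unfolding y_def[abs_def] by (intro borel_measurable_sum borel_measurable_times borel_measurable_const b_meas) simp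
    moreover have "y \<in> W" unfolding W_def y_def[abs_def] by (intro CollectI exI[of _ "\<lambda>i. \<Sum>k<n. c k * A k i"]) simp
    moreover have "AE x in lborel. y x = (\<Sum>i<n. c i * v i x)"
    proof -
      have "AE x in lborel. \<forall>k\<in>{..<n}. v k x = (\<Sum>i<n. A k i * b i x)"
        by (rule AE_finite_allI) (use A in auto)
      then show ?thesis
      proof eventually_elim
        case (elim x)
        have "(\<Sum>k<n. c k * v k x) = (\<Sum>k<n. \<Sum>i<n. c k * A k i * b i x)"
          using elim by (intro sum.cong refl) (simp add: sum_distrib_left mult.assoc)
        also have "\<dots> = y x" unfolding y_def by (subst sum.swap) (simp add: sum_distrib_right)
        finally show ?case by simp
      qed
    qed
    ultimately show ?thesis by blast
  qed
  ultimately show ?thesis by blast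
qed

section \<open>The Kolmogorov width\<close>

lemma H_norm_cong_AE:
  assumes "v \<in> borel_measurable borel" "w \<in> borel_measurable borel" "AE x in lborel. v x = w x"
  shows "H_norm \<sigma> v = H_norm \<sigma> w"
  unfolding H_norm_def H_density_def fourier_cong_AE[OF assms] ..

text \<open>Spanning functions are numbered by j * m + k, with j the interval and k the level of the
  divided difference. Coefficients supported on one interval reduce the sum to one block.\<close>

lemma sum_block:
  fixes g :: "nat \<Rightarrow> real"
  assumes "j * m + m \<le> n" "\<And>i. i < n \<Longrightarrow> i div m \<noteq> j \<Longrightarrow> g i = 0" "0 < m"
  shows "(\<Sum>i<n. g i) = (\<Sum>k<m. g (j * m + k))"
proof -
  have "(\<Sum>i<n. g i) = sum g ((\<lambda>k. j * m + k) ` {..<m})"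
  proof (rule sum.mono_neutral_right)
    show "(\<lambda>k. j * m + k) ` {..<m} \<subseteq> {..<n}" using assms(1) by auto
    show "\<forall>i\<in>{..<n} - (\<lambda>k. j * m + k) ` {..<m}. g i = 0"
    proof
      fix i assume i: "i \<in> {..<n} - (\<lambda>k. j * m + k) ` {..<m}"
      have "i div m \<noteq> j"
      proof
        assume "i div m = j"
        then have "i = j * m + i mod m" using div_mult_mod_eq[of i m] by simp
        then show False using i assms(3) by (auto simp: image_iff dest: spec)
      qed
      then show "g i = 0" using i assms(2) by simp
    qed
  qed simp
  also have "\<dots> = (\<Sum>k<m. g (j * m + k))" by (subst sum.reindex) (auto simp: inj_on_def)
  finally show ?thesis .
qed

lemma interval_index:
  assumes "0 < (l::real)" "0 < N" "0 \<le> \<mu>" "\<mu> \<le> real N * l"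
  obtains j where "j < N" "real j * l \<le> \<mu>" "\<mu> \<le> (real j + 1) * l"
proof (cases "\<mu> = real N * l")
  \<comment> \<open>Rounding down would give the index N at the right end point, which belongs to
    the last interval instead.\<close>
  case True
  have "real (N - 1) * l \<le> \<mu>" "\<mu> \<le> (real (N - 1) + 1) * l"
    using assms True by (simp_all add: of_nat_diff algebra_simps)
  then show ?thesis using assms(2) by (intro that[of "N - 1"]) auto
next
  case False
  define j where "j = nat \<lfloor>\<mu> / l\<rfloor>"
  have q: "0 \<le> \<mu> / l" using assms by simp
  have rj: "real j = of_int \<lfloor>\<mu> / l\<rfloor>" using q by (simp add: j_def)
  have 1: "real j \<le> \<mu> / l" "\<mu> / l < real j + 1" unfolding rj by linarith+
  have "\<mu> < real N * l" using assms(4) False by simp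
  then have "\<mu> / l < real N" using assms(1) by (simp add: divide_less_eq)
  then have "j < N" using 1 by linarith
  then show ?thesis using 1 assms(1) by (intro that[of j]) (simp_all add: field_simps)
qed

context parametric_problem
begin

lemma width_bound:
  assumes \<mu>max: "0 < \<mu>max" and N: "0 < N" "exp 1 * \<mu>max / \<gamma> \<le> real N"
  shows "kolmogorov_width (2 * \<sigma>) {0..\<mu>max} u n \<le>
    ereal (exp 1 * (H_norm \<sigma> (u 0) * (1 + \<mu>max / \<gamma>)) * exp (- (real n / real N)))"
proof -
  define U where "U = H_norm \<sigma> (u 0) * (1 + \<mu>max / \<gamma>)"
  have U0: "0 \<le> U" unfolding U_def using \<mu>max \<gamma>_pos by (intro mult_nonneg_nonneg H_norm_nonneg) simp
  define m where "m = n div N"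
  define l where "l = \<mu>max / real N"
  have l: "0 < l" and Nl: "real N * l = \<mu>max" using \<mu>max N by (simp_all add: l_def)
  \<comment> \<open>The lower bound on N is chosen for this: each additional node gains a factor 1/e
    in the remainder.\<close>
  have l\<gamma>: "l / \<gamma> \<le> exp (- 1)"
    using N \<gamma>_pos unfolding l_def exp_minus by (simp add: field_simps)
  \<comment> \<open>Infinitely many distinct points of the closed interval number j, as
    \<open>newton\<close> and its estimates work with injective infinite sequences.\<close>
  define node where "node j k = (real j + 1 / (real k + 1)) * l" for j k :: nat
  have node_ge: "real j * l \<le> node j k" and node_le: "node j k \<le> (real j + 1) * l" for j k
    using l by (auto simp: node_def intro!: mult_right_mono)
  have node_range: "node j k \<in> {0..\<mu>max}" if "j < N" for j k
  proof -
    have "(real j + 1) * l \<le> real N * l" using that l by (intro mult_right_mono) auto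
    moreover have "0 \<le> real j * l" using l by simp
    ultimately show ?thesis using node_ge[of j k] node_le[of j k] Nl by simp
  qed
  have node_inj: "inj (node j)" for j
    using l by (auto simp: inj_def node_def)
  \<comment> \<open>N blocks of m functions need not exhaust n; the remaining slots hold u 0, and
    any dependence is repaired when the subspace is built.\<close>
  define v where "v i = (if i < N * m then newton (node (i div m)) (i mod m) (node (i div m) (i mod m)) else u 0)" for i
  have zero: "0 \<in> {0..\<mu>max}" using \<mu>max by simp
  have v: "v i \<in> H_tilde \<sigma>" for i
  proof (cases "i < N * m")
    case True
    then have "i div m < N" by (simp add: less_mult_imp_div_less)
    from newton_H_tilde[of "node (i div m)", OF node_range[OF this] node_range[OF this]] True
    show ?thesis unfolding v_def by simp
  next
    case False
    then show ?thesis using u_H_tilde[OF zero] by (simp add: v_def)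
  qed
  obtain W where W: "subspace_of_dim (H_tilde \<sigma>) n W"
    "\<forall>c. \<exists>y\<in>W. y \<in> borel_measurable borel \<and> (AE x in lborel. y x = (\<Sum>i<n. c i * v i x))"
    using subspace_containing[OF left.\<sigma>_le_1, of n v, OF v] by blast
  \<comment> \<open>Rounding n / N down to m costs less than one node, hence at most a factor
    e.\<close>
  have decay: "exp (- real m) \<le> exp 1 * exp (- (real n / real N))"
  proof -
    have "n < N * (m + 1)" unfolding m_def using N(1) by (simp add: dividend_less_times_div)
    then have "real n < real N * (real m + 1)" by (metis of_nat_less_iff of_nat_mult of_nat_add of_nat_1)
    then have "real n / real N < real m + 1" using N(1) by (simp add: divide_less_eq mult.commute)
    then have "exp (- real m) \<le> exp (1 + - (real n / real N))" by simp
    then show ?thesis by (simp only: exp_add)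
  qed
  have approx: "\<exists>y\<in>W. H_norm \<sigma> (\<lambda>x. u \<mu> x - y x) \<le> exp 1 * U * exp (- (real n / real N))"
    if \<mu>: "\<mu> \<in> {0..\<mu>max}" for \<mu>
  proof -
    have "0 \<le> \<mu>" "\<mu> \<le> real N * l" using \<mu> Nl by auto
    from interval_index[OF l N(1) this] obtain j where j: "j < N" "real j * l \<le> \<mu>" "\<mu> \<le> (real j + 1) * l" .
    note nr = node_range[OF j(1)]
    define P where "P k = (\<Prod>i<k. \<mu> - node j i)" for k
    define c where "c i = (if i < N * m \<and> i div m = j then P (i mod m) else 0)" for i
    obtain y where y: "y \<in> W" "y \<in> borel_measurable borel" "AE x in lborel. y x = (\<Sum>i<n. c i * v i x)"
      using W(2) by blast
    have block: "(\<Sum>i<n. c i * v i x) = (\<Sum>k<m. P k * newton (node j) k (node j k) x)" for x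
    proof (cases "m = 0")
      case True
      then show ?thesis by (simp add: c_def)
    next
      case False
      have "(j + 1) * m \<le> N * m" using j(1) by (intro mult_right_mono) auto
      then have jm: "j * m + m \<le> N * m" by simp
      also have "N * m \<le> n" by (simp add: m_def)
      finally have "(\<Sum>i<n. c i * v i x) = (\<Sum>k<m. c (j * m + k) * v (j * m + k) x)"
        by (rule sum_block) (use False in \<open>simp_all add: c_def\<close>)
      also have "\<dots> = (\<Sum>k<m. P k * newton (node j) k (node j k) x)"
      proof (rule sum.cong[OF refl])
        fix k assume "k \<in> {..<m}"
        then have k: "k < m" by simp
        then have "j * m + k < N * m" "(j * m + k) div m = j" "(j * m + k) mod m = k" using jm by auto
        then show "c (j * m + k) * v (j * m + k) x = P k * newton (node j) k (node j k) x"
          by (simp add: c_def v_def)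
      qed
      finally show ?thesis .
    qed
    have diff: "AE x in lborel. u \<mu> x - y x = P m * newton (node j) m \<mu> x"
      using y(3)
    proof eventually_elim
      case (elim x)
      have "u \<mu> x = (\<Sum>k<m. P k * newton (node j) k (node j k) x) + P m * newton (node j) m \<mu> x"
        unfolding P_def by (rule newton_expansion) (rule nr)
      then show ?case using elim block[of x] by simp
    qed
    have u_meas: "u \<mu> \<in> borel_measurable borel" by (rule H_OmegaD(1)[OF H_tilde_H_Omega[OF u_H_tilde[OF \<mu>]]])
    have n_meas: "newton (node j) m \<mu> \<in> borel_measurable borel"
      by (rule H_OmegaD(1)[OF H_tilde_H_Omega[OF newton_H_tilde[of "node j", OF nr \<mu>]]])
    have "H_norm \<sigma> (\<lambda>x. u \<mu> x - y x) = H_norm \<sigma> (\<lambda>x. P m * newton (node j) m \<mu> x)"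
      by (intro H_norm_cong_AE diff borel_measurable_diff borel_measurable_times borel_measurable_const u_meas n_meas y(2))
    also have "\<dots> \<le> exp (- real m) * U"
    proof (cases "m = 0")
      \<comment> \<open>Fewer than N dimensions leave no node per interval: the approximation is
        zero and the solution itself is bounded by U.\<close>
      case True
      then show ?thesis using u_bound[OF \<mu>] by (simp add: P_def U_def)
    next
      case False
      have "\<bar>\<mu> - node j i\<bar> \<le> l" for i
        using node_ge[of j i] node_le[of j i] j(2,3) unfolding distrib_right by linarith
      then have "H_norm \<sigma> (\<lambda>x. P m * newton (node j) m \<mu> x) \<le> (l / \<gamma>) ^ m * H_norm \<sigma> (u (node j 0))"
        unfolding P_def using False by (intro newton_remainder nr node_inj \<mu>) auto
      also have "\<dots> \<le> exp (- 1) ^ m * U"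
        using l \<gamma>_pos l\<gamma> u_bound[OF nr] unfolding U_def
        by (intro mult_mono power_mono) (auto simp: H_norm_nonneg)
      also have "exp (- 1) ^ m = exp (- real m)" by (simp flip: exp_of_nat_mult)
      finally show ?thesis .
    qed
    also have "\<dots> \<le> (exp 1 * exp (- (real n / real N))) * U" by (rule mult_right_mono[OF decay U0])
    finally show ?thesis using y(1) by (intro bexI[of _ y]) (simp_all only: mult_ac)
  qed
  show ?thesis
    unfolding kolmogorov_width_def U_def[symmetric]
  proof (rule INF_lower2[of W])
    show "W \<in> {W. subspace_of_dim (H_tilde (2 * \<sigma> / 2)) n W}" using W(1) by simp
    show "(SUP \<mu>\<in>{0..\<mu>max}. INF y\<in>W. ereal (H_norm (2 * \<sigma> / 2) (\<lambda>x. u \<mu> x - y x))) \<le>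
      ereal (exp 1 * U * exp (- (real n / real N)))"
    proof (rule SUP_least)
      fix \<mu> assume "\<mu> \<in> {0..\<mu>max}"
      from approx[OF this] obtain y where y: "y \<in> W" "H_norm \<sigma> (\<lambda>x. u \<mu> x - y x) \<le> exp 1 * U * exp (- (real n / real N))" by blast
      show "(INF y\<in>W. ereal (H_norm (2 * \<sigma> / 2) (\<lambda>x. u \<mu> x - y x))) \<le> ereal (exp 1 * U * exp (- (real n / real N)))"
        by (rule INF_lower2[OF y(1)]) (use y(2) in simp)
    qed
  qed
qed

end

section \<open>The rate in terms of \<open>alpha\<close>\<close>

lemma alpha_bound:
  obtains A where "0 < A" "\<And>s. s \<in> {1<..<2} \<Longrightarrow> alpha s \<le> A * (s - 1)" "\<And>s. 0 \<le> alpha s"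
proof -
  obtain g where g: "0 < g" "\<And>x::real. x \<in> {1..2} \<Longrightarrow> Gamma x \<le> g" using Gamma_bound by metis
  have bound: "alpha s \<le> (pi / 2 * (g ^ 4 / 8)) * (s - 1)" if s: "s \<in> {1<..<2}" for s
  proof -
    \<comment> \<open>Writing s pi/2 as (s - 1) pi/2 + pi/2 turns the cosine into a sine that
      vanishes linearly at s = 1, matching the lower bound \<kappa> (s - 1) for coercivity.\<close>
    have "s * p = (s - 1) * p + p" for p :: real by (simp add: algebra_simps)
    from this[of "pi / 2"] have "cos (s * (pi / 2)) = - sin ((s - 1) * (pi / 2))" by (simp only: cos_add cos_pi_half sin_pi_half)
    then have "\<bar>cos (s * (pi / 2))\<bar> \<le> (s - 1) * (pi / 2)"
      using abs_sin_x_le_abs_x[of "(s - 1) * (pi / 2)"] s by simp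
    moreover have "Gamma (s / 2 + 1) ^ 4 \<le> g ^ 4"
      using s g(2)[of "s / 2 + 1"] Gamma_real_pos[of "s / 2 + 1"] by (intro power_mono) auto
    ultimately have "alpha s \<le> ((s - 1) * (pi / 2)) * (g ^ 4 / 8)"
      unfolding alpha_def using s by (intro mult_mono) auto
    then show ?thesis by (simp only: mult_ac)
  qed
  show ?thesis
  proof (rule that)
    show "0 < pi / 2 * (g ^ 4 / 8)" using g(1) by simp
    show "alpha s \<le> (pi / 2 * (g ^ 4 / 8)) * (s - 1)" if "s \<in> {1<..<2}" for s by (rule bound[OF that])
    show "0 \<le> alpha s" for s by (simp add: alpha_def)
  qed
qed

lemma filterlim_inverse_at_right_1: "filterlim (\<lambda>s::real. 1 / (s - 1)) at_top (at_right 1)"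
  unfolding filterlim_at_right_to_0[of _ _ 1]
  using filterlim_inverse_at_top_right by (simp add: inverse_eq_divide)

text \<open>Both the available coercivity constant \<kappa> (s - 1) and the upper bound for
  \<open>alpha s\<close> are multiples of s - 1, so replacing one by the other costs a factor that c
  absorbs. All dependence on s left over goes into the constant in front.\<close>

theorem theorem5p2:
  fixes \<mu>max :: real and f :: "real \<Rightarrow> real" and u :: "real \<Rightarrow> real \<Rightarrow> real \<Rightarrow> real"
  assumes "0 < \<mu>max"
    and "f \<in> L2_Omega"
    and "\<And>s \<mu>. s \<in> {1<..<2} \<Longrightarrow> \<mu> \<in> {0..\<mu>max} \<Longrightarrow> weak_solution s \<mu> f (u s \<mu>)"
  shows "\<exists>c>0. \<exists>C :: real \<Rightarrow> real.
           filterlim C at_top (at_right 1) \<and>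
           (\<forall>s\<in>{1<..<2}. \<forall>n::nat.
              kolmogorov_width s {0..\<mu>max} (u s) n
                \<le> ereal (C s * exp (- (c * (alpha s * real n / \<mu>max)))))"
proof -
  obtain \<kappa> where \<kappa>: "0 < \<kappa>"
    "\<And>\<sigma> \<phi>. 1/2 < \<sigma> \<Longrightarrow> \<sigma> < 1 \<Longrightarrow> \<phi> \<in> test_functions \<Longrightarrow>
       \<kappa> * (2 * \<sigma> - 1) * (H_norm \<sigma> \<phi>)\<^sup>2 \<le> - L2_inner (RL_left \<sigma> \<phi>) (RL_right \<sigma> \<phi>)"
    using RL_coercive by metis
  obtain A where A: "0 < A" "\<And>s. s \<in> {1<..<2} \<Longrightarrow> alpha s \<le> A * (s - 1)" "\<And>s. 0 \<le> alpha s"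
    using alpha_bound by metis
  \<comment> \<open>Chosen so that c * alpha s * N \<le> \<mu>max for the number N of intervals used
    at any s; it involves neither s nor n.\<close>
  define c where "c = \<mu>max / (A * (exp 1 * \<mu>max / \<kappa> + 1))"
  have c: "0 < c" using assms(1) A(1) \<kappa>(1) by (simp add: c_def add_pos_pos)
  \<comment> \<open>The modulus makes B nonnegative for every real s, as used when C is compared
    with 1 / (s - 1).\<close>
  define B where "B s = exp 1 * \<bar>H_norm (s / 2) (u s 0) * (1 + \<mu>max / (\<kappa> * (s - 1)))\<bar>" for s
  \<comment> \<open>An upper bound may be enlarged: the second summand forces divergence at 1
    irrespective of the size of the solutions.\<close>
  define C where "C s = B s + 1 / (s - 1)" for s
  have B0: "0 \<le> B s" for s by (simp add: B_def)
  have "filterlim C at_top (at_right 1)"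
    by (rule filterlim_at_top_mono[OF filterlim_inverse_at_right_1]) (use B0 in \<open>simp add: C_def\<close>)
  moreover have "kolmogorov_width s {0..\<mu>max} (u s) n \<le> ereal (C s * exp (- (c * (alpha s * real n / \<mu>max))))"
    if s: "s \<in> {1<..<2}" for s n
  proof -
    define \<gamma> where "\<gamma> = \<kappa> * (s - 1)"
    have s1: "0 < s - 1" using s by simp
    have \<gamma>: "0 < \<gamma>" using \<kappa>(1) s1 by (simp add: \<gamma>_def)
    interpret parametric_problem "s / 2" \<gamma> \<mu>max f "u s"
    proof
      show "1 / 2 < s / 2" "s / 2 < 1" "0 < \<gamma>" using s \<gamma> by auto
      show "\<gamma> * (H_norm (s / 2) \<phi>)\<^sup>2 \<le> - L2_inner (RL_left (s / 2) \<phi>) (RL_right (s / 2) \<phi>)"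
        if "\<phi> \<in> test_functions" for \<phi>
        using \<kappa>(2)[of "s / 2" \<phi>] s that by (simp add: \<gamma>_def)
      show "weak_solution (2 * (s / 2)) \<mu> f (u s \<mu>)" if "\<mu> \<in> {0..\<mu>max}" for \<mu>
        using assms(3)[OF s that] by simp
    qed
    define N where "N = nat \<lceil>exp 1 * \<mu>max / \<gamma>\<rceil>"
    have q: "0 < exp 1 * \<mu>max / \<gamma>" using assms(1) \<gamma> by simp
    then have ceil: "0 < \<lceil>exp 1 * \<mu>max / \<gamma>\<rceil>" by (simp only: zero_less_ceiling)
    then have rN: "real N = of_int \<lceil>exp 1 * \<mu>max / \<gamma>\<rceil>" by (simp add: N_def)
    have N: "0 < N" "exp 1 * \<mu>max / \<gamma> \<le> real N" "real N \<le> exp 1 * \<mu>max / \<gamma> + 1"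
      using ceil unfolding rN by (simp add: N_def, linarith+)
    have rate: "c * (alpha s * real n / \<mu>max) \<le> real n / real N"
    proof -
      have "alpha s * real N \<le> (A * (s - 1)) * (exp 1 * \<mu>max / \<gamma> + 1)"
        using A(1) A(2)[OF s] A(3)[of s] N(3) s1 by (intro mult_mono) auto
      \<comment> \<open>The factor s - 1 from \<open>alpha\<close> cancels the one in \<gamma>; the
        term left over from rounding N up is below 1 because s < 2.\<close>
      also have "\<dots> = A * (exp 1 * \<mu>max / \<kappa> + (s - 1))"
        unfolding \<gamma>_def using s1 \<kappa>(1) by (simp add: field_simps)
      also have "\<dots> \<le> A * (exp 1 * \<mu>max / \<kappa> + 1)" using A(1) s by (intro mult_left_mono) auto
      finally have le: "alpha s * real N \<le> A * (exp 1 * \<mu>max / \<kappa> + 1)" .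
      have D: "0 < A * (exp 1 * \<mu>max / \<kappa> + 1)" using A(1) \<kappa>(1) assms(1) by (simp add: add_pos_pos)
      have "c / \<mu>max * (alpha s * real N) \<le> c / \<mu>max * (A * (exp 1 * \<mu>max / \<kappa> + 1))"
        using c assms(1) by (intro mult_left_mono le) simp
      also have "\<dots> = 1"
      proof -
        have alg: "x / d / x * d = 1" if "0 < x" "0 < d" for x d :: real using that by simp
        show ?thesis unfolding c_def by (rule alg[OF assms(1) D])
      qed
      finally have "(c / \<mu>max * (alpha s * real N)) * (real n / real N) \<le> 1 * (real n / real N)"
        by (intro mult_right_mono) auto
      moreover have "(c / \<mu>max * (alpha s * real N)) * (real n / real N) = c * (alpha s * real n / \<mu>max)"
        using N(1) by simp
      ultimately show ?thesis by simp
    qed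
    have U: "exp 1 * (H_norm (s / 2) (u s 0) * (1 + \<mu>max / \<gamma>)) \<le> C s"
      unfolding C_def B_def \<gamma>_def[symmetric] using s1
      by (intro add_increasing2 mult_left_mono abs_ge_self) auto
    have "kolmogorov_width s {0..\<mu>max} (u s) n \<le>
      ereal (exp 1 * (H_norm (s / 2) (u s 0) * (1 + \<mu>max / \<gamma>)) * exp (- (real n / real N)))"
      using width_bound[OF assms(1) N(1,2), of n] by simp
    also have "\<dots> \<le> ereal (C s * exp (- (c * (alpha s * real n / \<mu>max))))"
    proof -
      have "0 \<le> C s" using B0[of s] s1 by (simp add: C_def)
      then show ?thesis using U rate by (simp, intro mult_mono) auto
    qed
    finally show ?thesis .
  qed
  ultimately show ?thesis using c by blast
qed

end
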